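(* Let $\Phi$ be a finite irreducible crystallographic root system of rank $n$ in a Euclidean space $V$, with Weyl group $W$, and let $\mathcal P_\Phi^*\subseteq V^*$ be its polar root polytope. Then: \begin{enumerate} \item[(1)] If $\Phi$ is of type $\mathrm A_n$ or $\mathrm C_n$, then $\mathcal P_\Phi^*=\mathrm{ZT}(W\cdot o_1)$. \item[(2)] If $\Phi$ is of type $\mathrm B_3$, then $\mathcal P_\Phi^*=\mathrm{ZT}\left(W\cdot \frac{o_3}{2}\right)$. \item[(3)] If $\Phi$ is of type $\mathrm G_2$, then $\mathcal P_\Phi^*=\mathrm{ZT}\left(W\cdot \frac{o_1}{2}\right)$. \item[(4)] If $\Phi$ is of any other type (i.e. not of type $\mathrm A_n$, $\mathrm C_n$, $\mathrm B_3$ or $\mathrm G_2$), then $\mathcal P_\Phi^*$ is not a zonotope. \end{enumerate}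
   Context: Root systems are reduced. Fix a positive system $\Phi^+$ of $\Phi$ with root basis (simple roots) $\Pi=\{\alpha_1,\dots,\alpha_n\}$, numbered as in Bourbaki's tables: in type $\mathrm A_n$, $\alpha_1,\dots,\alpha_n$ are consecutive nodes of the Dynkin diagram; in type $\mathrm C_n$ ($n\ge 2$) they are consecutive nodes, with $\alpha_n$ the unique long simple root; in type $\mathrm B_3$ they are consecutive nodes, with $\alpha_3$ the unique short simple root; in type $\mathrm G_2$, $\alpha_1$ is the short simple root and $\alpha_2$ the long one. Types are considered up to isomorphism, so $\mathrm B_2=\mathrm C_2$ counts as type $\mathrm C_2$ (and $\mathrm D_3=\mathrm A_3$ as type $\mathrm A_3$). Let $\theta=\sum_{i=1}^n m_i\alpha_i$ be the highest root. Let $\omega_1^\vee,\dots,\omega_n^\vee\in V^*$ be the fundamental coweights, i.e. the dual basis of $\Pi$: $\langle\omega_i^\vee,\alpha_j\rangle=\delta_{ij}$, where $\langle\ ,\ \rangle$ is the natural pairing of $V^*$ and $V$. Set $o_i=\omega_i^\vee/m_i$. The Weyl group $W$ acts on $V$ and, by the dual action, on $V^*$ (equivalently, identify $V^*$ with $V$ through the scalar product); $W\cdot x$ denotes the orbit of $x$. The root polytope $\mathcal P_\Phi$ is the convex hull of all roots in $\Phi$, and the polar root polytope is $$\mathcal P_\Phi^*=\{x\in V^*\mid \langle x,v\rangle\le 1\text{ for all }v\in\mathcal P_\Phi\}.$$ For a finite subset $S=\{v_1,\dots,v_k\}$ (with the $v_i$ distinct) of a real vector space $U$, set $\mathrm{ZT}(S)=\left\{\sum_{i=1}^k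 t_iv_i\mid 0\le t_i\le 1\right\}$. A zonotope in $U$ is a polytope of the form $\left\{p+\sum_{i=1}^k t_iv_i\mid -\frac12\le t_i\le\frac12\right\}$ for some $p\in U$ and some finite subset $\{v_1,\dots,v_k\}$ of $U$. *)

theory Defs
  imports "HOL-Analysis.Analysis"
begin

section \<open>Root systems\<close>

text \<open>The Euclidean space \<open>V\<close> is the whole type \<open>'a\<close>, and roots span it, so the rank is \<open>DIM('a)\<close>.
  The dual space \<open>V\<^sup>*\<close> is the type \<open>'a \<Rightarrow>\<^sub>L real\<close> of bounded linear functionals, which on a
  Euclidean space are all linear functionals.\<close>

definition reflection :: "'a::euclidean_space \<Rightarrow> 'a \<Rightarrow> 'a" where
  "reflection a x = x - (2 * (x \<bullet> a) / (a \<bullet> a)) *\<^sub>R a"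

definition root_system :: "'a::euclidean_space set \<Rightarrow> bool" where
  "root_system \<Phi> \<longleftrightarrow>
     finite \<Phi> \<and> span \<Phi> = UNIV \<and> 0 \<notin> \<Phi> \<and>
     (\<forall>a\<in>\<Phi>. reflection a ` \<Phi> = \<Phi>) \<and>
     (\<forall>a\<in>\<Phi>. \<forall>c. c *\<^sub>R a \<in> \<Phi> \<longrightarrow> c = 1 \<or> c = - 1)"

definition crystallographic :: "'a::euclidean_space set \<Rightarrow> bool" where
  "crystallographic \<Phi> \<longleftrightarrow> (\<forall>a\<in>\<Phi>. \<forall>b\<in>\<Phi>. 2 * (a \<bullet> b) / (b \<bullet> b) \<in> \<int>)"

definition irreducible_roots :: "'a::euclidean_space set \<Rightarrow> bool" where
  "irreducible_roots \<Phi> \<longleftrightarrow>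
     \<Phi> \<noteq> {} \<and>
     (\<forall>A B. A \<union> B = \<Phi> \<and> A \<inter> B = {} \<and> (\<forall>a\<in>A. \<forall>b\<in>B. orthogonal a b) \<longrightarrow> A = {} \<or> B = {})"

inductive_set weyl_group :: "'a::euclidean_space set \<Rightarrow> ('a \<Rightarrow> 'a) set" for \<Phi> where
  weyl_id: "id \<in> weyl_group \<Phi>"
| weyl_reflection: "w \<in> weyl_group \<Phi> \<Longrightarrow> a \<in> \<Phi> \<Longrightarrow> reflection a \<circ> w \<in> weyl_group \<Phi>"

definition dual_action :: "('a::euclidean_space \<Rightarrow> 'a) \<Rightarrow> ('a \<Rightarrow>\<^sub>L real) \<Rightarrow> ('a \<Rightarrow>\<^sub>L real)" where
  "dual_action w x = Blinfun (\<lambda>v. blinfun_apply x (inv w v))"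

definition weyl_orbit :: "'a::euclidean_space set \<Rightarrow> ('a \<Rightarrow>\<^sub>L real) \<Rightarrow> ('a \<Rightarrow>\<^sub>L real) set" where
  "weyl_orbit \<Phi> x = (\<lambda>w. dual_action w x) ` weyl_group \<Phi>"


section \<open>Root bases and types\<close>

text \<open>A root basis is enumerated as \<open>\<alpha> 1, \<dots>, \<alpha> n\<close> with \<open>n = DIM('a)\<close>; values of \<open>\<alpha>\<close> at other indices
  are irrelevant. The corresponding positive system consists of the roots that are
  nonnegative combinations of the \<open>\<alpha> i\<close>.\<close>

definition root_basis :: "'a::euclidean_space set \<Rightarrow> (nat \<Rightarrow> 'a) \<Rightarrow> bool" where
  "root_basis \<Phi> \<alpha> \<longleftrightarrow>
     inj_on \<alpha> {1..DIM('a)} \<and> \<alpha> ` {1..DIM('a)} \<subseteq> \<Phi> \<and>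
     independent (\<alpha> ` {1..DIM('a)}) \<and> span (\<alpha> ` {1..DIM('a)}) = UNIV \<and>
     (\<forall>b\<in>\<Phi>. \<exists>c::nat \<Rightarrow> nat. b = (\<Sum>i=1..DIM('a). real (c i) *\<^sub>R \<alpha> i) \<or>
                            b = - (\<Sum>i=1..DIM('a). real (c i) *\<^sub>R \<alpha> i))"

text \<open>Cartan matrices with Bourbaki's numbering and convention:
  the \<open>(i, j)\<close> entry is \<open>2 (\<alpha> i \<bullet> \<alpha> j) / (\<alpha> j \<bullet> \<alpha> j)\<close>, so an entry \<open>- 2\<close> or \<open>- 3\<close>
  means that \<open>\<alpha> i\<close> is longer than \<open>\<alpha> j\<close>.\<close>

definition has_cartan_matrix :: "(nat \<Rightarrow> 'a::euclidean_space) \<Rightarrow> (nat \<Rightarrow> nat \<Rightarrow> int) \<Rightarrow> bool" where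
  "has_cartan_matrix \<alpha> C \<longleftrightarrow>
     (\<forall>i\<in>{1..DIM('a)}. \<forall>j\<in>{1..DIM('a)}. 2 * (\<alpha> i \<bullet> \<alpha> j) / (\<alpha> j \<bullet> \<alpha> j) = of_int (C i j))"

definition cartan_A :: "nat \<Rightarrow> nat \<Rightarrow> int" where
  "cartan_A i j = (if i = j then 2 else if i = Suc j \<or> j = Suc i then - 1 else 0)"

definition cartan_B :: "nat \<Rightarrow> nat \<Rightarrow> nat \<Rightarrow> int" where
  "cartan_B n i j = (if Suc i = n \<and> j = n then - 2 else cartan_A i j)"

definition cartan_C :: "nat \<Rightarrow> nat \<Rightarrow> nat \<Rightarrow> int" where
  "cartan_C n i j = (if i = n \<and> Suc j = n then - 2 else cartan_A i j)"

definition cartan_G2 :: "nat \<Rightarrow> nat \<Rightarrow> int" where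
  "cartan_G2 i j = (if i = 2 \<and> j = 1 then - 3 else cartan_A i j)"

text \<open>The following say that \<open>\<Phi>\<close> is of the given type and that \<open>\<alpha>\<close> is a root basis of \<open>\<Phi>\<close>
  in Bourbaki's numbering; so \<open>\<Phi>\<close> is of that type iff such an \<open>\<alpha>\<close> exists.\<close>

definition type_A :: "'a::euclidean_space set \<Rightarrow> (nat \<Rightarrow> 'a) \<Rightarrow> bool" where
  "type_A \<Phi> \<alpha> \<longleftrightarrow> root_basis \<Phi> \<alpha> \<and> has_cartan_matrix \<alpha> cartan_A"

definition type_C :: "'a::euclidean_space set \<Rightarrow> (nat \<Rightarrow> 'a) \<Rightarrow> bool" where
  "type_C \<Phi> \<alpha> \<longleftrightarrow> DIM('a) \<ge> 2 \<and> root_basis \<Phi> \<alpha> \<and> has_cartan_matrix \<alpha> (cartan_C DIM('a))"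

definition type_B3 :: "'a::euclidean_space set \<Rightarrow> (nat \<Rightarrow> 'a) \<Rightarrow> bool" where
  "type_B3 \<Phi> \<alpha> \<longleftrightarrow> DIM('a) = 3 \<and> root_basis \<Phi> \<alpha> \<and> has_cartan_matrix \<alpha> (cartan_B 3)"

definition type_G2 :: "'a::euclidean_space set \<Rightarrow> (nat \<Rightarrow> 'a) \<Rightarrow> bool" where
  "type_G2 \<Phi> \<alpha> \<longleftrightarrow> DIM('a) = 2 \<and> root_basis \<Phi> \<alpha> \<and> has_cartan_matrix \<alpha> cartan_G2"


section \<open>Highest root and coweights\<close>

definition is_highest_root :: "'a::euclidean_space set \<Rightarrow> (nat \<Rightarrow> 'a) \<Rightarrow> 'a \<Rightarrow> bool" where
  "is_highest_root \<Phi> \<alpha> \<theta> \<longleftrightarrow>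
     \<theta> \<in> \<Phi> \<and> (\<forall>b\<in>\<Phi>. \<exists>c::nat \<Rightarrow> nat. \<theta> - b = (\<Sum>i=1..DIM('a). real (c i) *\<^sub>R \<alpha> i))"

definition highest_root :: "'a::euclidean_space set \<Rightarrow> (nat \<Rightarrow> 'a) \<Rightarrow> 'a" where
  "highest_root \<Phi> \<alpha> = (THE \<theta>. is_highest_root \<Phi> \<alpha> \<theta>)"

text \<open>The coefficient \<open>m\<^sub>i\<close> of \<open>\<alpha> i\<close> in the highest root.\<close>

definition highest_root_coeff :: "'a::euclidean_space set \<Rightarrow> (nat \<Rightarrow> 'a) \<Rightarrow> nat \<Rightarrow> real" where
  "highest_root_coeff \<Phi> \<alpha> i = representation (\<alpha> ` {1..DIM('a)}) (highest_root \<Phi> \<alpha>) (\<alpha> i)"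

definition fundamental_coweight :: "(nat \<Rightarrow> 'a::euclidean_space) \<Rightarrow> nat \<Rightarrow> ('a \<Rightarrow>\<^sub>L real)" where
  "fundamental_coweight \<alpha> i =
     (THE x. \<forall>j\<in>{1..DIM('a)}. blinfun_apply x (\<alpha> j) = (if i = j then 1 else 0))"

text \<open>The vector \<open>o\<^sub>i = \<omega>\<^sub>i\<^sup>\<or> / m\<^sub>i\<close>.\<close>

definition scaled_coweight :: "'a::euclidean_space set \<Rightarrow> (nat \<Rightarrow> 'a) \<Rightarrow> nat \<Rightarrow> ('a \<Rightarrow>\<^sub>L real)" where
  "scaled_coweight \<Phi> \<alpha> i = fundamental_coweight \<alpha> i /\<^sub>R highest_root_coeff \<Phi> \<alpha> i"


section \<open>Root polytopes and zonotopes\<close>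

definition root_polytope :: "'a::euclidean_space set \<Rightarrow> 'a set" where
  "root_polytope \<Phi> = convex hull \<Phi>"

definition polar_root_polytope :: "'a::euclidean_space set \<Rightarrow> ('a \<Rightarrow>\<^sub>L real) set" where
  "polar_root_polytope \<Phi> = {x. \<forall>v\<in>root_polytope \<Phi>. blinfun_apply x v \<le> 1}"

text \<open>Intended for finite \<open>S\<close> only.\<close>

definition ZT :: "'b::real_vector set \<Rightarrow> 'b set" where
  "ZT S = {(\<Sum>v\<in>S. t v *\<^sub>R v) | t. \<forall>v\<in>S. 0 \<le> t v \<and> t v \<le> 1}"

definition zonotope :: "'b::real_vector set \<Rightarrow> bool" where
  "zonotope Z \<longleftrightarrow>
     (\<exists>p S. finite S \<and> Z = {p + (\<Sum>v\<in>S. t v *\<^sub>R v) | t. \<forall>v\<in>S. - (1/2) \<le> t v \<and> t v \<le> 1/2})"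

end

theory Submission
  imports Defs
begin

text \<open>The support function of the polar \<open>\<P>\<^sup>*\<close> is the gauge \<open>N\<close> of the root polytope, while the
  support function of a zonotope is, up to a linear form, a sum \<open>\<Sum>\<^sub>v \<bar>v y\<bar>\<close>. Such a sum satisfies
  Hlawka's inequality
  \<open>N (a + b) + N (b + c) + N (a + c) \<le> N a + N b + N c + N (a + b + c)\<close>, and
  the linear form contributes equally to both sides. Let \<open>a, b, c\<close> be mutually orthogonal roots of
  maximal length and let \<open>p\<close> be a long root making an angle of 60 degrees with each of them; call
  this a star. Then \<open>N (a + b) = 2\<close>, and likewise for the other two pairs, because the scalar product
  with \<open>(a + b) / L\<close> is at most 1 on all roots, where \<open>L\<close> is the maximal squared length; but
  \<open>N (a + b + c) \<le> 2\<close>, because \<open>a + b + c\<close> is the sum of the roots \<open>p\<close> and \<open>a + b + c - p\<close>. This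
  contradicts Hlawka's inequality (\<open>6 \<le> 5\<close>), so if \<open>\<P>\<^sup>*\<close> is a zonotope, then there is no star of
  long roots, i.e. no Dynkin diagram \<open>D\<^sub>4\<close> among them (\<open>zonotope_imp_star_free\<close>).

  Root systems without stars are determined directly, without the classification of all root systems
  (\<open>star_free_imp_type\<close>). Take a set \<open>T\<close> of points whose pairwise differences are long roots, i.e. a
  regular simplex, with as many points as possible; its differences form a subsystem of type \<open>A\<close>.
  A long root is either one of these differences or orthogonal to all of them: its scalar products
  with the differences split \<open>T\<close> into two parts; if one part is a single point the simplex can be
  enlarged, otherwise there is a star. By irreducibility the differences are all roots if there are
  no short roots: type \<open>A\<close>. Let \<open>s\<close> be a short root that is not orthogonal to all of
  the differences. It splits \<open>T\<close> in the same way, and the reflection of a difference in \<open>s\<close> is a long root and so again a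
  difference or orthogonal to all of them. If \<open>T\<close> has at least three points this determines both
  \<open>T\<close> and \<open>s\<close>: either \<open>T\<close> has four points and \<open>2 s = t + v - u - w\<close>, which gives \<open>B\<^sub>3\<close>, or it has three
  points and \<open>3 s = x + y - 2 z\<close> up to sign, which gives \<open>G\<^sub>2\<close>. If \<open>T\<close> has only two points, then the
  long roots form an orthogonal frame together with its negatives, and the short roots are the
  half-sums \<open>(\<plusminus>k \<plusminus> l) / 2\<close>: type \<open>C\<close>.

  Conversely, in the types \<open>A\<close>, \<open>C\<close>, \<open>B\<^sub>3\<close> and \<open>G\<^sub>2\<close> every root arises from the simple ones by simple reflections
  (\<open>root_induct\<close>). In suitable coordinates on \<open>V\<close> the simple reflections permute and negate the
  coordinate functionals, or act by a simple integer matrix in rank 2. From this one reads off the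
  roots, the highest root, and the orbit of the given coweight, and the two polytopes are compared
  through their coordinates.\<close>

section \<open>Reflections and zonotopes\<close>

lemma linear_reflection: "linear (reflection a)"
  by (rule linearI) (simp_all add: reflection_def inner_add_left algebra_simps add_divide_distrib)

lemma inner_reflection_reflection: "reflection a x \<bullet> reflection a y = x \<bullet> y"
  by (cases "a = 0") (simp_all add: reflection_def inner_diff_left inner_diff_right inner_commute field_simps)

lemma reflection_reflection [simp]: "reflection a (reflection a x) = x"
  by (cases "a = 0") (simp_all add: reflection_def inner_diff_left algebra_simps)

lemma reflection_self: "reflection a a = - a"
  by (cases "a = 0") (simp_all add: reflection_def scaleR_2)

text \<open>The one-dimensional case of Hlawka's inequality; summing it over the generators of a zonotope
  gives the inequality for support functions.\<close>

lemma Hlawka_real: "\<bar>x + y\<bar> + \<bar>y + z\<bar> + \<bar>x + z\<bar> \<le> \<bar>x\<bar> + \<bar>y\<bar> + \<bar>z\<bar> + \<bar>x + y + z\<bar>" for x y z :: real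
  by arith

text \<open>The support function \<open>h\<close> of a zonotope is a linear form plus a sum of absolute values of linear
  forms, so it satisfies Hlawka's inequality. The statement avoids \<open>h\<close>: upper bounds for the
  elements of \<open>Z\<close> bound it from above, single elements of \<open>Z\<close> bound it from below.\<close>

lemma zonotope_Hlawka:
  fixes Z :: "('a::euclidean_space \<Rightarrow>\<^sub>L real) set"
  assumes Z: "zonotope Z"
    and bounds: "\<And>x. x \<in> Z \<Longrightarrow> x a \<le> A" "\<And>x. x \<in> Z \<Longrightarrow> x b \<le> B" "\<And>x. x \<in> Z \<Longrightarrow> x c \<le> C"
      "\<And>x. x \<in> Z \<Longrightarrow> x (a + b + c) \<le> D"
    and mem: "x1 \<in> Z" "x2 \<in> Z" "x3 \<in> Z"
  shows "x1 (a + b) + x2 (b + c) + x3 (a + c) \<le> A + B + C + D"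
proof -
  obtain p S where fin: "finite S"
    and Zeq: "Z = {p + (\<Sum>v\<in>S. t v *\<^sub>R v) | t. \<forall>v\<in>S. - (1/2) \<le> t v \<and> t v \<le> (1/2::real)}"
    using Z unfolding zonotope_def by blast
  define h where "h y = blinfun_apply p y + (\<Sum>v\<in>S. \<bar>blinfun_apply v y\<bar>) / 2" for y
  have eval: "(p + (\<Sum>v\<in>S. t v *\<^sub>R v)) y = p y + (\<Sum>v\<in>S. t v * blinfun_apply v y)" for t y
    by (simp add: blinfun.add_left blinfun.sum_left blinfun.scaleR_left)
  have upper: "x y \<le> h y" if x: "x \<in> Z" for x y
  proof -
    obtain t where t: "\<forall>v\<in>S. - (1/2) \<le> t v \<and> t v \<le> (1/2::real)" "x = p + (\<Sum>v\<in>S. t v *\<^sub>R v)"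
      using x Zeq by blast
    have "t v * v y \<le> \<bar>v y\<bar> / 2" if "v \<in> S" for v
    proof -
      have "\<bar>t v\<bar> \<le> 1/2" using t(1) that by fastforce
      then have "\<bar>t v\<bar> * \<bar>v y\<bar> \<le> 1/2 * \<bar>v y\<bar>" by (intro mult_right_mono) auto
      moreover have "t v * v y \<le> \<bar>t v\<bar> * \<bar>v y\<bar>" by (metis abs_ge_self abs_mult)
      ultimately show ?thesis by simp
    qed
    then have "(\<Sum>v\<in>S. t v * blinfun_apply v y) \<le> (\<Sum>v\<in>S. \<bar>blinfun_apply v y\<bar> / 2)" by (rule sum_mono)
    then show ?thesis by (simp add: t(2) eval h_def sum_divide_distrib)
  qed
  \<comment> \<open>The maximum in direction \<open>y\<close> is attained where the coefficient of each \<open>v\<close> has the sign of \<open>v y\<close>.\<close>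
  have attained: "\<exists>x\<in>Z. x y = h y" for y
  proof -
    define x where "x = p + (\<Sum>v\<in>S. (sgn (blinfun_apply v y) / 2) *\<^sub>R v)"
    have "x \<in> Z" unfolding x_def Zeq
      by (rule CollectI, rule exI[of _ "\<lambda>v. sgn (blinfun_apply v y) / 2"]) (auto simp: sgn_if)
    moreover have "x y = h y"
      unfolding x_def eval h_def by (simp add: sum_divide_distrib sgn_mult_abs abs_sgn mult.commute)
    ultimately show ?thesis by blast
  qed
  have ub: "h a \<le> A" "h b \<le> B" "h c \<le> C" "h (a + b + c) \<le> D"
    using attained bounds by metis+
  have "(\<Sum>v\<in>S. \<bar>blinfun_apply v (a + b)\<bar>) + (\<Sum>v\<in>S. \<bar>blinfun_apply v (b + c)\<bar>) + (\<Sum>v\<in>S. \<bar>blinfun_apply v (a + c)\<bar>)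
     \<le> (\<Sum>v\<in>S. \<bar>blinfun_apply v a\<bar>) + (\<Sum>v\<in>S. \<bar>blinfun_apply v b\<bar>) + (\<Sum>v\<in>S. \<bar>blinfun_apply v c\<bar>) + (\<Sum>v\<in>S. \<bar>blinfun_apply v (a + b + c)\<bar>)"
    unfolding sum.distrib[symmetric] blinfun.add_right by (intro sum_mono Hlawka_real)
  then have "h (a + b) + h (b + c) + h (a + c) \<le> h a + h b + h c + h (a + b + c)"
    by (simp add: h_def blinfun.add_right)
  with ub upper[OF mem(1), of "a + b"] upper[OF mem(2), of "b + c"] upper[OF mem(3), of "a + c"]
  show ?thesis by linarith
qed

lemma polar_root_polytope_eq: "polar_root_polytope \<Phi> = {x. \<forall>a\<in>\<Phi>. blinfun_apply x a \<le> 1}"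
proof -
  have "x v \<le> 1" if x: "\<forall>a\<in>\<Phi>. x a \<le> 1" and v: "v \<in> convex hull \<Phi>" for x :: "'a \<Rightarrow>\<^sub>L real" and v
  proof -
    have "convex {u. blinfun_apply x u \<le> 1}"
    proof (rule convexI)
      fix u w and s t :: real
      assume "u \<in> {u. x u \<le> 1}" "w \<in> {u. x u \<le> 1}" "0 \<le> s" "0 \<le> t" "s + t = 1"
      then show "s *\<^sub>R u + t *\<^sub>R w \<in> {u. x u \<le> 1}"
        using convex_bound_le[of "x u" 1 "x w" s t] by (simp add: blinfun.add_right blinfun.scaleR_right)
    qed
    then have "convex hull \<Phi> \<subseteq> {u. x u \<le> 1}" using x by (intro hull_minimal) auto
    with v show ?thesis by auto
  qed
  then show ?thesis
    unfolding polar_root_polytope_def root_polytope_def by (auto intro: hull_inc)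
qed

section \<open>Long roots and stars\<close>

locale irreducible_root_system =
  fixes \<Phi> :: "'a::euclidean_space set"
  assumes root_system: "root_system \<Phi>"
    and crystallographic: "crystallographic \<Phi>"
    and irreducible: "irreducible_roots \<Phi>"
begin

lemma finite_roots: "finite \<Phi>" and span_roots: "span \<Phi> = UNIV"
  and zero_not_root: "0 \<notin> \<Phi>" and roots_nonempty: "\<Phi> \<noteq> {}"
  using root_system irreducible by (auto simp: root_system_def irreducible_roots_def)

lemma reflection_root: "a \<in> \<Phi> \<Longrightarrow> b \<in> \<Phi> \<Longrightarrow> reflection a b \<in> \<Phi>"
  using root_system unfolding root_system_def by blast

lemma minus_root: "a \<in> \<Phi> \<Longrightarrow> - a \<in> \<Phi>"
  using reflection_root[of a a] by (simp add: reflection_self)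

lemma multiple_root: "a \<in> \<Phi> \<Longrightarrow> c *\<^sub>R a \<in> \<Phi> \<Longrightarrow> c = 1 \<or> c = - 1"
  using root_system unfolding root_system_def by blast

lemma Cartan_integer: "a \<in> \<Phi> \<Longrightarrow> b \<in> \<Phi> \<Longrightarrow> 2 * (a \<bullet> b) / (b \<bullet> b) \<in> \<int>"
  using crystallographic unfolding crystallographic_def by blast

definition max_sqnorm :: real where "max_sqnorm = Max ((\<lambda>r. r \<bullet> r) ` \<Phi>)"

abbreviation L :: real where "L \<equiv> max_sqnorm"

definition long :: "'a set" where "long = {l \<in> \<Phi>. l \<bullet> l = L}"

lemma long_root: "l \<in> long \<Longrightarrow> l \<in> \<Phi>" and long_sqnorm: "l \<in> long \<Longrightarrow> l \<bullet> l = L"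
  by (auto simp: long_def)

lemma sqnorm_le: "r \<in> \<Phi> \<Longrightarrow> r \<bullet> r \<le> L"
  unfolding max_sqnorm_def using finite_roots by (intro Max_ge) auto

lemma long_exists: "\<exists>l. l \<in> long"
proof -
  have "L \<in> (\<lambda>r. r \<bullet> r) ` \<Phi>"
    unfolding max_sqnorm_def using finite_roots roots_nonempty by (intro Max_in) auto
  then show ?thesis by (auto simp: long_def)
qed

lemma L_pos: "L > 0"
  using long_exists zero_not_root long_root long_sqnorm by (metis inner_gt_zero_iff)

lemma minus_long: "l \<in> long \<Longrightarrow> - l \<in> long"
  by (auto simp: long_def minus_root)

lemma reflection_long: "a \<in> \<Phi> \<Longrightarrow> l \<in> long \<Longrightarrow> reflection a l \<in> long"
  by (auto simp: long_def reflection_root inner_reflection_reflection)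

text \<open>The Cartan integer of a root and a longer or equally long root is \<open>0\<close> or \<open>\<plusminus>1\<close>, unless the two
  are proportional.\<close>

lemma inner_long:
  assumes r: "r \<in> \<Phi>" and l: "l \<in> long" and ne: "r \<noteq> l" "r \<noteq> - l"
  shows "r \<bullet> l = 0 \<or> r \<bullet> l = L / 2 \<or> r \<bullet> l = - L / 2"
proof -
  obtain k :: int where k: "2 * (r \<bullet> l) / L = of_int k"
    using Cartan_integer[OF r long_root[OF l]] long_sqnorm[OF l] by (auto elim: Ints_cases)
  then have rl: "r \<bullet> l = of_int k * L / 2" using L_pos by (simp add: field_simps)
  have "r \<bullet> l < L"
  proof (rule ccontr)
    assume "\<not> r \<bullet> l < L"
    then have "(r - l) \<bullet> (r - l) \<le> 0"
      using sqnorm_le[OF r] long_sqnorm[OF l] by (simp add: inner_diff_left inner_diff_right inner_commute)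
    then show False using ne(1) by (metis inner_gt_zero_iff not_le right_minus_eq)
  qed
  moreover have "- L < r \<bullet> l"
  proof (rule ccontr)
    assume "\<not> - L < r \<bullet> l"
    then have "(r + l) \<bullet> (r + l) \<le> 0"
      using sqnorm_le[OF r] long_sqnorm[OF l] by (simp add: inner_add_left inner_add_right inner_commute)
    then show False using ne(2) by (metis inner_gt_zero_iff not_le eq_neg_iff_add_eq_0)
  qed
  ultimately have "of_int k * L < 2 * L" "- 2 * L < of_int k * L" using rl by linarith+
  then have "of_int k * L < 2 * L" "(- 2) * L < of_int k * L" by auto
  then have "of_int k < (2::real)" "- 2 < (of_int k :: real)"
    using L_pos by (simp_all only: mult_less_cancel_right_pos)
  then have "k = 0 \<or> k = 1 \<or> k = - 1" by linarith
  then show ?thesis using rl by auto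
qed

lemma diff_long:
  assumes "k \<in> long" "l \<in> long" "k \<bullet> l = L / 2"
  shows "k - l \<in> long"
  using reflection_long[OF long_root[OF assms(2)] assms(1)] assms L_pos
  by (simp add: reflection_def long_sqnorm)

text \<open>The roots \<open>p\<close>, \<open>-a\<close>, \<open>-b\<close>, \<open>-c\<close> of a star form the Dynkin diagram \<open>D\<^sub>4\<close> with centre \<open>p\<close>.\<close>

definition star_free :: bool where
  "star_free \<longleftrightarrow> (\<forall>p a b c. {p, a, b, c} \<subseteq> long \<longrightarrow> a \<bullet> b = 0 \<longrightarrow> b \<bullet> c = 0 \<longrightarrow> a \<bullet> c = 0 \<longrightarrow>
      p \<bullet> a = L / 2 \<longrightarrow> p \<bullet> b = L / 2 \<longrightarrow> p \<bullet> c \<noteq> L / 2)"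

text \<open>This shows that \<open>(a + b) / L\<close>, as a functional, lies in the polar of the root polytope; its value
  2 at \<open>a + b\<close> is the largest possible one, since \<open>a\<close> and \<open>b\<close> are roots.\<close>

lemma inner_sum_orthogonal_long:
  assumes a: "a \<in> long" and b: "b \<in> long" and ab: "a \<bullet> b = 0" and r: "r \<in> \<Phi>"
  shows "(a + b) \<bullet> r \<le> L"
proof (cases "r = a \<or> r = - a \<or> r = b \<or> r = - b")
  case True
  then show ?thesis
    using ab long_sqnorm[OF a] long_sqnorm[OF b] L_pos by (auto simp: inner_add_left inner_add_right inner_commute)
next
  case False
  then have "r \<bullet> a \<le> L / 2" "r \<bullet> b \<le> L / 2"
    using inner_long[OF r a] inner_long[OF r b] L_pos by auto
  then show ?thesis by (simp add: inner_add_left inner_add_right inner_commute)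
qed

text \<open>On a star, Hlawka's inequality for the support function of the polar would read
  \<open>2 + 2 + 2 \<le> 1 + 1 + 1 + 2\<close>.\<close>

lemma zonotope_imp_star_free:
  assumes "zonotope (polar_root_polytope \<Phi>)"
  shows star_free
  unfolding star_free_def
proof (intro allI impI notI)
  fix p a b c
  assume mem: "{p, a, b, c} \<subseteq> long" and orth: "a \<bullet> b = 0" "b \<bullet> c = 0" "a \<bullet> c = 0"
    and pa: "p \<bullet> a = L / 2" and pb: "p \<bullet> b = L / 2" and pc: "p \<bullet> c = L / 2"
  \<comment> \<open>Up to sign this is the image of \<open>p\<close> under the reflections in \<open>a\<close>, \<open>b\<close> and \<open>c\<close>.\<close>
  have q: "a + b + c - p \<in> long"
  proof -
    have 1: "p - a \<in> long" using diff_long[of p a] mem pa by auto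
    have 2: "p - a - b \<in> long" using diff_long[OF 1, of b] mem pb orth by (auto simp: inner_diff_left)
    have "p - a - b - c \<in> long" using diff_long[OF 2, of c] mem pc orth by (auto simp: inner_diff_left)
    from minus_long[OF this] show ?thesis by (simp add: algebra_simps)
  qed
  have pol: "blinfun_inner_left ((1 / L) *\<^sub>R (u + v)) \<in> polar_root_polytope \<Phi>"
    if "u \<in> long" "v \<in> long" "u \<bullet> v = 0" for u v
  proof -
    have "((1 / L) *\<^sub>R (u + v)) \<bullet> r \<le> 1" if "r \<in> \<Phi>" for r
      using inner_sum_orthogonal_long[OF \<open>u \<in> long\<close> \<open>v \<in> long\<close> \<open>u \<bullet> v = 0\<close> that] L_pos by (simp only: inner_scaleR_left) (simp add: field_simps)
    then show ?thesis by (auto simp: polar_root_polytope_eq inner_commute)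
  qed
  have val: "blinfun_inner_left ((1 / L) *\<^sub>R (u + v)) (u + v) = 2"
    if "u \<in> long" "v \<in> long" "u \<bullet> v = 0" for u v
    using that L_pos by (simp add: inner_add_left inner_add_right inner_commute long_sqnorm)
  have root: "x r \<le> 1" if "x \<in> polar_root_polytope \<Phi>" "r \<in> long" for x r
    using that by (auto simp: polar_root_polytope_eq long_root)
  have "x (a + b + c) \<le> 2" if "x \<in> polar_root_polytope \<Phi>" for x
  proof -
    have "x (a + b + c) = x p + x (a + b + c - p)" by (simp flip: blinfun.add_right)
    then show ?thesis using root[OF that q] root[OF that, of p] mem by auto
  qed
  from zonotope_Hlawka[OF assms _ _ _ this pol[of a b] pol[of b c] pol[of a c], of 1 1 1]
  show False using mem orth root val[of a b] val[of b c] val[of a c] by auto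
qed


section \<open>Simplices of long roots\<close>

text \<open>The form in which irreducibility is applied: the roots inside the span of \<open>S\<close> and those outside
  are mutually orthogonal, so one of the two sets is empty.\<close>

lemma all_roots_in_span:
  assumes r0: "r0 \<in> \<Phi>" "r0 \<in> span S"
    and split: "\<And>r. r \<in> \<Phi> \<Longrightarrow> r \<in> span S \<or> (\<forall>x\<in>S. r \<bullet> x = 0)"
  shows "\<Phi> \<subseteq> span S"
proof -
  define A where "A = \<Phi> \<inter> span S"
  define B where "B = \<Phi> - span S"
  have "orthogonal a b" if "a \<in> A" "b \<in> B" for a b
  proof -
    have "orthogonal b x" if "x \<in> S" for x
      using split[of b] \<open>b \<in> B\<close> that by (auto simp: B_def orthogonal_def)
    then have "orthogonal b a"
      using orthogonal_to_span[of a S b] \<open>a \<in> A\<close> by (auto simp: A_def)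
    then show ?thesis by (simp add: orthogonal_commute)
  qed
  moreover have "A \<union> B = \<Phi>" "A \<inter> B = {}" by (auto simp: A_def B_def)
  ultimately have "A = {} \<or> B = {}"
    using irreducible unfolding irreducible_roots_def by blast
  with r0 show ?thesis by (auto simp: A_def B_def)
qed

lemma no_root_orthogonal:
  assumes "r0 \<in> \<Phi>" "r0 \<in> span S"
    and "\<And>r. r \<in> \<Phi> \<Longrightarrow> r \<in> span S \<or> (\<forall>x\<in>S. r \<bullet> x = 0)"
    and r: "r \<in> \<Phi>" "\<forall>x\<in>S. r \<bullet> x = 0"
  shows False
proof -
  have "r \<in> span S" using all_roots_in_span[OF assms(1-3)] r(1) by blast
  moreover have "orthogonal r x" if "x \<in> S" for x using r(2) that by (simp add: orthogonal_def)
  ultimately have "orthogonal r r" using orthogonal_to_span[of r S r] by blast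
  then show False using r(1) zero_not_root by (auto simp: orthogonal_def)
qed

text \<open>All edges have the same length, so the points of \<open>T\<close> are the vertices of a regular simplex, and
  its edge vectors form a root system of type \<open>A\<close> (the standard model being
  \<open>T = {e\<^sub>0, \<dots>, e\<^sub>n}\<close>).\<close>

definition long_simplex :: "'a set \<Rightarrow> bool" where
  "long_simplex T \<longleftrightarrow> finite T \<and> (\<forall>t\<in>T. \<forall>u\<in>T. t \<noteq> u \<longrightarrow> t - u \<in> long)"

definition edges :: "'a set \<Rightarrow> 'a set" where
  "edges T = {t - u | t u. t \<in> T \<and> u \<in> T \<and> t \<noteq> u}"

definition maximal_simplex :: "'a set \<Rightarrow> bool" where
  "maximal_simplex T \<longleftrightarrow> long_simplex T \<and> (\<forall>U. long_simplex U \<longrightarrow> card U \<le> card T)"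

lemma edgesI: "t \<in> T \<Longrightarrow> u \<in> T \<Longrightarrow> t \<noteq> u \<Longrightarrow> t - u \<in> edges T"
  by (auto simp: edges_def)

lemma edges_long: "long_simplex T \<Longrightarrow> edges T \<subseteq> long"
  by (auto simp: long_simplex_def edges_def)

lemma minus_edge: "r \<in> edges T \<Longrightarrow> - r \<in> edges T"
  unfolding edges_def by (force simp: algebra_simps)

text \<open>Polarisation: the distances determine all scalar products of edges, with the same result as for
  the differences of an orthogonal basis.\<close>

lemma inner_edges:
  assumes T: "long_simplex T" and mem: "t \<in> T" "u \<in> T" "v \<in> T" "w \<in> T"
  shows "(t - u) \<bullet> (v - w) =
    L / 2 * (of_bool (t = v) - of_bool (t = w) - of_bool (u = v) + of_bool (u = w))"
proof -
  have d: "(x - y) \<bullet> (x - y) = L * (1 - of_bool (x = y))" if "x \<in> T" "y \<in> T" for x y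
    using T that long_sqnorm[of "x - y"] by (auto simp: long_simplex_def)
  have "2 * ((t - u) \<bullet> (v - w)) =
      (t - w) \<bullet> (t - w) + (u - v) \<bullet> (u - v) - (t - v) \<bullet> (t - v) - (u - w) \<bullet> (u - w)"
    by (simp add: inner_diff_left inner_diff_right inner_commute)
  also have "\<dots> = L * (of_bool (t = v) - of_bool (t = w) - of_bool (u = v) + of_bool (u = w))"
    unfolding d[OF mem(1,4)] d[OF mem(2,3)] d[OF mem(1,3)] d[OF mem(2,4)] by (simp add: algebra_simps)
  finally show ?thesis by (simp add: field_simps)
qed

lemma inner_edge_self: "long_simplex T \<Longrightarrow> t \<in> T \<Longrightarrow> u \<in> T \<Longrightarrow> t \<noteq> u \<Longrightarrow> (t - u) \<bullet> (t - u) = L"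
  by (simp add: inner_edges)

text \<open>The number of points is bounded, since the points differ from one of them by roots.\<close>

lemma maximal_simplex_exists: "\<exists>T. maximal_simplex T \<and> 2 \<le> card T"
proof -
  obtain l where l: "l \<in> long" using long_exists by blast
  have l0: "l \<noteq> 0" using l zero_not_root long_root by blast
  have base: "long_simplex {0, l}" using l minus_long[OF l] by (auto simp: long_simplex_def)
  have bound: "card U \<le> card \<Phi> + 1" if U: "long_simplex U" for U
  proof (cases "U = {}")
    case False
    then obtain u where u: "u \<in> U" by blast
    have "card U = card ((\<lambda>x. x - u) ` U)" by (simp add: card_image)
    also have "\<dots> \<le> card (insert 0 \<Phi>)"
    proof (rule card_mono)
      have "x - u \<in> insert 0 \<Phi>" if "x \<in> U" for x
        using U u that long_root[of "x - u"] by (cases "x = u") (simp_all add: long_simplex_def)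
      then show "(\<lambda>x. x - u) ` U \<subseteq> insert 0 \<Phi>" by blast
    qed (simp add: finite_roots)
    also have "\<dots> \<le> card \<Phi> + 1" using finite_roots by (simp add: card_insert_if)
    finally show ?thesis .
  qed simp
  have "\<forall>U. long_simplex U \<longrightarrow> card U < card \<Phi> + 2" using bound by fastforce
  from ex_has_greatest_nat[of long_simplex "{0, l}" card, OF base this]
  obtain T where "long_simplex T" and T: "\<forall>U. long_simplex U \<longrightarrow> card U \<le> card T" by blast
  moreover have "card {0, l} = 2" using l0 by simp
  with T base have "2 \<le> card T" by metis
  ultimately show ?thesis unfolding maximal_simplex_def by blast
qed

lemma simplex_insert_bounded:
  assumes T: "maximal_simplex T" and x: "x \<notin> T" "\<And>t. t \<in> T \<Longrightarrow> t - x \<in> long"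
  shows False
proof -
  have "x - t \<in> long" if "t \<in> T" for t using minus_long[OF x(2)[OF that]] by simp
  then have "long_simplex (insert x T)"
    using T x by (auto simp: maximal_simplex_def long_simplex_def)
  moreover have "card (insert x T) = Suc (card T)"
    using T x(1) by (simp add: maximal_simplex_def long_simplex_def)
  ultimately show False using T by (auto simp: maximal_simplex_def)
qed

text \<open>For fixed \<open>r\<close>, these differences of \<open>r \<bullet> t\<close> are at most \<open>L / 2\<close> in absolute value for all pairs, so
  \<open>r \<bullet> t\<close> takes at most two values on \<open>T\<close>: each such root splits \<open>T\<close> into two parts.\<close>

lemma inner_edge_values:
  assumes T: "long_simplex T" and r: "r \<in> \<Phi>" "r \<notin> edges T" and tu: "t \<in> T" "u \<in> T"
  shows "r \<bullet> (t - u) = 0 \<or> r \<bullet> (t - u) = L / 2 \<or> r \<bullet> (t - u) = - L / 2"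
proof (cases "t = u")
  case False
  then have e: "t - u \<in> edges T" using tu by (simp add: edgesI)
  then have "r \<noteq> t - u" "r \<noteq> - (t - u)" using r(2) minus_edge by blast+
  with inner_long[OF r(1), of "t - u"] e edges_long[OF T] show ?thesis by blast
qed simp

text \<open>Suppose that \<open>r\<close> splits \<open>T\<close> into \<open>I\<close> (containing \<open>t\<close>, value \<open>L / 2\<close> relative to \<open>u\<close>) and \<open>J\<close> (containing
  \<open>u\<close>, value \<open>0\<close>). If \<open>I = {t}\<close> then \<open>t - r\<close> is a further vertex, and if \<open>J = {u}\<close> then \<open>u + r\<close> is one.
  Otherwise there are a second point \<open>t'\<close> in \<open>I\<close> and a second point \<open>u'\<close> in \<open>J\<close>, and \<open>t - u\<close> is the centre of a
  star with leaves \<open>t - t'\<close>, \<open>u' - u\<close> and \<open>r\<close>.\<close>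

lemma long_edge_or_orthogonal:
  assumes T: "maximal_simplex T" and star: star_free and r: "r \<in> long" "r \<notin> edges T"
    and tu: "t \<in> T" "u \<in> T"
  shows "r \<bullet> (t - u) = 0"
proof -
  have S: "long_simplex T" using T by (simp add: maximal_simplex_def)
  have no: False if r: "r \<in> long" "r \<notin> edges T" and tu: "t \<in> T" "u \<in> T" and val: "r \<bullet> (t - u) = L / 2"
    for r t u
  proof -
    have rP: "r \<in> \<Phi>" using r(1) long_root by blast
    have r0: "r \<noteq> 0" using rP zero_not_root by auto
    have tu_ne: "t \<noteq> u" using val L_pos by auto
    have two: "r \<bullet> (v - u) = 0 \<or> r \<bullet> (v - u) = L / 2" if v: "v \<in> T" for v
    proof -
      have "r \<bullet> (t - v) = L / 2 - r \<bullet> (v - u)" using val by (simp add: inner_diff_right)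
      then show ?thesis
        using inner_edge_values[OF S rP r(2) v tu(2)] inner_edge_values[OF S rP r(2) tu(1) v] L_pos
        by linarith
    qed
    show False
    proof (cases "\<exists>v\<in>T. v \<noteq> t \<and> r \<bullet> (v - u) = L / 2")
      case noI: False
      have "v - (t - r) \<in> long" if v: "v \<in> T" for v
      proof (cases "v = t")
        case False
        then have "r \<bullet> (v - u) = 0" using noI two[OF v] v by blast
        then have "r \<bullet> (t - v) = L / 2" using val by (simp add: inner_diff_right)
        then have "(t - v) \<bullet> r = L / 2" by (simp add: inner_commute)
        then have "(t - v) - r \<in> long"
          using diff_long[of "t - v" r] r(1) S tu(1) v False by (auto simp: long_simplex_def)
        from minus_long[OF this] show ?thesis by (simp add: algebra_simps)
      qed (use r(1) in simp)
      moreover have "t - r \<notin> T"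
      proof
        assume "t - r \<in> T"
        from edgesI[OF tu(1) this] show False using r(2) r0 by simp
      qed
      ultimately show False using simplex_insert_bounded[OF T] by blast
    next
      case True
      then obtain t' where t': "t' \<in> T" "t' \<noteq> t" "r \<bullet> (t' - u) = L / 2" by blast
      show False
      proof (cases "\<exists>v\<in>T. v \<noteq> u \<and> r \<bullet> (v - u) = 0")
        case noJ: False
        have "v - (u + r) \<in> long" if v: "v \<in> T" for v
        proof (cases "v = u")
          case False
          then have "r \<bullet> (v - u) = L / 2" using noJ two[OF v] v by blast
          then have "(v - u) \<bullet> r = L / 2" by (simp add: inner_commute)
          then have "(v - u) - r \<in> long"
            using diff_long[of "v - u" r] r(1) S tu(2) v False by (auto simp: long_simplex_def)
          then show ?thesis by (simp add: algebra_simps)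
        qed (use minus_long[OF r(1)] in simp)
        moreover have "u + r \<notin> T"
        proof
          assume "u + r \<in> T"
          from edgesI[OF this tu(2)] show False using r(2) r0 by simp
        qed
        ultimately show False using simplex_insert_bounded[OF T] by blast
      next
        case True
        then obtain u' where u': "u' \<in> T" "u' \<noteq> u" "r \<bullet> (u' - u) = 0" by blast
        have d: "t' \<noteq> u" "u' \<noteq> t" "t' \<noteq> u'" using t'(3) u'(3) val L_pos by auto
        have 1: "{t - u, t - t', u' - u, r} \<subseteq> long"
          using S r(1) t'(1,2) u'(1,2) tu tu_ne unfolding long_simplex_def by simp
        have 2: "(t - t') \<bullet> (u' - u) = 0" "(t - u) \<bullet> (t - t') = L / 2" "(t - u) \<bullet> (u' - u) = L / 2"
          using tu t' u' d tu_ne by (simp_all add: inner_edges[OF S])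
        have 3: "(u' - u) \<bullet> r = 0" "(t - t') \<bullet> r = 0" "(t - u) \<bullet> r = L / 2"
          using t'(3) u'(3) val by (simp_all add: inner_diff_left inner_diff_right inner_commute)
        show False
          using star[unfolded star_free_def, rule_format, OF 1 2(1) 3(1) 3(2) 2(2) 2(3)] 3(3) by blast
      qed
    qed
  qed
  have "r \<bullet> (t - u) \<noteq> L / 2" using no[OF r tu] by blast
  moreover have "r \<bullet> (t - u) \<noteq> - L / 2"
  proof
    assume "r \<bullet> (t - u) = - L / 2"
    then have "r \<bullet> (u - t) = L / 2" by (simp add: inner_diff_right)
    then show False using no[OF r tu(2,1)] by blast
  qed
  ultimately show ?thesis using inner_edge_values[OF S long_root[OF r(1)] r(2) tu] by blast
qed

section \<open>Short roots\<close>

text \<open>The Cartan integer \<open>k = L / (s \<bullet> s)\<close> exceeds 1 as \<open>s\<close> is short, and \<open>l \<noteq> 2 s\<close> (the system is reduced)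
  gives \<open>k < 4\<close>.\<close>

lemma short_sqnorm:
  assumes s: "s \<in> \<Phi>" "s \<notin> long" and l: "l \<in> long" and val: "s \<bullet> l = L / 2"
  shows "s \<bullet> s = L / 2 \<or> s \<bullet> s = L / 3"
proof -
  have s0: "s \<bullet> s > 0" using s zero_not_root by (metis inner_gt_zero_iff)
  have "s \<bullet> s < L" using s sqnorm_le[OF s(1)] by (auto simp: long_def)
  obtain k :: int where k: "2 * (l \<bullet> s) / (s \<bullet> s) = of_int k"
    using Cartan_integer[OF long_root[OF l] s(1)] by (auto elim: Ints_cases)
  then have kL: "of_int k * (s \<bullet> s) = L" using val s0 by (simp add: field_simps inner_commute)
  have "l - 2 *\<^sub>R s \<noteq> 0"
  proof
    assume "l - 2 *\<^sub>R s = 0"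
    then have "2 *\<^sub>R s \<in> \<Phi>" using long_root[OF l] by simp
    from multiple_root[OF s(1) this] show False by simp
  qed
  then have "0 < (l - 2 *\<^sub>R s) \<bullet> (l - 2 *\<^sub>R s)" by simp
  also have "\<dots> = 4 * (s \<bullet> s) - L"
    using val long_sqnorm[OF l] by (simp add: inner_diff_left inner_diff_right inner_commute)
  finally have "of_int k * (s \<bullet> s) < 4 * (s \<bullet> s)" using kL by linarith
  then have "of_int k < (4::real)" using s0 by (simp only: mult_less_cancel_right_pos)
  moreover have "1 * (s \<bullet> s) < of_int k * (s \<bullet> s)" using kL \<open>s \<bullet> s < L\<close> by simp
  then have "1 < (of_int k :: real)" using s0 by (simp only: mult_less_cancel_right_pos)
  ultimately have "k = 2 \<or> k = 3" by linarith
  then show ?thesis using kL by auto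
qed

text \<open>The differences below are the images of \<open>l\<close> under the reflection in \<open>s\<close>.\<close>

lemma diff_short_half:
  assumes "s \<in> \<Phi>" "l \<in> long" "s \<bullet> l = L / 2" "s \<bullet> s = L / 2"
  shows "l - 2 *\<^sub>R s \<in> long"
proof -
  have "2 * (l \<bullet> s) / (s \<bullet> s) = 2"
    unfolding inner_commute[of l s] assms(3,4) using L_pos by simp
  then show ?thesis using reflection_long[OF assms(1,2)] by (simp add: reflection_def)
qed

lemma diff_short_third:
  assumes "s \<in> \<Phi>" "l \<in> long" "s \<bullet> l = L / 2" "s \<bullet> s = L / 3"
  shows "l - 3 *\<^sub>R s \<in> long"
proof -
  have "2 * (l \<bullet> s) / (s \<bullet> s) = 3"
    unfolding inner_commute[of l s] assms(3,4) using L_pos by simp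
  then show ?thesis using reflection_long[OF assms(1,2)] by (simp add: reflection_def)
qed

text \<open>The reflection \<open>r = t - u - 2 s\<close> of \<open>t - u\<close> is orthogonal to \<open>t - u\<close>, but a third point of \<open>T\<close> yields an edge that
  is not orthogonal to \<open>r\<close>. Hence \<open>r\<close> is an edge \<open>w - v\<close>; its end points
  are distinct from \<open>t\<close> and \<open>u\<close>, and it determines \<open>s\<close>.
  A fifth point of \<open>T\<close> would have the scalar product \<open>L / 4\<close> with \<open>s\<close>, relative to \<open>u\<close>.\<close>

lemma short_half_form:
  assumes T: "maximal_simplex T" and star: star_free and card: "3 \<le> card T"
    and s: "s \<in> \<Phi>" "s \<bullet> s = L / 2" and tu: "t \<in> T" "u \<in> T" and val: "s \<bullet> (t - u) = L / 2"
  shows "\<exists>v w. T = {t, v, u, w} \<and> distinct [t, v, u, w] \<and> 2 *\<^sub>R s = t + v - u - w"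
proof -
  have S: "long_simplex T" using T by (simp add: maximal_simplex_def)
  have ne: "t \<noteq> u" using val L_pos by auto
  have tu_long: "t - u \<in> long" using S tu ne by (auto simp: long_simplex_def)
  have s_short: "s \<notin> edges T" using edges_long[OF S] s(2) L_pos long_sqnorm by fastforce
  define r where "r = t - u - 2 *\<^sub>R s"
  have r: "r \<in> long" unfolding r_def using diff_short_half[OF s(1) tu_long val s(2)] .
  have "\<not> T \<subseteq> {t, u}" using card card_mono[of "{t, u}" T] card_insert_le_m1[of 2 "{u}" t] by fastforce
  then obtain v where v: "v \<in> T" "v \<noteq> t" "v \<noteq> u" by blast
  have r_edge: "r \<in> edges T"
  proof (rule ccontr)
    assume "r \<notin> edges T"
    note orth = long_edge_or_orthogonal[OF T star r this]
    have "r \<bullet> (v - u) = L / 2 - 2 * (s \<bullet> (v - u))"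
      using inner_edges[OF S tu v(1) tu(2)] v ne by (simp add: r_def inner_diff_left)
    moreover have "r \<bullet> (t - v) = L / 2 - 2 * (s \<bullet> (t - v))"
      using inner_edges[OF S tu tu(1) v(1)] v ne by (simp add: r_def inner_diff_left)
    moreover have "s \<bullet> (t - v) = L / 2 - s \<bullet> (v - u)"
      using val by (simp add: inner_diff_right)
    ultimately show False
      using orth[OF v(1) tu(2)] orth[OF tu(1) v(1)] inner_edge_values[OF S s(1) s_short v(1) tu(2)] L_pos by auto
  qed
  then obtain w x where wx: "w \<in> T" "x \<in> T" "w \<noteq> x" "r = w - x" by (auto simp: edges_def)
  have s2: "2 *\<^sub>R s = t + x - u - w" using wx(4) by (simp add: r_def algebra_simps)
  have "(w - x) \<bullet> (t - u) = 0"
    using wx(4)[symmetric] val inner_edge_self[OF S tu ne] by (simp add: r_def inner_diff_left)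
  then have d: "w \<noteq> t" "w \<noteq> u" "x \<noteq> t" "x \<noteq> u"
    using inner_edges[OF S wx(1,2) tu] ne wx(3) L_pos by (auto simp: of_bool_def split: if_splits)
  have "y \<in> {t, x, u, w}" if y: "y \<in> T" for y
  proof (rule ccontr)
    assume yn: "y \<notin> {t, x, u, w}"
    have "2 * (s \<bullet> (y - u)) = (2 *\<^sub>R s) \<bullet> (y - u)" by simp
    also have "\<dots> = (t - u) \<bullet> (y - u) + (x - w) \<bullet> (y - u)"
      unfolding s2 by (simp add: inner_diff_left inner_add_left)
    also have "\<dots> = L / 2"
      using inner_edges[OF S tu y tu(2)] inner_edges[OF S wx(2,1) y tu(2)] yn d ne by auto
    finally show False using inner_edge_values[OF S s(1) s_short y tu(2)] L_pos by auto
  qed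
  then have "T = {t, x, u, w}" using tu wx by blast
  then show ?thesis using s2 d ne wx(3) by (intro exI[of _ x] exI[of _ w]) auto
qed

text \<open>Now the reflection \<open>r = t - u - 3 s\<close> of \<open>t - u\<close> meets \<open>t - u\<close> in the scalar product \<open>- L / 2\<close>, so \<open>r\<close> is an
  edge that shares exactly one point with \<open>t\<close>, \<open>u\<close>. A fourth point of \<open>T\<close> would have a scalar product \<open>\<plusminus>L / 3\<close>
  with \<open>s\<close>, relative to \<open>t\<close> or \<open>u\<close>.\<close>

lemma short_third_form:
  assumes T: "maximal_simplex T" and star: star_free
    and s: "s \<in> \<Phi>" "s \<bullet> s = L / 3" and tu: "t \<in> T" "u \<in> T" and val: "s \<bullet> (t - u) = L / 2"
  shows "\<exists>x y z. T = {x, y, z} \<and> distinct [x, y, z] \<and>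
    (3 *\<^sub>R s = x + y - 2 *\<^sub>R z \<or> 3 *\<^sub>R (- s) = x + y - 2 *\<^sub>R z)"
proof -
  have S: "long_simplex T" using T by (simp add: maximal_simplex_def)
  have ne: "t \<noteq> u" using val L_pos by auto
  have tu_long: "t - u \<in> long" using S tu ne by (auto simp: long_simplex_def)
  have s_short: "s \<notin> edges T" using edges_long[OF S] s(2) L_pos long_sqnorm by fastforce
  define r where "r = t - u - 3 *\<^sub>R s"
  have r: "r \<in> long" unfolding r_def using diff_short_third[OF s(1) tu_long val s(2)] .
  have rtu: "r \<bullet> (t - u) = - L / 2"
    using val inner_edge_self[OF S tu ne] by (simp add: r_def inner_diff_left)
  have "r \<in> edges T"
    using long_edge_or_orthogonal[OF T star r _ tu] rtu L_pos by fastforce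
  then obtain w x where wx: "w \<in> T" "x \<in> T" "w \<noteq> x" "r = w - x" by (auto simp: edges_def)
  have s3: "3 *\<^sub>R s = t + x - u - w" using wx(4) by (simp add: r_def algebra_simps)
  have "(w - x) \<bullet> (t - u) = - L / 2" using rtu wx(4) by simp
  then have cases: "w = u \<and> x \<notin> {t, u} \<or> x = t \<and> w \<notin> {t, u}"
    using inner_edges[OF S wx(1,2) tu] ne wx(3) L_pos
    by (cases "w = t"; cases "w = u"; cases "x = t"; cases "x = u") auto
  have only: "y \<in> {t, u, x, w}" if y: "y \<in> T" for y
  proof (rule ccontr)
    assume yn: "y \<notin> {t, u, x, w}"
    have "3 * (s \<bullet> (y - z)) = (t - u) \<bullet> (y - z) + (x - w) \<bullet> (y - z)" for z
    proof -
      have "3 * (s \<bullet> (y - z)) = (3 *\<^sub>R s) \<bullet> (y - z)" by simp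
      also have "\<dots> = (t - u) \<bullet> (y - z) + (x - w) \<bullet> (y - z)"
        unfolding s3 by (simp add: inner_diff_left inner_add_left)
      finally show ?thesis .
    qed
    note v = this
    show False
      using v[of u] v[of t] inner_edges[OF S tu y tu(2)] inner_edges[OF S wx(2,1) y tu(2)]
        inner_edges[OF S tu y tu(1)] inner_edges[OF S wx(2,1) y tu(1)]
        inner_edge_values[OF S s(1) s_short y tu(2)] inner_edge_values[OF S s(1) s_short y tu(1)]
        yn cases ne L_pos by auto
  qed
  from cases show ?thesis
  proof
    assume c: "w = u \<and> x \<notin> {t, u}"
    then have "T = {t, x, u}" using only tu wx by blast
    moreover have "3 *\<^sub>R s = t + x - 2 *\<^sub>R u" using s3 c by (simp add: scaleR_2)
    ultimately show ?thesis using c ne by (intro exI[of _ t] exI[of _ x] exI[of _ u]) auto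
  next
    assume c: "x = t \<and> w \<notin> {t, u}"
    then have "T = {u, w, t}" using only tu wx by blast
    moreover have "3 *\<^sub>R (- s) = u + w - 2 *\<^sub>R t" using s3 c by (simp add: scaleR_2)
    ultimately show ?thesis using c ne by (intro exI[of _ u] exI[of _ w] exI[of _ t]) auto
  qed
qed

end

section \<open>Root bases from explicit descriptions of the roots\<close>

lemma scaleR_3: "3 *\<^sub>R x = x + x + (x :: 'a::real_vector)"
  using scaleR_left_distrib[of 2 1 x] by (simp add: scaleR_2)

definition nonneg_comb :: "(nat \<Rightarrow> 'a::euclidean_space) \<Rightarrow> nat \<Rightarrow> 'a \<Rightarrow> bool" where
  "nonneg_comb \<alpha> n b \<longleftrightarrow> (\<exists>c::nat \<Rightarrow> nat. b = (\<Sum>i=1..n. real (c i) *\<^sub>R \<alpha> i))"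

lemma nonneg_comb_0: "nonneg_comb \<alpha> n 0"
  unfolding nonneg_comb_def by (rule exI[of _ "\<lambda>_. 0"]) simp

lemma nonneg_comb_simple: "i \<in> {1..n} \<Longrightarrow> nonneg_comb \<alpha> n (\<alpha> i)"
proof -
  assume i: "i \<in> {1..n}"
  have "(\<Sum>j=1..n. real (of_bool (j = i)) *\<^sub>R \<alpha> j) = (\<Sum>j=1..n. if j = i then \<alpha> j else 0)"
    by (rule sum.cong) auto
  also have "\<dots> = \<alpha> i" using i by simp
  finally show ?thesis unfolding nonneg_comb_def by metis
qed

lemma nonneg_comb_add:
  assumes "nonneg_comb \<alpha> n b" "nonneg_comb \<alpha> n b'"
  shows "nonneg_comb \<alpha> n (b + b')"
proof -
  obtain c c' :: "nat \<Rightarrow> nat" where "b = (\<Sum>i=1..n. real (c i) *\<^sub>R \<alpha> i)" "b' = (\<Sum>i=1..n. real (c' i) *\<^sub>R \<alpha> i)"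
    using assms unfolding nonneg_comb_def by blast
  then show ?thesis unfolding nonneg_comb_def
    by (intro exI[of _ "\<lambda>i. c i + c' i"]) (simp add: scaleR_add_left sum.distrib)
qed

lemma nonneg_comb_2: "nonneg_comb \<alpha> 2 (real a *\<^sub>R \<alpha> 1 + real b *\<^sub>R \<alpha> 2)"
  unfolding nonneg_comb_def
  by (rule exI[of _ "\<lambda>i. if i = 1 then a else b"]) (simp add: numeral_2_eq_2)

lemma nonneg_comb_3: "nonneg_comb \<alpha> 3 (real a *\<^sub>R \<alpha> 1 + real b *\<^sub>R \<alpha> 2 + real c *\<^sub>R \<alpha> 3)"
  unfolding nonneg_comb_def
  by (rule exI[of _ "\<lambda>i. if i = 1 then a else if i = 2 then b else c"])
     (simp add: numeral_3_eq_3 numeral_2_eq_2)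

context irreducible_root_system
begin

text \<open>The dual family \<open>y\<close> certifies linear independence; since the \<open>\<alpha> i\<close> span, their number is the
  dimension.\<close>

lemma root_basisI:
  assumes mem: "\<And>i. i \<in> {1..n} \<Longrightarrow> \<alpha> i \<in> \<Phi>"
    and dual: "\<And>i j. i \<in> {1..n} \<Longrightarrow> j \<in> {1..n} \<Longrightarrow> y i \<bullet> \<alpha> j = of_bool (i = j)"
    and comb: "\<And>b. b \<in> \<Phi> \<Longrightarrow> nonneg_comb \<alpha> n b \<or> nonneg_comb \<alpha> n (- b)"
  shows "DIM('a) = n" and "root_basis \<Phi> \<alpha>"
proof -
  have inj: "inj_on \<alpha> {1..n}"
  proof (rule inj_onI)
    fix i j assume ij: "i \<in> {1..n}" "j \<in> {1..n}" "\<alpha> i = \<alpha> j"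
    show "i = j" using dual[OF ij(1,1)] dual[OF ij(1,2)] ij(3) by (cases "i = j") auto
  qed
  have indep: "independent (\<alpha> ` {1..n})"
  proof (rule independent_if_scalars_zero)
    fix f x assume sum0: "(\<Sum>x\<in>\<alpha> ` {1..n}. f x *\<^sub>R x) = 0" and "x \<in> \<alpha> ` {1..n}"
    then obtain i where i: "i \<in> {1..n}" "x = \<alpha> i" by blast
    have "0 = y i \<bullet> (\<Sum>j=1..n. f (\<alpha> j) *\<^sub>R \<alpha> j)"
      using sum0 unfolding sum.reindex[OF inj] by simp
    also have "\<dots> = (\<Sum>j=1..n. f (\<alpha> j) * of_bool (i = j))"
      unfolding inner_sum_right using i(1) dual by (intro sum.cong) auto
    also have "\<dots> = f x" using i by (simp add: of_bool_def if_distrib[of "\<lambda>x. _ * x"] cong: if_cong)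
    finally show "f x = 0" by simp
  qed simp
  have span_comb: "b \<in> span (\<alpha> ` {1..n})" if "nonneg_comb \<alpha> n b" for b
  proof -
    from that obtain c :: "nat \<Rightarrow> nat" where "b = (\<Sum>i=1..n. real (c i) *\<^sub>R \<alpha> i)"
      unfolding nonneg_comb_def by blast
    then show ?thesis by (simp only:) (intro span_sum span_scale span_base imageI)
  qed
  have "\<Phi> \<subseteq> span (\<alpha> ` {1..n})"
  proof
    fix b assume "b \<in> \<Phi>"
    from comb[OF this] show "b \<in> span (\<alpha> ` {1..n})"
      using span_comb[of b] span_comb[of "- b"] span_neg[of "- b"] by auto
  qed
  then have sp: "span (\<alpha> ` {1..n}) = UNIV"
    using span_mono[of \<Phi> "span (\<alpha> ` {1..n})"] unfolding span_roots span_span by blast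
  have "DIM('a) = card (\<alpha> ` {1..n})"
    using sp indep dim_span_eq_card_independent[OF indep] by (simp add: dim_UNIV)
  then show dim: "DIM('a) = n" using card_image[OF inj] by simp
  have "\<exists>c::nat \<Rightarrow> nat. b = (\<Sum>i=1..n. real (c i) *\<^sub>R \<alpha> i) \<or> b = - (\<Sum>i=1..n. real (c i) *\<^sub>R \<alpha> i)"
    if "b \<in> \<Phi>" for b
    using comb[OF that] unfolding nonneg_comb_def by (metis minus_minus)
  then show "root_basis \<Phi> \<alpha>"
    unfolding root_basis_def dim using inj indep sp mem by blast
qed

text \<open>Seen from the centroid \<open>g\<close>, the vertices are up to a factor the coordinate functionals on the
  edges; the fundamental coweights of type \<open>A\<close> are their partial sums.\<close>

lemma centroid_exists:
  assumes T: "long_simplex T" and ne: "T \<noteq> {}"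
  shows "\<exists>g. \<forall>t\<in>T. \<forall>v\<in>T. \<forall>w\<in>T. (t - g) \<bullet> (v - w) = L / 2 * (of_bool (t = v) - of_bool (t = w))"
proof -
  have fin: "finite T" using T by (simp add: long_simplex_def)
  then have c: "real (card T) > 0" using ne by (simp add: card_gt_0_iff)
  define g where "g = (1 / real (card T)) *\<^sub>R (\<Sum>x\<in>T. x)"
  have "(t - g) \<bullet> (v - w) = L / 2 * (of_bool (t = v) - of_bool (t = w))"
    if m: "t \<in> T" "v \<in> T" "w \<in> T" for t v w
  proof -
    have "real (card T) *\<^sub>R (t - g) = (\<Sum>x\<in>T. t - x)"
      using c by (simp add: g_def scaleR_right_diff_distrib sum_subtractf scaleR_conv_of_real sum_constant_scaleR)
    then have "real (card T) * ((t - g) \<bullet> (v - w)) = (\<Sum>x\<in>T. (t - x) \<bullet> (v - w))"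
      by (metis inner_scaleR_left inner_sum_left)
    also have "\<dots> = (\<Sum>x\<in>T. L / 2 * (of_bool (t = v) - of_bool (t = w)) - L / 2 * of_bool (x = v) + L / 2 * of_bool (x = w))"
    proof (rule sum.cong)
      fix x assume "x \<in> T"
      show "(t - x) \<bullet> (v - w) =
          L / 2 * (of_bool (t = v) - of_bool (t = w)) - L / 2 * of_bool (x = v) + L / 2 * of_bool (x = w)"
        unfolding inner_edges[OF T m(1) \<open>x \<in> T\<close> m(2,3)] by (simp add: right_diff_distrib distrib_left)
    qed simp
    also have "\<dots> = real (card T) * (L / 2 * (of_bool (t = v) - of_bool (t = w)))"
      using m fin by (simp add: sum.distrib sum_subtractf of_bool_def if_distrib[of "\<lambda>x. _ * x"] cong: if_cong)
    finally show ?thesis using c by simp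
  qed
  then show ?thesis by blast
qed

text \<open>Number the points of \<open>T\<close> as \<open>t 0, \<dots>, t n\<close>; the steps \<open>t (i - 1) - t i\<close> are simple roots.\<close>

lemma type_A_from_simplex:
  assumes T: "long_simplex T" and card: "2 \<le> card T" and roots: "\<Phi> = edges T"
  shows "\<exists>\<alpha>. type_A \<Phi> \<alpha>"
proof -
  define n where "n = card T - 1"
  have fin: "finite T" using T by (simp add: long_simplex_def)
  obtain t where "bij_betw t {0..<card T} T" using ex_bij_betw_nat_finite[OF fin] by blast
  moreover have "{0..<card T} = {0..n}" using card by (auto simp: n_def)
  ultimately have bij: "bij_betw t {0..n} T" by simp
  then have tT: "t i \<in> T" if "i \<le> n" for i using that by (auto simp: bij_betw_def)
  have t_eq: "t i = t j \<longleftrightarrow> i = j" if "i \<le> n" "j \<le> n" for i j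
    using bij that by (auto simp: bij_betw_def inj_on_eq_iff)
  define \<alpha> where "\<alpha> i = t (i - 1) - t i" for i
  obtain g where g: "(x - g) \<bullet> (v - w) = L / 2 * (of_bool (x = v) - of_bool (x = w))"
    if "x \<in> T" "v \<in> T" "w \<in> T" for x v w
    using centroid_exists[OF T] tT by blast
  define y where "y k = (2 / L) *\<^sub>R (\<Sum>i<k. t i - g)" for k
  have mem: "\<alpha> i \<in> \<Phi>" if "i \<in> {1..n}" for i
    unfolding roots \<alpha>_def using that tT t_eq by (intro edgesI) auto
  have dual: "y k \<bullet> \<alpha> j = of_bool (k = j)" if k: "k \<in> {1..n}" and j: "j \<in> {1..n}" for k j
  proof -
    have "y k \<bullet> \<alpha> j = 2 / L * (\<Sum>i<k. (t i - g) \<bullet> (t (j - 1) - t j))"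
      by (simp add: y_def \<alpha>_def inner_sum_left)
    also have "(\<Sum>i<k. (t i - g) \<bullet> (t (j - 1) - t j)) = (\<Sum>i<k. L / 2 * of_bool (i = j - 1) - L / 2 * of_bool (i = j))"
    proof (rule sum.cong)
      fix i assume "i \<in> {..<k}"
      then have "i \<le> n" "j - 1 \<le> n" "j \<le> n" using k j by auto
      then show "(t i - g) \<bullet> (t (j - 1) - t j) = L / 2 * of_bool (i = j - 1) - L / 2 * of_bool (i = j)"
        by (simp add: g tT t_eq right_diff_distrib)
    qed simp
    also have "\<dots> = L / 2 * of_bool (j - 1 < k) - L / 2 * of_bool (j < k)"
      by (simp add: sum_subtractf of_bool_def if_distrib[of "\<lambda>x. _ * x"] cong: if_cong)
    also have "2 / L * \<dots> = of_bool (k = j)" using j L_pos by (auto simp: of_bool_def)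
    finally show ?thesis .
  qed
  have diff: "nonneg_comb \<alpha> n (t i - t j)" if "i \<le> j" "j \<le> n" for i j
    using that
  proof (induction j)
    case (Suc j)
    show ?case
    proof (cases "i = Suc j")
      case False
      then have "nonneg_comb \<alpha> n ((t i - t j) + \<alpha> (Suc j))"
        using Suc by (intro nonneg_comb_add nonneg_comb_simple) auto
      moreover have "(t i - t j) + \<alpha> (Suc j) = t i - t (Suc j)" by (simp add: \<alpha>_def)
      ultimately show ?thesis by simp
    qed (simp add: nonneg_comb_0)
  qed (simp add: nonneg_comb_0)
  have comb: "nonneg_comb \<alpha> n b \<or> nonneg_comb \<alpha> n (- b)" if "b \<in> \<Phi>" for b
  proof -
    from that obtain x x' where "x \<in> T" "x' \<in> T" and b: "b = x - x'" unfolding roots edges_def by blast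
    moreover have "T = t ` {0..n}" using bij by (simp add: bij_betw_def)
    ultimately obtain i j where ij: "i \<le> n" "j \<le> n" and b: "b = t i - t j" by auto
    then show ?thesis using diff[of i j] diff[of j i] by (cases "i \<le> j") (simp_all add: b)
  qed
  have rb: "DIM('a) = n" "root_basis \<Phi> \<alpha>"
    by (rule root_basisI[of n \<alpha> y]; (rule mem dual comb, assumption+))+
  have "2 * (\<alpha> i \<bullet> \<alpha> j) / (\<alpha> j \<bullet> \<alpha> j) = of_int (cartan_A i j)" if ij: "i \<in> {1..n}" "j \<in> {1..n}" for i j
  proof -
    have b: "i - 1 \<le> n" "i \<le> n" "j - 1 \<le> n" "j \<le> n" using ij by auto
    have 1: "\<alpha> j \<bullet> \<alpha> j = L"
      unfolding \<alpha>_def using b ij by (intro inner_edge_self[OF T]) (auto simp: tT t_eq)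
    have "\<alpha> i \<bullet> \<alpha> j = L / 2 * (of_bool (i - 1 = j - 1) - of_bool (i - 1 = j) - of_bool (i = j - 1) + of_bool (i = j))"
      unfolding \<alpha>_def using b by (simp add: inner_edges[OF T] tT t_eq)
    also have "of_bool (i - 1 = j - 1) - of_bool (i - 1 = j) - of_bool (i = j - 1) + of_bool (i = j) =
        (of_int (cartan_A i j) :: real)"
      using ij by (cases i; cases j) (auto simp: cartan_A_def)
    finally show ?thesis using 1 L_pos by (simp add: field_simps)
  qed
  then show ?thesis unfolding type_A_def has_cartan_matrix_def rb(1) using rb(2)
    by (intro exI[of _ \<alpha>]) blast
qed

text \<open>The edges of the tetrahedron \<open>T\<close> are the long roots. The condition on \<open>b\<close> says that \<open>2 b\<close> is the sum of
  two points of \<open>T\<close> minus the sum of the other two, so that the short roots join midpoints of opposite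
  edges. The simple roots are \<open>v - t\<close>, \<open>u - v\<close> and \<open>s\<close>.\<close>

lemma type_B3_from_simplex:
  assumes T: "long_simplex T" "T = {t, v, u, w}" "distinct [t, v, u, w]"
    and s: "s \<in> \<Phi>" "2 *\<^sub>R s = t + v - u - w"
    and roots: "\<And>b. b \<in> \<Phi> \<Longrightarrow> b \<in> edges T \<or>
       (\<exists>x y. x \<in> T \<and> y \<in> T \<and> x \<noteq> y \<and> 2 *\<^sub>R b = 2 *\<^sub>R (x + y) - (t + v + u + w))"
  shows "\<exists>\<alpha>. type_B3 \<Phi> \<alpha>"
proof -
  define a1 a2 where "a1 = v - t" and "a2 = u - v"
  define \<alpha> where "\<alpha> i = (if i = 1 then a1 else if i = 2 then a2 else s)" for i :: nat
  \<comment> \<open>The dual basis is read off from the inverse of the Gram matrix.\<close>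
  define y where "y i = (2 / L) *\<^sub>R (if i = 1 then a1 + a2 + s else if i = 2 then a1 + 2 *\<^sub>R a2 + 2 *\<^sub>R s
    else a1 + 2 *\<^sub>R a2 + 3 *\<^sub>R s)" for i :: nat
  have \<alpha>: "\<alpha> 1 = a1" "\<alpha> 2 = a2" "\<alpha> 3 = s" by (simp_all add: \<alpha>_def)
  have idx: "{1..3} = {1, 2, 3::nat}" by auto
  have v: "v = t + a1" and u: "u = t + a1 + a2" by (simp_all add: a1_def a2_def)
  have w: "w = t - a2 - 2 *\<^sub>R s" using s(2) v u by (simp add: algebra_simps)
  have dist: "t \<noteq> v" "t \<noteq> u" "t \<noteq> w" "v \<noteq> u" "v \<noteq> w" "u \<noteq> w" using T(3) by auto
  have tvuw: "t \<in> T" "v \<in> T" "u \<in> T" "w \<in> T" using T(2) by auto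
  note edge = inner_edges[OF T(1)]
  have two_s: "2 * (x \<bullet> s) = x \<bullet> (t - u) + x \<bullet> (v - w)" for x
  proof -
    have "2 * (x \<bullet> s) = x \<bullet> (2 *\<^sub>R s)" by simp
    then show ?thesis unfolding s(2) by (simp add: inner_diff_right inner_add_right)
  qed
  have 11: "a1 \<bullet> a1 = L" and 22: "a2 \<bullet> a2 = L" and 12: "a1 \<bullet> a2 = - L / 2"
    unfolding a1_def a2_def using dist tvuw by (simp_all add: edge)
  have 1: "a1 \<bullet> s = 0" using two_s[of a1] dist tvuw unfolding a1_def by (simp add: edge)
  have 2: "a2 \<bullet> s = - L / 2" using two_s[of a2] dist tvuw unfolding a2_def by (simp add: edge)
  have 3: "s \<bullet> s = L / 2"
    using two_s[of s] two_s[of "t - u"] two_s[of "v - w"] dist tvuw by (simp add: edge inner_commute)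
  note prods = 11 22 12 1 2 3 12[unfolded inner_commute[of a1]] 1[unfolded inner_commute[of a1]]
    2[unfolded inner_commute[of a2]]
  have mem: "\<alpha> i \<in> \<Phi>" if "i \<in> {1..3}" for i
    using T(1) tvuw dist s(1) that long_root unfolding \<alpha>_def a1_def a2_def long_simplex_def by auto
  have dual: "y k \<bullet> \<alpha> j = of_bool (k = j)" if "k \<in> {1..3}" "j \<in> {1..3}" for k j
    using that L_pos unfolding idx
    by (auto simp: y_def \<alpha>_def inner_add_left prods field_simps)
  have comb3: "nonneg_comb \<alpha> 3 b" if "b = real k *\<^sub>R a1 + real l *\<^sub>R a2 + real m *\<^sub>R s" for b k l m
    using nonneg_comb_3[of \<alpha> k l m] unfolding \<alpha> that .
  define N where "N = {real k *\<^sub>R a1 + real l *\<^sub>R a2 + real m *\<^sub>R s | k l m. True}"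
  have combN: "nonneg_comb \<alpha> 3 b" if "b \<in> N" for b using that comb3 unfolding N_def by blast
  have NI: "real k *\<^sub>R a1 + real l *\<^sub>R a2 + real m *\<^sub>R s \<in> N" for k l m unfolding N_def by blast
  have long_pos: "v - t \<in> N" "u - t \<in> N" "u - v \<in> N" "t - w \<in> N" "v - w \<in> N" "u - w \<in> N"
    using NI[of 1 0 0] NI[of 1 1 0] NI[of 0 1 0] NI[of 0 1 2] NI[of 1 1 2] NI[of 1 2 2]
    by (simp_all add: v u w algebra_simps scaleR_2)
  have short_pos: "s \<in> N" "a2 + s \<in> N" "a1 + a2 + s \<in> N"
    using NI[of 0 0 1] NI[of 0 1 1] NI[of 1 1 1] by simp_all
  have comb: "nonneg_comb \<alpha> 3 b \<or> nonneg_comb \<alpha> 3 (- b)" if b: "b \<in> \<Phi>" for b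
  proof -
    have "b \<in> N \<or> - b \<in> N"
      using roots[OF b]
    proof
      assume "b \<in> edges T"
      then show ?thesis using long_pos unfolding edges_def T(2) by auto
    next
      assume "\<exists>x y. x \<in> T \<and> y \<in> T \<and> x \<noteq> y \<and> 2 *\<^sub>R b = 2 *\<^sub>R (x + y) - (t + v + u + w)"
      then obtain x y where xy: "x \<in> T" "y \<in> T" "x \<noteq> y" "2 *\<^sub>R b = 2 *\<^sub>R (x + y) - (t + v + u + w)"
        by blast
      have "t + v + u + w = 2 *\<^sub>R (2 *\<^sub>R t + a1 - s)"
        by (simp add: v u w algebra_simps scaleR_2)
      then have "2 *\<^sub>R b = 2 *\<^sub>R (x + y - (2 *\<^sub>R t + a1 - s))" using xy(4) by (simp only: scaleR_right_diff_distrib)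
      then have b_eq: "b = x + y - (2 *\<^sub>R t + a1 - s)" by simp
      define c where "c = 2 *\<^sub>R t + a1 - s"
      have eqs: "t + v - c = s" "t + u - c = a2 + s"
        "t + w - c = - (a1 + a2 + s)" "v + u - c = a1 + a2 + s"
        "v + w - c = - (a2 + s)" "u + w - c = - s"
        unfolding c_def by (simp_all add: v u w algebra_simps scaleR_2)
      then have "p + q - c \<in> N \<or> - (p + q - c) \<in> N"
        if "(p, q) \<in> {(t, v), (t, u), (t, w), (v, u), (v, w), (u, w)}" for p q
        using that unfolding insert_iff empty_iff prod.inject
        by (elim disjE conjE FalseE) (simp_all only: eqs short_pos minus_minus simp_thms)
      moreover have "(x, y) \<in> {(t, v), (t, u), (t, w), (v, u), (v, w), (u, w)} \<or>
          (y, x) \<in> {(t, v), (t, u), (t, w), (v, u), (v, w), (u, w)}"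
        using xy(1-3) unfolding T(2) by auto
      ultimately show ?thesis unfolding b_eq c_def[symmetric] by (metis add.commute)
    qed
    then show ?thesis using combN by blast
  qed
  have rb: "DIM('a) = 3" "root_basis \<Phi> \<alpha>"
    by (rule root_basisI[of 3 \<alpha> y]; (rule mem dual comb, assumption+))+
  have "2 * (\<alpha> i \<bullet> \<alpha> j) / (\<alpha> j \<bullet> \<alpha> j) = of_int (cartan_B 3 i j)" if "i \<in> {1..3}" "j \<in> {1..3}" for i j
    using that L_pos prods(1-3,6) unfolding idx
    by (cases "s = 0"; cases "a1 = 0"; cases "a2 = 0") (auto simp: \<alpha>_def prods cartan_B_def cartan_A_def)
  then show ?thesis unfolding type_B3_def has_cartan_matrix_def rb(1) using rb(2) by blast
qed

text \<open>The edges of the triangle \<open>T\<close> are the long roots, and the short roots join its vertices to its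
  centroid. The simple roots are \<open>s\<close> and \<open>z - x\<close>.\<close>

lemma type_G2_from_simplex:
  assumes T: "long_simplex T" "T = {x, y, z}" "distinct [x, y, z]"
    and s: "s \<in> \<Phi>" "3 *\<^sub>R s = x + y - 2 *\<^sub>R z"
    and roots: "\<And>b. b \<in> \<Phi> \<Longrightarrow> b \<in> edges T \<or>
       (\<exists>p\<in>T. 3 *\<^sub>R b = x + y + z - 3 *\<^sub>R p \<or> 3 *\<^sub>R (- b) = x + y + z - 3 *\<^sub>R p)"
  shows "\<exists>\<alpha>. type_G2 \<Phi> \<alpha>"
proof -
  define a2 where "a2 = z - x"
  define \<alpha> where "\<alpha> i = (if i = 1 then s else a2)" for i :: nat
  define d where "d i = (2 / L) *\<^sub>R (if i = 1 then 6 *\<^sub>R s + 3 *\<^sub>R a2 else 3 *\<^sub>R s + 2 *\<^sub>R a2)" for i :: nat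
  have \<alpha>: "\<alpha> 1 = s" "\<alpha> 2 = a2" by (simp_all add: \<alpha>_def)
  have idx: "{1..2} = {1, 2::nat}" by auto
  have z: "z = x + a2" by (simp add: a2_def)
  have y: "y = x + 3 *\<^sub>R s + 2 *\<^sub>R a2" using s(2) z by (simp add: algebra_simps scaleR_2)
  have dist: "x \<noteq> y" "x \<noteq> z" "y \<noteq> z" using T(3) by auto
  have xyz: "x \<in> T" "y \<in> T" "z \<in> T" using T(2) by auto
  note edge = inner_edges[OF T(1)]
  have three_s: "3 * (q \<bullet> s) = q \<bullet> (x - z) + q \<bullet> (y - z)" for q
  proof -
    have "3 * (q \<bullet> s) = q \<bullet> (3 *\<^sub>R s)" by simp
    then show ?thesis unfolding s(2) by (simp add: inner_diff_right inner_add_right)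
  qed
  have 22: "a2 \<bullet> a2 = L"
    unfolding a2_def using dist xyz by (simp add: edge)
  have 12: "a2 \<bullet> s = - L / 2" using three_s[of a2] dist xyz unfolding a2_def by (simp add: edge)
  have 11: "s \<bullet> s = L / 3"
    using three_s[of s] three_s[of "x - z"] three_s[of "y - z"] dist xyz by (simp add: edge inner_commute)
  note prods = 11 22 12 12[unfolded inner_commute[of a2]]
  have mem: "\<alpha> i \<in> \<Phi>" if "i \<in> {1..2}" for i
    using T(1) xyz dist s(1) that long_root unfolding \<alpha>_def a2_def long_simplex_def by auto
  have dual: "d k \<bullet> \<alpha> j = of_bool (k = j)" if "k \<in> {1..2}" "j \<in> {1..2}" for k j
    using that L_pos unfolding idx
    by (auto simp: d_def \<alpha>_def inner_add_left prods field_simps)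
  define N where "N = {real k *\<^sub>R s + real l *\<^sub>R a2 | k l. True}"
  have combN: "nonneg_comb \<alpha> 2 b" if "b \<in> N" for b
    using that nonneg_comb_2[of \<alpha>] unfolding N_def \<alpha> by blast
  have NI: "real k *\<^sub>R s + real l *\<^sub>R a2 \<in> N" for k l unfolding N_def by blast
  have long_pos: "z - x \<in> N" "y - z \<in> N" "y - x \<in> N"
    using NI[of 0 1] NI[of 3 1] NI[of 3 2] by (simp_all add: y z algebra_simps scaleR_2)
  have short_pos: "s \<in> N" "s + a2 \<in> N" "2 *\<^sub>R s + a2 \<in> N"
    using NI[of 1 0] NI[of 1 1] NI[of 2 1] by simp_all
  have sum3: "x + y + z - 3 *\<^sub>R p = 3 *\<^sub>R (x + s + a2 - p)" for p
    by (simp add: y z scaleR_3 algebra_simps scaleR_2)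
  have comb: "nonneg_comb \<alpha> 2 b \<or> nonneg_comb \<alpha> 2 (- b)" if b: "b \<in> \<Phi>" for b
  proof -
    have "b \<in> N \<or> - b \<in> N"
      using roots[OF b]
    proof
      assume "b \<in> edges T"
      then show ?thesis using long_pos unfolding edges_def T(2) by auto
    next
      assume "\<exists>p\<in>T. 3 *\<^sub>R b = x + y + z - 3 *\<^sub>R p \<or> 3 *\<^sub>R (- b) = x + y + z - 3 *\<^sub>R p"
      then obtain p where p: "p \<in> T" "b = x + s + a2 - p \<or> - b = x + s + a2 - p"
        unfolding sum3 by (metis scaleR_cancel_left zero_neq_numeral)
      have "x + s + a2 - x = s + a2" "x + s + a2 - y = - (2 *\<^sub>R s + a2)" "x + s + a2 - z = s"
        by (simp_all add: y z algebra_simps scaleR_2 scaleR_3)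
      then have "x + s + a2 - p \<in> N \<or> - (x + s + a2 - p) \<in> N"
        using p(1) short_pos unfolding T(2) by (metis insertE emptyE minus_minus)
      then show ?thesis using p(2) by (metis minus_minus)
    qed
    then show ?thesis using combN by blast
  qed
  have rb: "DIM('a) = 2" "root_basis \<Phi> \<alpha>"
    by (rule root_basisI[of 2 \<alpha> d]; (rule mem dual comb, assumption+))+
  have "2 * (\<alpha> i \<bullet> \<alpha> j) / (\<alpha> j \<bullet> \<alpha> j) = of_int (cartan_G2 i j)" if "i \<in> {1..2}" "j \<in> {1..2}" for i j
    using that L_pos prods(1,2) unfolding idx by (cases "s = 0"; cases "a2 = 0") (auto simp: \<alpha>_def prods cartan_G2_def cartan_A_def)
  then show ?thesis unfolding type_G2_def has_cartan_matrix_def rb(1) using rb(2) by blast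
qed


section \<open>Star-free root systems are of type A, B3, C or G2\<close>

text \<open>Two long roots at an angle of 60 degrees span a triangle with the origin.\<close>

lemma orthogonal_long_if_card_2:
  assumes T: "maximal_simplex T" "card T = 2" and kl: "k \<in> long" "l \<in> long" "k \<noteq> l" "k \<noteq> - l"
  shows "k \<bullet> l = 0"
proof -
  have no: False if kl: "k \<in> long" "l \<in> long" "k \<bullet> l = L / 2" for k l
  proof -
    have 1: "k - l \<in> long" using diff_long kl by blast
    have 2: "k \<noteq> 0" "l \<noteq> 0" "k \<noteq> l"
      using kl zero_not_root long_root L_pos long_sqnorm[OF kl(2)] by auto
    have "long_simplex {0, k, l}"
      using kl 1 minus_long[OF 1] minus_long[OF kl(1)] minus_long[OF kl(2)] by (simp add: long_simplex_def)
    then have "card {0, k, l} \<le> 2" using T by (auto simp: maximal_simplex_def)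
    moreover have "card {0, k, l} = 3" using 2 by simp
    ultimately show False by simp
  qed
  show ?thesis
    using no[OF kl(1,2)] no[OF kl(1) minus_long[OF kl(2)]] inner_long[OF long_root[OF kl(1)] kl(2-4)] by auto
qed

text \<open>The long roots are \<open>\<plusminus>k\<close> for \<open>k\<close> in a maximal orthogonal set \<open>K\<close>, which is a basis of \<open>V\<close> by irreducibility.
  A short root that meets \<open>k\<close> has half the squared length of a long root (in the ratio 3 the reflection
  of \<open>k\<close> would be a long root oblique to \<open>k\<close>), and the reflection of \<open>k\<close> in it is \<open>\<plusminus>l\<close> for another
  \<open>l\<close> in \<open>K\<close>; therefore it is one of \<open>(\<plusminus>k \<plusminus> l) / 2\<close>. That \<open>(k - l) / 2\<close> is a root is an
  equivalence relation on \<open>K\<close> (up to reflexivity), and irreducibility leaves only one class.\<close>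

lemma type_C_from_frame:
  assumes T: "maximal_simplex T" "card T = 2" and short: "s0 \<in> \<Phi>" "s0 \<notin> long"
  shows "\<exists>\<alpha>. type_C \<Phi> \<alpha>"
proof -
  note orth = orthogonal_long_if_card_2[OF T]
  define frame where "frame K \<longleftrightarrow> K \<subseteq> long \<and> (\<forall>k\<in>K. \<forall>l\<in>K. k \<noteq> l \<longrightarrow> k \<bullet> l = 0)" for K
  have "\<forall>K. frame K \<longrightarrow> card K < card \<Phi> + 1"
  proof (intro allI impI)
    fix K assume "frame K"
    then have "K \<subseteq> \<Phi>" using long_root unfolding frame_def by blast
    then have "card K \<le> card \<Phi>" by (rule card_mono[OF finite_roots])
    then show "card K < card \<Phi> + 1" by simp
  qed
  moreover have "frame {}" by (simp add: frame_def)
  ultimately obtain K where K: "frame K" and Kmax: "\<forall>K'. frame K' \<longrightarrow> card K' \<le> card K"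
    using ex_has_greatest_nat[of frame "{}" card "card \<Phi> + 1"] by blast
  have Klong: "k \<in> long" if "k \<in> K" for k using K that by (auto simp: frame_def)
  have Kinner: "k \<bullet> l = L * of_bool (k = l)" if "k \<in> K" "l \<in> K" for k l
    using K that long_sqnorm[of k] by (auto simp: frame_def)
  have finK: "finite K"
    using Klong long_root finite_subset[OF _ finite_roots, of K] by blast
  have longK: "r \<in> K \<or> - r \<in> K" if r: "r \<in> long" for r
  proof (rule ccontr)
    assume no: "\<not> (r \<in> K \<or> - r \<in> K)"
    have o: "r \<bullet> k = 0" if "k \<in> K" for k
      using orth[OF r Klong[OF that]] no that by (metis minus_minus)
    have "frame (insert r K)"
      unfolding frame_def using K r o by (auto simp: frame_def inner_commute)
    then have "card (insert r K) \<le> card K" using Kmax by blast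
    then show False using no finK by simp
  qed
  have short_form: "\<exists>l\<in>K. l \<noteq> k \<and> (2 *\<^sub>R s = k - l \<or> 2 *\<^sub>R s = k + l)"
    if s: "s \<in> \<Phi>" "s \<notin> long" and k: "k \<in> K" and val: "s \<bullet> k = L / 2" for s k
  proof -
    note kl = Klong[OF k]
    have "s \<bullet> s \<noteq> L / 3"
    proof
      assume third: "s \<bullet> s = L / 3"
      define r where "r = k - 3 *\<^sub>R s"
      have r: "r \<in> long" unfolding r_def using diff_short_third[OF s(1) kl val third] .
      have rk: "r \<bullet> k = - L / 2" unfolding r_def using val long_sqnorm[OF kl] by (simp add: inner_diff_left)
      have "r \<noteq> k" "r \<noteq> - k" using rk long_sqnorm[OF kl] L_pos by auto
      then show False using orth[OF r kl] rk L_pos by auto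
    qed
    then have half: "s \<bullet> s = L / 2" using short_sqnorm[OF s kl val] by blast
    have r: "k - 2 *\<^sub>R s \<in> long" using diff_short_half[OF s(1) kl val half] .
    have r0: "(k - 2 *\<^sub>R s) \<bullet> k = 0" using val long_sqnorm[OF kl] by (simp add: inner_diff_left)
    have kk: "k \<bullet> k \<noteq> 0" using long_sqnorm[OF kl] L_pos by simp
    from longK[OF r] show ?thesis
    proof
      assume "k - 2 *\<^sub>R s \<in> K"
      then show ?thesis using r0 kk by (intro bexI[of _ "k - 2 *\<^sub>R s"]) auto
    next
      assume "- (k - 2 *\<^sub>R s) \<in> K"
      moreover have "- (k - 2 *\<^sub>R s) \<noteq> k"
      proof
        assume "- (k - 2 *\<^sub>R s) = k"
        then have "(- (k - 2 *\<^sub>R s)) \<bullet> k = k \<bullet> k" by (simp only:)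
        then show False using r0 kk unfolding inner_minus_left by simp
      qed
      ultimately show ?thesis by (intro bexI[of _ "- (k - 2 *\<^sub>R s)"]) auto
    qed
  qed
  define E where "E k l \<longleftrightarrow> (1/2) *\<^sub>R (k - l) \<in> \<Phi>" for k l
  have reflect_K: "reflection l (a *\<^sub>R k + b *\<^sub>R l) = a *\<^sub>R k - b *\<^sub>R l" if "k \<in> K" "l \<in> K" "k \<noteq> l" for a b k l
  proof -
    have "2 * ((a *\<^sub>R k + b *\<^sub>R l) \<bullet> l) / (l \<bullet> l) = b + b"
      using that L_pos by (simp add: inner_add_left Kinner)
    then show ?thesis unfolding reflection_def by (simp only: scaleR_left_distrib) simp
  qed
  have plus_E: "E k l" if "(1/2) *\<^sub>R (k + l) \<in> \<Phi>" and kl: "k \<in> K" "l \<in> K" "k \<noteq> l" for k l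
    using reflection_root[OF long_root[OF Klong[OF kl(2)]] that(1)] reflect_K[OF kl, of "1/2" "1/2"]
    by (simp add: E_def scaleR_right_distrib scaleR_right_diff_distrib)
  have E_sym: "E l k" if "E k l" for k l
    using minus_root[OF that[unfolded E_def]] by (simp add: E_def flip: scaleR_minus_right)
  have E_trans: "E k m" if "E k l" "E l m" and mem: "k \<in> K" "l \<in> K" "m \<in> K" "k \<noteq> l" "l \<noteq> m" "k \<noteq> m" for k l m
  proof -
    define a where "a = (1/2) *\<^sub>R (l - m)"
    define b where "b = (1/2) *\<^sub>R (k - l)"
    have "a \<bullet> a = L / 2" "b \<bullet> a = - L / 4"
      unfolding a_def b_def using mem by (simp_all add: inner_diff_left inner_diff_right Kinner)
    then have "2 * (b \<bullet> a) / (a \<bullet> a) = - 1" using L_pos by (simp only:) simp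
    then have "reflection a b = b + a" unfolding reflection_def by (simp only:) simp
    also have "\<dots> = (1/2) *\<^sub>R (k - m)" by (simp add: a_def b_def algebra_simps)
    finally show ?thesis using reflection_root[of a b] that(1,2) by (simp add: E_def a_def b_def)
  qed
  have short_E: "\<exists>l\<in>K. l \<noteq> k \<and> E k l \<and> (2 *\<^sub>R s \<in> {k - l, k + l, l - k, - k - l})"
    if s: "s \<in> \<Phi>" "s \<notin> long" and k: "k \<in> K" and val: "s \<bullet> k \<noteq> 0" for s k
  proof -
    have E_if: "E k l" if "s' \<in> \<Phi>" "2 *\<^sub>R s' = k - l \<or> 2 *\<^sub>R s' = k + l" "l \<in> K" "l \<noteq> k" for s' l
    proof -
      have "s' = (1/2) *\<^sub>R (2 *\<^sub>R s')" by simp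
      then have "s' = (1/2) *\<^sub>R (k - l) \<or> s' = (1/2) *\<^sub>R (k + l)" using that(2) by metis
      then show ?thesis using that plus_E[of k l] k by (auto simp: E_def)
    qed
    have ne: "s \<noteq> k" "s \<noteq> - k" using s(2) Klong[OF k] minus_long by auto
    have "s \<bullet> k = L / 2 \<or> (- s) \<bullet> k = L / 2"
      using inner_long[OF s(1) Klong[OF k] ne] val by auto
    then show ?thesis
    proof
      assume "s \<bullet> k = L / 2"
      from short_form[OF s k this] show ?thesis using E_if[OF s(1)] by blast
    next
      assume v: "(- s) \<bullet> k = L / 2"
      have m: "- s \<in> \<Phi>" "- s \<notin> long" using s minus_root minus_long[of "- s"] by auto
      from short_form[OF m k v] obtain l where l: "l \<in> K" "l \<noteq> k" "2 *\<^sub>R (- s) = k - l \<or> 2 *\<^sub>R (- s) = k + l"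
        by blast
      have "2 *\<^sub>R s = - (2 *\<^sub>R (- s))" by simp
      then have "2 *\<^sub>R s = l - k \<or> 2 *\<^sub>R s = - k - l" using l(3) by (metis minus_diff_eq minus_add_distrib diff_conv_add_uminus)
      then show ?thesis using E_if[OF m(1) l(3,1,2)] l by blast
    qed
  qed
  obtain k0 where k0: "k0 \<in> K" using long_exists longK by blast
  have span_short: "s \<in> span C" if "2 *\<^sub>R s \<in> {k - l, k + l, l - k, - k - l}" "k \<in> C" "l \<in> C" for s k l and C :: "'a set"
  proof -
    have C: "k \<in> span C" "l \<in> span C" using that(2,3) span_base by blast+
    have "2 *\<^sub>R s \<in> span C"
      using that(1) span_diff[OF C] span_add[OF C] span_diff[OF C(2,1)] span_diff[OF span_neg[OF C(1)] C(2)]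
      by (metis insertE emptyE)
    then have "(1/2) *\<^sub>R (2 *\<^sub>R s) \<in> span C" by (rule span_scale)
    then show ?thesis by simp
  qed
  have splitK: "r \<in> span K \<or> (\<forall>x\<in>K. r \<bullet> x = 0)" if r: "r \<in> \<Phi>" for r
  proof (cases "r \<in> long")
    case True
    then show ?thesis using longK[OF True] span_base[of r K] span_base[of "- r" K] span_neg[of "- r" K] by auto
  next
    case False
    then show ?thesis using short_E[OF r False] span_short[of r _ _ K] by blast
  qed
  have not_orthK: "\<exists>k\<in>K. r \<bullet> k \<noteq> 0" if "r \<in> \<Phi>" for r
    using no_root_orthogonal[OF long_root[OF Klong[OF k0]] span_base[OF k0] splitK that] by blast
  from not_orthK[OF short(1)] obtain k1 where k1: "k1 \<in> K" "s0 \<bullet> k1 \<noteq> 0" by blast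
  from short_E[OF short k1] obtain k2 where k2: "k2 \<in> K" "k2 \<noteq> k1" by blast
  \<comment> \<open>The equivalence class of \<open>k1\<close>; every root lies in its span or is orthogonal to it.\<close>
  define C where "C = {k \<in> K. k = k1 \<or> E k1 k}"
  have C_closed: "l \<in> C" if "k \<in> C" "l \<in> K" "E k l" for k l
  proof (cases "l = k1 \<or> k = k1 \<or> k = l")
    case True
    then show ?thesis using that by (auto simp: C_def)
  next
    case False
    then show ?thesis using E_trans[of k1 k l] that k1(1) by (auto simp: C_def)
  qed
  have splitC: "r \<in> span C \<or> (\<forall>x\<in>C. r \<bullet> x = 0)" if r: "r \<in> \<Phi>" for r
  proof (cases "r \<in> long")
    case True
    have "\<forall>x\<in>C. k \<bullet> x = 0" if "k \<in> K" "k \<notin> C" for k using that Kinner by (auto simp: C_def)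
    then show ?thesis
      using longK[OF True] span_base[of r C] span_base[of "- r" C] span_neg[of "- r" C]
      by (metis inner_minus_left minus_minus neg_equal_0_iff_equal)
  next
    case False
    show ?thesis
    proof (cases "\<forall>x\<in>C. r \<bullet> x = 0")
      case no: False
      then obtain c where c: "c \<in> C" "r \<bullet> c \<noteq> 0" by blast
      then have "c \<in> K" by (simp add: C_def)
      from short_E[OF r False this c(2)] obtain l where l: "l \<in> K" "E c l"
        "2 *\<^sub>R r \<in> {c - l, c + l, l - c, - c - l}" by blast
      then show ?thesis using span_short[OF l(3) c(1)] C_closed[OF c(1) l(1,2)] by blast
    qed blast
  qed
  have k1C: "k1 \<in> C" using k1(1) by (simp add: C_def)
  have KC: "k \<in> C" if "k \<in> K" for k
  proof (rule ccontr)
    assume "k \<notin> C"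
    then have "\<forall>x\<in>C. k \<bullet> x = 0" using that Kinner by (auto simp: C_def)
    then show False
      using no_root_orthogonal[OF long_root[OF Klong[OF k1(1)]] span_base[OF k1C] splitC long_root[OF Klong[OF that]]] by blast
  qed
  have E_all: "E k l" if "k \<in> K" "l \<in> K" "k \<noteq> l" for k l
  proof -
    have "k = k1 \<or> E k1 k" "l = k1 \<or> E k1 l" using KC that by (auto simp: C_def)
    then show ?thesis using E_sym E_trans[of k k1 l] that k1(1) by blast
  qed
  define n where "n = card K"
  have n2: "2 \<le> n"
  proof -
    have "card {k1, k2} \<le> n" unfolding n_def using finK k1 k2 by (intro card_mono) auto
    then show ?thesis using k2 by simp
  qed
  obtain l where bij: "bij_betw l {1..n} K"
    using ex_bij_betw_nat_finite_1[OF finK] unfolding n_def by blast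
  have lK: "l i \<in> K" if "i \<in> {1..n}" for i using bij that by (auto simp: bij_betw_def)
  have l_inner: "l i \<bullet> l j = L * of_bool (i = j)" if "i \<in> {1..n}" "j \<in> {1..n}" for i j
  proof -
    have "l i = l j \<longleftrightarrow> i = j" using bij that by (auto simp: bij_betw_def inj_on_eq_iff)
    then show ?thesis using Kinner lK that by simp
  qed
  define \<alpha> where "\<alpha> i = (if i < n then (1/2) *\<^sub>R (l i - l (Suc i)) else l n)" for i
  \<comment> \<open>The factor is halved for \<open>i = n\<close>, where \<open>\<alpha> n = l n\<close> carries no factor \<open>1/2\<close>.\<close>
  define y where "y i = (if i < n then 2 / L else 1 / L) *\<^sub>R (\<Sum>j=1..i. l j)" for i
  have mem: "\<alpha> i \<in> \<Phi>" if "i \<in> {1..n}" for i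
  proof (cases "i < n")
    case True
    have "l i \<noteq> l (Suc i)" using l_inner[of i "Suc i"] l_inner[of i i] True that L_pos by auto
    then show ?thesis using True that E_all[of "l i" "l (Suc i)"] lK by (auto simp: \<alpha>_def E_def)
  next
    case False
    then show ?thesis using that lK Klong long_root by (simp add: \<alpha>_def)
  qed
  have sum_l: "(\<Sum>j=1..i. l j) \<bullet> l k = L * of_bool (k \<le> i)" if "i \<in> {1..n}" "k \<in> {1..n}" for i k
  proof -
    have "(\<Sum>j=1..i. l j) \<bullet> l k = (\<Sum>j=1..i. if j = k then L else 0)"
      unfolding inner_sum_left using that by (intro sum.cong) (auto simp: l_inner)
    then show ?thesis using that by simp
  qed
  have dual: "y i \<bullet> \<alpha> j = of_bool (i = j)" if "i \<in> {1..n}" "j \<in> {1..n}" for i j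
  proof (cases "j < n")
    case True
    then show ?thesis using that L_pos sum_l[of i j] sum_l[of i "Suc j"]
      by (auto simp: y_def \<alpha>_def inner_diff_right)
  next
    case False
    then show ?thesis using that L_pos sum_l[of i n]
      by (auto simp: y_def \<alpha>_def)
  qed
  have D: "nonneg_comb \<alpha> n ((1/2) *\<^sub>R (l i - l j))" if "i \<in> {1..n}" "j \<in> {1..n}" "i \<le> j" for i j
    using that(3,1,2)
  proof (induction j rule: dec_induct)
    case base
    then show ?case by (simp add: nonneg_comb_0)
  next
    case (step j)
    have "nonneg_comb \<alpha> n ((1/2) *\<^sub>R (l i - l j) + \<alpha> j)"
      using step by (intro nonneg_comb_add nonneg_comb_simple) auto
    moreover have "(1/2) *\<^sub>R (l i - l j) + \<alpha> j = (1/2) *\<^sub>R (l i - l (Suc j))"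
      using step by (simp add: \<alpha>_def algebra_simps)
    ultimately show ?case by simp
  qed
  have P: "nonneg_comb \<alpha> n ((1/2) *\<^sub>R (l i + l j))" if "i \<in> {1..n}" "j \<in> {1..n}" for i j
  proof -
    have "nonneg_comb \<alpha> n ((1/2) *\<^sub>R (l i - l n) + (1/2) *\<^sub>R (l j - l n) + \<alpha> n)"
      using that by (intro nonneg_comb_add nonneg_comb_simple D) auto
    moreover have "(1/2) *\<^sub>R (l i - l n) + (1/2) *\<^sub>R (l j - l n) + \<alpha> n = (1/2) *\<^sub>R (l i + l j)"
      by (simp add: \<alpha>_def algebra_simps flip: scaleR_add_left)
    ultimately show ?thesis by simp
  qed
  have K_l: "\<exists>i\<in>{1..n}. k = l i" if "k \<in> K" for k
    using bij that unfolding bij_betw_def by blast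
  have comb: "nonneg_comb \<alpha> n b \<or> nonneg_comb \<alpha> n (- b)" if b: "b \<in> \<Phi>" for b
  proof (cases "b \<in> long")
    case True
    have pos: "nonneg_comb \<alpha> n k" if "k \<in> K" for k
    proof -
      obtain i where i: "i \<in> {1..n}" "k = l i" using K_l \<open>k \<in> K\<close> by blast
      have "(1/2) *\<^sub>R (l i + l i) = l i" by (simp flip: scaleR_2)
      then show ?thesis using P[OF i(1,1)] i(2) by simp
    qed
    then show ?thesis using longK[OF True] by blast
  next
    case False
    obtain k where k: "k \<in> K" "b \<bullet> k \<noteq> 0" using not_orthK[OF b] by blast
    from short_E[OF b False k] obtain k' where k': "k' \<in> K"
      "2 *\<^sub>R b \<in> {k - k', k + k', k' - k, - k - k'}" by blast
    obtain i j where ij: "i \<in> {1..n}" "k = l i" "j \<in> {1..n}" "k' = l j" using K_l k(1) k'(1) by metis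
    have "b = (1/2) *\<^sub>R (2 *\<^sub>R b)" by simp
    then have "b \<in> {(1/2) *\<^sub>R (l i - l j), (1/2) *\<^sub>R (l i + l j), (1/2) *\<^sub>R (l j - l i), (1/2) *\<^sub>R (- l i - l j)}"
      using k'(2) ij(2,4) by (metis insert_iff empty_iff)
    moreover have "(1/2) *\<^sub>R (- l i - l j) = - ((1/2) *\<^sub>R (l i + l j))"
      "(1/2) *\<^sub>R (l j - l i) = - ((1/2) *\<^sub>R (l i - l j))"
      by (simp_all add: algebra_simps)
    moreover have "nonneg_comb \<alpha> n ((1/2) *\<^sub>R (l i - l j)) \<or> nonneg_comb \<alpha> n (- ((1/2) *\<^sub>R (l i - l j)))"
      using D[of i j] D[of j i] ij calculation(3) by (cases "i \<le> j") auto
    ultimately show ?thesis using P[of i j] ij by (metis insert_iff empty_iff minus_minus)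
  qed
  have rb: "DIM('a) = n" "root_basis \<Phi> \<alpha>"
    by (rule root_basisI[of n \<alpha> y]; (rule mem dual comb, assumption+))+
  have cartan: "2 * (\<alpha> i \<bullet> \<alpha> j) / (\<alpha> j \<bullet> \<alpha> j) = of_int (cartan_C n i j)" if ij: "i \<in> {1..n}" "j \<in> {1..n}" for i j
  proof -
    have jj: "\<alpha> j \<bullet> \<alpha> j = (if j < n then L / 2 else L)"
      using ij by (auto simp: \<alpha>_def l_inner inner_diff_left inner_diff_right)
    have "\<alpha> i \<bullet> \<alpha> j = of_int (cartan_C n i j) * (if j < n then L / 4 else L / 2)"
      using ij n2 by (auto simp: \<alpha>_def l_inner inner_diff_left inner_diff_right cartan_C_def cartan_A_def)
    with jj L_pos show ?thesis by auto
  qed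
  show ?thesis
    unfolding type_C_def has_cartan_matrix_def rb(1) using rb(2) n2 cartan by (intro exI[of _ \<alpha>]) blast
qed

text \<open>The type is determined by the existence of short roots and by the size of a largest simplex.\<close>

lemma star_free_imp_type:
  assumes star: star_free
  shows "\<exists>\<alpha>. type_A \<Phi> \<alpha> \<or> type_C \<Phi> \<alpha> \<or> type_B3 \<Phi> \<alpha> \<or> type_G2 \<Phi> \<alpha>"
proof -
  obtain T where T: "maximal_simplex T" and card: "2 \<le> card T" using maximal_simplex_exists by blast
  have S: "long_simplex T" using T by (simp add: maximal_simplex_def)
  have "\<exists>t u. t \<in> T \<and> u \<in> T \<and> t \<noteq> u"
    using card by (metis card_le_Suc0_iff_eq card.infinite not_less_eq_eq numeral_2_eq_2 zero_le)
  then obtain t0 u0 where tu0: "t0 \<in> T" "u0 \<in> T" "t0 \<noteq> u0" by blast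
  define e0 where "e0 = t0 - u0"
  have e0: "e0 \<in> edges T" "e0 \<in> \<Phi>" unfolding e0_def using edgesI[OF tu0] edges_long[OF S] long_root by blast+
  have long_split: "r \<in> edges T \<or> (\<forall>x\<in>edges T. r \<bullet> x = 0)" if "r \<in> long" for r
    using long_edge_or_orthogonal[OF T star that] unfolding edges_def[of T] by blast
  note none = no_root_orthogonal[OF e0(2) span_base[OF e0(1)]]
  show ?thesis
  proof (cases "\<Phi> \<subseteq> long")
    case True
    have split: "r \<in> span (edges T) \<or> (\<forall>x\<in>edges T. r \<bullet> x = 0)" if "r \<in> \<Phi>" for r
      using long_split True that span_base by blast
    have "\<Phi> = edges T"
    proof
      show "\<Phi> \<subseteq> edges T" using long_split True none[OF split] by blast
      show "edges T \<subseteq> \<Phi>" using edges_long[OF S] long_root by blast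
    qed
    from type_A_from_simplex[OF S card this] show ?thesis by blast
  next
    case False
    then obtain s0 where s0: "s0 \<in> \<Phi>" "s0 \<notin> long" by blast
    show ?thesis
    proof (cases "card T = 2")
      case True
      from type_C_from_frame[OF T True s0] show ?thesis by blast
    next
      case False
      then have card3: "3 \<le> card T" using card by simp
      define B where "B b \<longleftrightarrow> (\<exists>t v u w. T = {t, v, u, w} \<and> distinct [t, v, u, w] \<and> 2 *\<^sub>R b = t + v - u - w)" for b
      define G where "G b \<longleftrightarrow> (\<exists>x y z. T = {x, y, z} \<and> distinct [x, y, z] \<and>
        (3 *\<^sub>R b = x + y - 2 *\<^sub>R z \<or> 3 *\<^sub>R (- b) = x + y - 2 *\<^sub>R z))" for b
      have short: "B s \<or> G s" if s: "s \<in> \<Phi>" "s \<notin> long" and no: "\<not> (\<forall>x\<in>edges T. s \<bullet> x = 0)" for s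
      proof -
        have se: "s \<notin> edges T" using s edges_long[OF S] by blast
        obtain t u where tu: "t \<in> T" "u \<in> T" "t \<noteq> u" and val: "s \<bullet> (t - u) \<noteq> 0"
          using no unfolding edges_def by blast
        then have "s \<bullet> (t - u) = L / 2 \<or> s \<bullet> (u - t) = L / 2"
          using inner_edge_values[OF S s(1) se tu(1,2)] by (auto simp: inner_diff_right)
        then obtain t u where tu: "t \<in> T" "u \<in> T" "t \<noteq> u" and val: "s \<bullet> (t - u) = L / 2"
          using tu by metis
        have "t - u \<in> long" using S tu by (simp add: long_simplex_def)
        from short_sqnorm[OF s this val] show ?thesis
          using short_half_form[OF T star card3 s(1) _ tu(1,2) val]
            short_third_form[OF T star s(1) _ tu(1,2) val] unfolding B_def G_def by blast
      qed
      have span_edge: "x - y \<in> span (edges T)" if "x \<in> T" "y \<in> T" for x y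
        using that edgesI[of x T y] by (cases "x = y") (auto intro: span_base span_zero)
      have B_span: "b \<in> span (edges T)" if "B b" for b
      proof -
        from that obtain t v u w where T4: "T = {t, v, u, w}" and b: "2 *\<^sub>R b = t + v - u - w"
          unfolding B_def by blast
        have eq: "t + v - u - w = (t - u) + (v - w)" by simp
        have "2 *\<^sub>R b \<in> span (edges T)" unfolding b eq using T4 by (intro span_add span_edge) auto
        then have "(1/2) *\<^sub>R (2 *\<^sub>R b) \<in> span (edges T)" by (rule span_scale)
        then show ?thesis by simp
      qed
      have G_span: "b \<in> span (edges T)" if "G b" for b
      proof -
        from that obtain x y z where T3: "T = {x, y, z}" and b: "3 *\<^sub>R b = x + y - 2 *\<^sub>R z \<or> 3 *\<^sub>R (- b) = x + y - 2 *\<^sub>R z"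
          unfolding G_def by blast
        have eq: "x + y - 2 *\<^sub>R z = (x - z) + (y - z)" by (simp add: scaleR_2)
        have *: "x + y - 2 *\<^sub>R z \<in> span (edges T)" unfolding eq using T3 by (intro span_add span_edge) auto
        have "b = (1/3) *\<^sub>R (3 *\<^sub>R b)" "b = (- 1/3) *\<^sub>R (3 *\<^sub>R (- b))" by simp_all
        then show ?thesis using b span_scale[OF *] by metis
      qed
      have split: "r \<in> span (edges T) \<or> (\<forall>x\<in>edges T. r \<bullet> x = 0)" if "r \<in> \<Phi>" for r
        using long_split[of r] short[OF that] B_span G_span span_base by blast
      have roots: "r \<in> edges T \<or> B r \<or> G r" if r: "r \<in> \<Phi>" for r
      proof -
        have "\<not> (\<forall>x\<in>edges T. r \<bullet> x = 0)" using none[OF split r] by blast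
        then show ?thesis using long_split[of r] short[OF r] by (cases "r \<in> long") auto
      qed
      have "s0 \<notin> edges T" using s0 edges_long[OF S] by blast
      then consider "B s0" | "G s0" using roots[OF s0(1)] by blast
      then show ?thesis
      proof cases
        case 1
        then obtain t v u w where T4: "T = {t, v, u, w}" "distinct [t, v, u, w]" "2 *\<^sub>R s0 = t + v - u - w"
          unfolding B_def by blast
        have card4: "card T = 4" using T4(1,2) by simp
        have "b \<in> edges T \<or> (\<exists>x y. x \<in> T \<and> y \<in> T \<and> x \<noteq> y \<and> 2 *\<^sub>R b = 2 *\<^sub>R (x + y) - (t + v + u + w))"
          if b: "b \<in> \<Phi>" for b
        proof -
          have "\<not> G b"
          proof
            assume "G b"
            then obtain x y z where "T = {x, y, z}" unfolding G_def by metis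
            then have "card T \<le> 3" by (simp add: card_insert_if)
            then show False using card4 by simp
          qed
          moreover have ?thesis if "B b"
          proof -
            from that obtain x y x' y' where b4: "T = {x, y, x', y'}" "distinct [x, y, x', y']"
              "2 *\<^sub>R b = x + y - x' - y'" unfolding B_def by blast
            have "x + y + x' + y' = \<Sum>T" using b4(1,2) by simp
            moreover have "t + v + u + w = \<Sum>T" using T4(1,2) by simp
            moreover have "x + y - x' - y' = 2 *\<^sub>R (x + y) - (x + y + x' + y')" by (simp add: scaleR_2)
            ultimately have "2 *\<^sub>R b = 2 *\<^sub>R (x + y) - (t + v + u + w)" using b4(3) by metis
            then show ?thesis using b4(1,2) by (intro disjI2 exI[of _ x] exI[of _ y]) auto
          qed
          ultimately show ?thesis using roots[OF b] by blast
        qed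
        from type_B3_from_simplex[OF S T4(1,2) s0(1) T4(3) this] show ?thesis by blast
      next
        case 2
        then obtain x y z where T3: "T = {x, y, z}" "distinct [x, y, z]"
          and "3 *\<^sub>R s0 = x + y - 2 *\<^sub>R z \<or> 3 *\<^sub>R (- s0) = x + y - 2 *\<^sub>R z"
          unfolding G_def by blast
        then obtain s where s: "s \<in> \<Phi>" "3 *\<^sub>R s = x + y - 2 *\<^sub>R z"
          using s0(1) minus_root[OF s0(1)] by blast
        have card3: "card T = 3" using T3(1,2) by simp
        have "b \<in> edges T \<or> (\<exists>p\<in>T. 3 *\<^sub>R b = x + y + z - 3 *\<^sub>R p \<or> 3 *\<^sub>R (- b) = x + y + z - 3 *\<^sub>R p)"
          if b: "b \<in> \<Phi>" for b
        proof -
          have "\<not> B b"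
          proof
            assume "B b"
            then obtain t v u w where "T = {t, v, u, w}" "distinct [t, v, u, w]" unfolding B_def by blast
            then have "card T = 4" by simp
            then show False using card3 by simp
          qed
          moreover have ?thesis if "G b"
          proof -
            from that obtain x' y' z' where b3: "T = {x', y', z'}" "distinct [x', y', z']"
              "3 *\<^sub>R b = x' + y' - 2 *\<^sub>R z' \<or> 3 *\<^sub>R (- b) = x' + y' - 2 *\<^sub>R z'" unfolding G_def by blast
            have "x' + y' + z' = \<Sum>T" using b3(1,2) by simp
            also have "\<Sum>T = x + y + z" using T3(1,2) by simp
            finally have "x' + y' - 2 *\<^sub>R z' = x + y + z - 3 *\<^sub>R z'" by (simp add: scaleR_2 scaleR_3 algebra_simps)
            moreover have "z' \<in> T" using b3(1) by blast
            ultimately show ?thesis using b3(3) by metis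
          qed
          ultimately show ?thesis using roots[OF b] by blast
        qed
        from type_G2_from_simplex[OF S T3(1,2) s this] show ?thesis by blast
      qed
    qed
  qed
qed

end

section \<open>Weyl orbits in the dual space\<close>

lemma reflection_minus: "reflection (- a) = reflection a"
  by (rule ext) (simp add: reflection_def)

lemma reflection_conjugate:
  "reflection (reflection s a) v = reflection s (reflection a (reflection s v))"
proof -
  have "reflection (reflection s a) v =
      v - (2 * (reflection s v \<bullet> a) / (a \<bullet> a)) *\<^sub>R reflection s a"
    using inner_reflection_reflection[of s "reflection s v" a] inner_reflection_reflection[of s a a]
    by (simp add: reflection_def[of "reflection s a"])
  also have "\<dots> = reflection s (reflection s v - (2 * (reflection s v \<bullet> a) / (a \<bullet> a)) *\<^sub>R a)"
    by (simp add: linear_diff[OF linear_reflection] linear_scale[OF linear_reflection])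
  finally show ?thesis by (simp add: reflection_def[of a])
qed

definition dual_reflection :: "'a::euclidean_space \<Rightarrow> ('a \<Rightarrow>\<^sub>L real) \<Rightarrow> ('a \<Rightarrow>\<^sub>L real)" where
  "dual_reflection a x = Blinfun (\<lambda>v. x (reflection a v))"

lemma blinfun_apply_linear_comp:
  fixes x :: "'a::euclidean_space \<Rightarrow>\<^sub>L real" and f :: "'a \<Rightarrow> 'a"
  assumes "linear f"
  shows "blinfun_apply (Blinfun (\<lambda>v. x (f v))) = (\<lambda>v. x (f v))"
proof (rule bounded_linear_Blinfun_apply)
  have "bounded_linear f" using assms by (simp add: linear_conv_bounded_linear)
  then show "bounded_linear (\<lambda>v. x (f v))"
    by (rule bounded_linear_compose[OF blinfun.bounded_linear_right])
qed

lemma dual_reflection_apply: "dual_reflection a x v = x (reflection a v)"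
  unfolding dual_reflection_def blinfun_apply_linear_comp[OF linear_reflection] ..

lemma weyl_group_linear_bij: "w \<in> weyl_group \<Phi> \<Longrightarrow> linear w \<and> bij w"
proof (induction rule: weyl_group.induct)
  case weyl_id
  show ?case using linear_id bij_id by blast
next
  case (weyl_reflection w a)
  have "bij (reflection a)" by (rule o_bij[of "reflection a"]) (auto simp: fun_eq_iff)
  then show ?case using weyl_reflection by (intro conjI linear_compose linear_reflection bij_comp) blast+
qed

lemma dual_action_apply:
  assumes "w \<in> weyl_group \<Phi>"
  shows "dual_action w x v = x (inv w v)"
proof -
  have "linear (inv w)"
    using weyl_group_linear_bij[OF assms] by (auto intro!: inj_linear_imp_inv_linear bij_is_inj)
  from blinfun_apply_linear_comp[OF this] show ?thesis unfolding dual_action_def by metis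
qed

lemma weyl_orbit_self: "x \<in> weyl_orbit \<Phi> x"
proof -
  have "dual_action id x = x"
    by (rule blinfun_eqI) (simp add: dual_action_apply[OF weyl_group.weyl_id])
  then show ?thesis unfolding weyl_orbit_def by (metis image_eqI weyl_group.weyl_id)
qed

lemma dual_action_reflection:
  assumes w: "w \<in> weyl_group \<Phi>" and a: "a \<in> \<Phi>"
  shows "dual_action (reflection a \<circ> w) x = dual_reflection a (dual_action w x)"
proof (rule blinfun_eqI)
  fix v
  have bij: "bij (reflection a)" by (rule o_bij[of "reflection a"]) (auto simp: fun_eq_iff)
  have "inv (reflection a) = reflection a" by (rule inv_equality) auto
  then have "inv (reflection a \<circ> w) = inv w \<circ> reflection a"
    using o_inv_distrib[OF bij] weyl_group_linear_bij[OF w] by metis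
  then show "dual_action (reflection a \<circ> w) x v = dual_reflection a (dual_action w x) v"
    using dual_action_apply[OF weyl_group.weyl_reflection[OF w a]] dual_action_apply[OF w]
    by (simp add: dual_reflection_apply)
qed

lemma weyl_orbit_dual_reflection:
  assumes "y \<in> weyl_orbit \<Phi> x" "a \<in> \<Phi>"
  shows "dual_reflection a y \<in> weyl_orbit \<Phi> x"
proof -
  obtain w where w: "w \<in> weyl_group \<Phi>" "y = dual_action w x"
    using assms(1) unfolding weyl_orbit_def by blast
  show ?thesis
    unfolding weyl_orbit_def w(2) dual_action_reflection[OF w(1) assms(2), symmetric]
    by (rule imageI) (rule weyl_group.weyl_reflection[OF w(1) assms(2)])
qed

text \<open>With \<open>weyl_orbit_self\<close> and \<open>weyl_orbit_dual_reflection\<close> this says that the orbit is the least set that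
  contains \<open>x\<close> and is closed under reflections.\<close>

lemma weyl_orbit_subset:
  assumes "x \<in> X" and closed: "\<And>a y. a \<in> \<Phi> \<Longrightarrow> y \<in> X \<Longrightarrow> dual_reflection a y \<in> X"
  shows "weyl_orbit \<Phi> x \<subseteq> X"
proof -
  have "dual_action w x \<in> X" if "w \<in> weyl_group \<Phi>" for w
    using that
  proof induction
    case weyl_id
    have "dual_action id x = x"
      by (rule blinfun_eqI) (simp add: dual_action_apply[OF weyl_group.weyl_id])
    with assms(1) show ?case by metis
  next
    case (weyl_reflection w a)
    then show ?case using closed dual_action_reflection by metis
  qed
  then show ?thesis by (auto simp: weyl_orbit_def)
qed

section \<open>Zonotopes over finite families\<close>

lemma sum_in_Nats: "(\<And>i. i \<in> A \<Longrightarrow> f i \<in> \<nat>) \<Longrightarrow> sum f A \<in> (\<nat> :: real set)"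
  by (induction A rule: infinite_finite_induct) auto

lemma ZT_image:
  assumes "finite I" "inj_on f I"
  shows "ZT (f ` I) = {\<Sum>i\<in>I. c i *\<^sub>R f i | c. \<forall>i\<in>I. 0 \<le> c i \<and> c i \<le> 1}" (is "_ = ?R")
proof
  show "ZT (f ` I) \<subseteq> ?R"
  proof
    fix z assume "z \<in> ZT (f ` I)"
    then obtain t where t: "\<forall>v\<in>f ` I. 0 \<le> t v \<and> t v \<le> 1" "z = (\<Sum>v\<in>f ` I. t v *\<^sub>R v)"
      unfolding ZT_def by blast
    then have "z = (\<Sum>i\<in>I. t (f i) *\<^sub>R f i)" by (simp add: sum.reindex[OF assms(2)])
    then show "z \<in> ?R" using t(1) by (intro CollectI exI[of _ "\<lambda>i. t (f i)"]) auto
  qed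
  show "?R \<subseteq> ZT (f ` I)"
  proof
    fix z assume "z \<in> ?R"
    then obtain c where c: "\<forall>i\<in>I. 0 \<le> c i \<and> c i \<le> 1" "z = (\<Sum>i\<in>I. c i *\<^sub>R f i)" by blast
    have "z = (\<Sum>v\<in>f ` I. c (inv_into I f v) *\<^sub>R v)"
      unfolding c(2) sum.reindex[OF assms(2)] using assms(2) by (intro sum.cong) auto
    then show "z \<in> ZT (f ` I)" unfolding ZT_def
      using c(1) assms(2) by (intro CollectI exI[of _ "\<lambda>v. c (inv_into I f v)"]) auto
  qed
qed

text \<open>A pair of opposite generators with coefficients in \<open>[0, 1]\<close> amounts to one generator with a
  coefficient in \<open>[-1, 1]\<close>.\<close>

lemma ZT_image_symmetric:
  assumes fin: "finite I" and inj: "inj_on f I" and ne: "\<And>i j. i \<in> I \<Longrightarrow> j \<in> I \<Longrightarrow> f i \<noteq> - f j"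
  shows "ZT (f ` I \<union> (\<lambda>i. - f i) ` I) = {\<Sum>i\<in>I. c i *\<^sub>R f i | c. \<forall>i\<in>I. -1 \<le> c i \<and> c i \<le> 1}" (is "_ = ?R")
proof -
  define g where "g p = (if snd p then f (fst p) else - f (fst p))" for p
  define J where "J = I \<times> (UNIV :: bool set)"
  have J: "finite J" using fin by (simp add: J_def)
  have injg: "inj_on g J"
  proof (rule inj_onI)
    fix p q assume pq: "p \<in> J" "q \<in> J" and "g p = g q"
    then show "p = q"
      using inj ne[of "fst p" "fst q"] ne[of "fst q" "fst p"]
      by (cases p; cases q) (auto simp: g_def J_def inj_on_eq_iff split: if_splits)
  qed
  have img: "f ` I \<union> (\<lambda>i. - f i) ` I = g ` J"
  proof -
    have "J = (\<lambda>i. (i, True)) ` I \<union> (\<lambda>i. (i, False)) ` I"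
      unfolding J_def by (auto simp: UNIV_bool)
    then show ?thesis by (simp only: image_Un image_image) (simp add: g_def)
  qed
  have sumJ: "(\<Sum>p\<in>J. c p *\<^sub>R g p) = (\<Sum>i\<in>I. (c (i, True) - c (i, False)) *\<^sub>R f i)" for c
  proof -
    have "(\<Sum>p\<in>J. c p *\<^sub>R g p) = (\<Sum>i\<in>I. \<Sum>b\<in>UNIV. c (i, b) *\<^sub>R g (i, b))"
      unfolding J_def sum.cartesian_product by simp
    also have "\<dots> = (\<Sum>i\<in>I. (c (i, True) - c (i, False)) *\<^sub>R f i)"
      by (simp add: UNIV_bool g_def scaleR_left_diff_distrib add.commute)
    finally show ?thesis .
  qed
  show ?thesis
  proof
    show "ZT (f ` I \<union> (\<lambda>i. - f i) ` I) \<subseteq> ?R"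
    proof
      fix z assume "z \<in> ZT (f ` I \<union> (\<lambda>i. - f i) ` I)"
      then obtain c where c: "\<forall>p\<in>J. 0 \<le> c p \<and> c p \<le> 1" "z = (\<Sum>p\<in>J. c p *\<^sub>R g p)"
        unfolding img ZT_image[OF J injg] by blast
      have "- 1 \<le> c (i, True) - c (i, False) \<and> c (i, True) - c (i, False) \<le> 1" if "i \<in> I" for i
        using c(1) that unfolding J_def by (smt (verit) SigmaI UNIV_I)
      then show "z \<in> ?R" unfolding c(2) sumJ by (intro CollectI exI[of _ "\<lambda>i. c (i, True) - c (i, False)"]) auto
    qed
    show "?R \<subseteq> ZT (f ` I \<union> (\<lambda>i. - f i) ` I)"
    proof
      fix z assume "z \<in> ?R"
      then obtain c where c: "\<forall>i\<in>I. - 1 \<le> c i \<and> c i \<le> 1" "z = (\<Sum>i\<in>I. c i *\<^sub>R f i)" by blast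
      define d where "d p = (if snd p then max 0 (c (fst p)) else max 0 (- c (fst p)))" for p
      have "d (i, True) - d (i, False) = c i" for i by (simp add: d_def)
      then have "z = (\<Sum>p\<in>J. d p *\<^sub>R g p)" unfolding sumJ c(2) by simp
      moreover have "\<forall>p\<in>J. 0 \<le> d p \<and> d p \<le> 1" using c(1) by (auto simp: d_def J_def)
      ultimately show "z \<in> ZT (f ` I \<union> (\<lambda>i. - f i) ` I)"
        unfolding img ZT_image[OF J injg] by blast
    qed
  qed
qed

section \<open>Root systems with a root basis\<close>

text \<open>The rank is a separate parameter \<open>n\<close> so that index sets read \<open>{1..n}\<close>.\<close>

locale based_root_system = irreducible_root_system \<Phi> for \<Phi> :: "'a::euclidean_space set" +
  fixes \<alpha> :: "nat \<Rightarrow> 'a" and n :: nat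
  assumes root_basis: "root_basis \<Phi> \<alpha>" and n_eq: "n = DIM('a)"
begin

lemma n_pos: "1 \<le> n" unfolding n_eq using DIM_positive[where 'a='a] by linarith

lemma simple_inj: "inj_on \<alpha> {1..n}"
  using root_basis[unfolded root_basis_def, folded n_eq] by (rule conjunct1)

lemma simple_root: "i \<in> {1..n} \<Longrightarrow> \<alpha> i \<in> \<Phi>"
  using root_basis[unfolded root_basis_def, folded n_eq, THEN conjunct2, THEN conjunct1] by (rule subsetD) (rule imageI)

lemma simple_independent: "independent (\<alpha> ` {1..n})"
  using root_basis[unfolded root_basis_def, folded n_eq, THEN conjunct2, THEN conjunct2] by (rule conjunct1)

lemma simple_span: "span (\<alpha> ` {1..n}) = UNIV"
  using root_basis[unfolded root_basis_def, folded n_eq, THEN conjunct2, THEN conjunct2, THEN conjunct2]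
  by (rule conjunct1)

lemma root_comb:
  "\<forall>b\<in>\<Phi>. \<exists>c::nat \<Rightarrow> nat. b = (\<Sum>i=1..n. real (c i) *\<^sub>R \<alpha> i) \<or> b = - (\<Sum>i=1..n. real (c i) *\<^sub>R \<alpha> i)"
  using root_basis[unfolded root_basis_def, folded n_eq, THEN conjunct2, THEN conjunct2, THEN conjunct2]
  by (rule conjunct2)

lemma in_simple_span: "v \<in> span (\<alpha> ` {1..n})"
  unfolding simple_span by (rule UNIV_I)

lemma functional_exists: "\<exists>x :: 'a \<Rightarrow>\<^sub>L real. \<forall>j\<in>{1..n}. x (\<alpha> j) = f j"
proof -
  obtain g where g: "linear g" "\<forall>v\<in>\<alpha> ` {1..n}. g v = (f (inv_into {1..n} \<alpha> v) :: real)"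
    using linear_independent_extend[OF simple_independent, of "\<lambda>v. f (inv_into {1..n} \<alpha> v)"] by metis
  have "Blinfun g (\<alpha> j) = f j" if "j \<in> {1..n}" for j
    using g that simple_inj by (simp add: bounded_linear_Blinfun_apply linear_conv_bounded_linear)
  then show ?thesis by blast
qed

lemma functional_eqI:
  fixes x y :: "'a \<Rightarrow>\<^sub>L real"
  assumes "\<And>j. j \<in> {1..n} \<Longrightarrow> x (\<alpha> j) = y (\<alpha> j)"
  shows "x = y"
proof (rule blinfun_eqI)
  fix v
  have "linear (blinfun_apply x)" "linear (blinfun_apply y)"
    by (simp_all add: blinfun.bounded_linear_right bounded_linear.linear)
  then show "x v = y v"
    using linear_eq_on_span[of "blinfun_apply x" "blinfun_apply y" "\<alpha> ` {1..n}" v] assms in_simple_span by blast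
qed

abbreviation \<omega> :: "nat \<Rightarrow> ('a \<Rightarrow>\<^sub>L real)" where "\<omega> \<equiv> fundamental_coweight \<alpha>"

lemma coweight_simple: "j \<in> {1..n} \<Longrightarrow> \<omega> i (\<alpha> j) = (if i = j then 1 else 0)"
proof -
  assume j: "j \<in> {1..n}"
  obtain x :: "'a \<Rightarrow>\<^sub>L real" where x: "\<forall>j\<in>{1..n}. x (\<alpha> j) = (if i = j then 1 else 0)"
    using functional_exists[of "\<lambda>j. if i = j then 1 else 0"] by blast
  have "\<forall>j\<in>{1..n}. \<omega> i (\<alpha> j) = (if i = j then 1 else 0)"
    unfolding fundamental_coweight_def n_eq[symmetric] by (rule theI[of _ x]) (use x in \<open>auto intro!: functional_eqI\<close>)
  with j show ?thesis by blast
qed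

lemma coweight_expansion: "v = (\<Sum>i=1..n. \<omega> i v *\<^sub>R \<alpha> i)"
proof -
  have lin: "linear (\<lambda>v. \<Sum>i=1..n. \<omega> i v *\<^sub>R \<alpha> i)"
    by (rule linearI) (simp_all add: blinfun.add_right blinfun.scaleR_right scaleR_left_distrib sum.distrib scaleR_sum_right)
  have "id w = (\<Sum>i=1..n. \<omega> i w *\<^sub>R \<alpha> i)" if w: "w \<in> \<alpha> ` {1..n}" for w
  proof -
    obtain j where j: "j \<in> {1..n}" "w = \<alpha> j" using w by blast
    have "(\<Sum>i=1..n. \<omega> i (\<alpha> j) *\<^sub>R \<alpha> i) = (\<Sum>i=1..n. if i = j then \<alpha> i else 0)"
      using j(1) by (intro sum.cong) (auto simp: coweight_simple)
    then show ?thesis using j by simp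
  qed
  then have "id v = (\<Sum>i=1..n. \<omega> i v *\<^sub>R \<alpha> i)"
    using linear_eq_on_span[OF linear_id lin, of "\<alpha> ` {1..n}" v] in_simple_span by blast
  then show ?thesis by simp
qed

lemma coweight_separates: "(\<And>i. i \<in> {1..n} \<Longrightarrow> \<omega> i u = \<omega> i v) \<Longrightarrow> u = v"
  by (subst coweight_expansion, subst (2) coweight_expansion) simp

lemma coweight_root:
  assumes "b \<in> \<Phi>"
  shows "(\<forall>i\<in>{1..n}. \<omega> i b \<in> \<nat>) \<or> (\<forall>i\<in>{1..n}. - \<omega> i b \<in> \<nat>)"
proof -
  have val: "\<omega> i (\<Sum>j=1..n. real (c j) *\<^sub>R \<alpha> j) = real (c i)" if "i \<in> {1..n}" for i and c :: "nat \<Rightarrow> nat"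
  proof -
    have "\<omega> i (\<Sum>j=1..n. real (c j) *\<^sub>R \<alpha> j) = (\<Sum>j=1..n. if j = i then real (c j) else 0)"
      unfolding blinfun.sum_right by (intro sum.cong) (auto simp: blinfun.scaleR_right coweight_simple)
    then show ?thesis using that by simp
  qed
  obtain c :: "nat \<Rightarrow> nat" where "b = (\<Sum>i=1..n. real (c i) *\<^sub>R \<alpha> i) \<or> b = - (\<Sum>i=1..n. real (c i) *\<^sub>R \<alpha> i)"
    using root_comb assms by blast
  then show ?thesis
  proof
    assume b: "b = (\<Sum>i=1..n. real (c i) *\<^sub>R \<alpha> i)"
    have "\<omega> i b = real (c i)" if "i \<in> {1..n}" for i unfolding b using val[OF that] .
    then show ?thesis by simp
  next
    assume b: "b = - (\<Sum>i=1..n. real (c i) *\<^sub>R \<alpha> i)"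
    have "- \<omega> i b = real (c i)" if "i \<in> {1..n}" for i unfolding b blinfun.minus_right using val[OF that] by simp
    then show ?thesis by simp
  qed
qed

text \<open>Every root arises from the simple roots by simple reflections and a change of sign. For a positive
  root \<open>b\<close> that is not simple, some simple root \<open>\<alpha> i\<close> has a positive coefficient in \<open>b\<close> and satisfies
  \<open>\<alpha> i \<bullet> b > 0\<close>, since \<open>b \<bullet> b > 0\<close>. The reflection in \<open>\<alpha> i\<close> changes only the coefficient of \<open>\<alpha> i\<close>, so the
  result still has a positive coefficient and is a positive root; its height is smaller.\<close>

lemma root_induct [consumes 1, case_names simple minus reflection]:
  assumes "b \<in> \<Phi>"
    and simple: "\<And>i. i \<in> {1..n} \<Longrightarrow> P (\<alpha> i)"
    and minus: "\<And>b. b \<in> \<Phi> \<Longrightarrow> P b \<Longrightarrow> P (- b)"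
    and refl: "\<And>b i. b \<in> \<Phi> \<Longrightarrow> i \<in> {1..n} \<Longrightarrow> P b \<Longrightarrow> P (reflection (\<alpha> i) b)"
  shows "P b"
proof -
  have pos: "P b" if "b \<in> \<Phi>" "\<forall>i\<in>{1..n}. \<omega> i b \<in> \<nat>" "(\<Sum>i=1..n. \<omega> i b) = real N" for b N
    using that
  proof (induction N arbitrary: b rule: less_induct)
    case (less N)
    note b = less.prems
    have nonneg: "0 \<le> \<omega> i b" if "i \<in> {1..n}" for i
      using b(2) that by (metis Nats_cases of_nat_0_le_iff)
    have "b \<noteq> 0" using b(1) zero_not_root by blast
    then have "0 < b \<bullet> b" by simp
    also have "b \<bullet> b = (\<Sum>i=1..n. \<omega> i b *\<^sub>R \<alpha> i) \<bullet> b" using coweight_expansion[of b] by simp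
    also have "\<dots> = (\<Sum>i=1..n. \<omega> i b * (\<alpha> i \<bullet> b))" by (simp add: inner_sum_left)
    finally have "\<exists>i\<in>{1..n}. 0 < \<omega> i b * (\<alpha> i \<bullet> b)" by (meson not_le sum_nonpos)
    then obtain i where i: "i \<in> {1..n}" "0 < \<omega> i b * (\<alpha> i \<bullet> b)" by blast
    then have ib: "0 < \<omega> i b" "0 < \<alpha> i \<bullet> b" using nonneg[OF i(1)] by (auto simp: zero_less_mult_iff)
    define k where "k = 2 * (b \<bullet> \<alpha> i) / (\<alpha> i \<bullet> \<alpha> i)"
    have "\<alpha> i \<bullet> \<alpha> i > 0" using simple_root[OF i(1)] zero_not_root by (metis inner_gt_zero_iff)
    then have kpos: "0 < k" using ib by (simp add: k_def inner_commute)
    moreover have "k \<in> \<int>" unfolding k_def by (rule Cartan_integer[OF b(1) simple_root[OF i(1)]])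
    ultimately have k1: "1 \<le> k" by (auto elim!: Ints_cases)
    define b' where "b' = reflection (\<alpha> i) b"
    have b'_eq: "b' = b - k *\<^sub>R \<alpha> i" by (simp add: b'_def reflection_def k_def)
    have b': "b' \<in> \<Phi>" unfolding b'_def by (rule reflection_root[OF simple_root[OF i(1)] b(1)])
    have \<omega>b': "\<omega> j b' = \<omega> j b - (if j = i then k else 0)" for j
      using i(1) by (simp add: b'_eq blinfun.diff_right blinfun.scaleR_right coweight_simple)
    show ?case
    proof (cases "\<exists>j\<in>{1..n}. j \<noteq> i \<and> 0 < \<omega> j b")
      case True
      then obtain j where j: "j \<in> {1..n}" "j \<noteq> i" "0 < \<omega> j b" by blast
      then have "- \<omega> j b' \<notin> \<nat>" using \<omega>b'[of j] by (auto elim!: Nats_cases)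
      then have nat: "\<forall>j\<in>{1..n}. \<omega> j b' \<in> \<nat>" using coweight_root[OF b'] j(1) by blast
      then have "(\<Sum>j=1..n. \<omega> j b') \<in> \<nat>" using sum_in_Nats[of "{1..n}" "\<lambda>j. \<omega> j b'"] by blast
      then obtain N' where N': "(\<Sum>j=1..n. \<omega> j b') = real N'" by (auto elim: Nats_cases)
      have "(\<Sum>j=1..n. \<omega> j b') = real N - k"
        using b(3) i(1) by (simp add: \<omega>b' sum_subtractf)
      then have "N' < N" using N' k1 by simp
      from less.IH[OF this b' nat N'] have "P (reflection (\<alpha> i) b')" by (rule refl[OF b' i(1)])
      then show ?thesis by (simp add: b'_def)
    next
      case False
      then have zero: "\<omega> j b = 0" if "j \<in> {1..n}" "j \<noteq> i" for j using nonneg[OF that(1)] that by force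
      have "b = (\<Sum>j=1..n. \<omega> j b *\<^sub>R \<alpha> j)" by (rule coweight_expansion)
      also have "\<dots> = (\<Sum>j=1..n. if j = i then \<omega> i b *\<^sub>R \<alpha> i else 0)"
        by (rule sum.cong) (auto simp: zero)
      also have "\<dots> = \<omega> i b *\<^sub>R \<alpha> i" using i(1) by simp
      finally have b_eq: "b = \<omega> i b *\<^sub>R \<alpha> i" .
      then have "\<omega> i b = 1 \<or> \<omega> i b = - 1" using multiple_root[OF simple_root[OF i(1)]] b(1) by metis
      then have "\<omega> i b = 1" using ib by linarith
      then show ?thesis using b_eq simple[OF i(1)] by simp
    qed
  qed
  have natsum: "\<exists>N. (\<Sum>i=1..n. \<omega> i b) = real N" if "\<forall>i\<in>{1..n}. \<omega> i b \<in> \<nat>" for b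
    using sum_in_Nats[of "{1..n}" "\<lambda>i. \<omega> i b"] that by (auto elim: Nats_cases)
  from coweight_root[OF assms(1)] show ?thesis
  proof
    assume "\<forall>i\<in>{1..n}. \<omega> i b \<in> \<nat>"
    then show ?thesis using pos[OF assms(1)] natsum by blast
  next
    assume "\<forall>i\<in>{1..n}. - \<omega> i b \<in> \<nat>"
    then have "\<forall>i\<in>{1..n}. \<omega> i (- b) \<in> \<nat>" by (simp add: blinfun.minus_right)
    then have "P (- b)" using pos[OF minus_root[OF assms(1)]] natsum by blast
    from minus[OF minus_root[OF assms(1)] this] show ?thesis by simp
  qed
qed

text \<open>The reflection in \<open>s b\<close>, where \<open>s\<close> is a simple reflection, is the conjugate by \<open>s\<close> of the reflection in
  \<open>b\<close>. So closure under simple reflections implies closure under all reflections.\<close>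

lemma weyl_orbit_subset_simple:
  assumes "x \<in> X" and closed: "\<And>i y. i \<in> {1..n} \<Longrightarrow> y \<in> X \<Longrightarrow> dual_reflection (\<alpha> i) y \<in> X"
  shows "weyl_orbit \<Phi> x \<subseteq> X"
proof (rule weyl_orbit_subset[OF assms(1)])
  fix a y assume "a \<in> \<Phi>" "y \<in> X"
  from \<open>a \<in> \<Phi>\<close> have "\<forall>y\<in>X. dual_reflection a y \<in> X"
  proof (induction rule: root_induct)
    case (simple i)
    then show ?case using closed by blast
  next
    case (minus b)
    then show ?case by (simp add: dual_reflection_def reflection_minus)
  next
    case (reflection b i)
    have "dual_reflection (reflection (\<alpha> i) b) y =
        dual_reflection (\<alpha> i) (dual_reflection b (dual_reflection (\<alpha> i) y))" for y
      by (rule blinfun_eqI) (simp add: dual_reflection_apply reflection_conjugate)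
    then show ?case using reflection closed by simp
  qed
  with \<open>y \<in> X\<close> show "dual_reflection a y \<in> X" by blast
qed

lemma dual_reflection_simple:
  assumes C: "has_cartan_matrix \<alpha> C" and "j \<in> {1..n}" "k \<in> {1..n}"
  shows "dual_reflection (\<alpha> k) x (\<alpha> j) = x (\<alpha> j) - of_int (C j k) * x (\<alpha> k)"
proof -
  have "2 * (\<alpha> j \<bullet> \<alpha> k) / (\<alpha> k \<bullet> \<alpha> k) = of_int (C j k)"
    using assms unfolding has_cartan_matrix_def n_eq by blast
  then show ?thesis
    by (simp add: dual_reflection_apply reflection_def blinfun.diff_right blinfun.scaleR_right)
qed

lemma coweight_int: "b \<in> \<Phi> \<Longrightarrow> i \<in> {1..n} \<Longrightarrow> \<omega> i b \<in> \<int>"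
  using coweight_root[of b] by (metis Ints_minus Nats_subset_Ints minus_minus subsetD)

text \<open>A root that dominates all others coefficientwise is the highest root, and its coefficients
  are the values of the fundamental coweights.\<close>

lemma highest_root_coeff_eq:
  assumes \<theta>: "\<theta> \<in> \<Phi>" and dom: "\<And>b i. b \<in> \<Phi> \<Longrightarrow> i \<in> {1..n} \<Longrightarrow> \<omega> i b \<le> \<omega> i \<theta>" and i: "i \<in> {1..n}"
  shows "highest_root_coeff \<Phi> \<alpha> i = \<omega> i \<theta>"
proof -
  have high: "is_highest_root \<Phi> \<alpha> \<theta>"
    unfolding is_highest_root_def n_eq[symmetric]
  proof (intro conjI ballI)
    fix b assume b: "b \<in> \<Phi>"
    define c where "c i = nat \<lfloor>\<omega> i (\<theta> - b)\<rfloor>" for i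
    have c: "real (c i) = \<omega> i (\<theta> - b)" if i: "i \<in> {1..n}" for i
    proof -
      have "\<omega> i (\<theta> - b) \<in> \<int>" using coweight_int[OF \<theta> i] coweight_int[OF b i] by (simp add: blinfun.diff_right)
      moreover have "0 \<le> \<omega> i (\<theta> - b)" using dom[OF b i] by (simp add: blinfun.diff_right)
      ultimately show ?thesis by (auto simp: c_def elim!: Ints_cases)
    qed
    have "\<theta> - b = (\<Sum>i=1..n. \<omega> i (\<theta> - b) *\<^sub>R \<alpha> i)" by (rule coweight_expansion)
    also have "\<dots> = (\<Sum>i=1..n. real (c i) *\<^sub>R \<alpha> i)" by (rule sum.cong) (simp_all add: c)
    finally show "\<exists>c::nat \<Rightarrow> nat. \<theta> - b = (\<Sum>i=1..n. real (c i) *\<^sub>R \<alpha> i)" by (rule exI[of _ c])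
  qed (rule \<theta>)
  have unique: "\<theta>' = \<theta>" if high': "is_highest_root \<Phi> \<alpha> \<theta>'" for \<theta>'
  proof (rule coweight_separates)
    fix i assume i: "i \<in> {1..n}"
    obtain c :: "nat \<Rightarrow> nat" where c: "\<theta>' - \<theta> = (\<Sum>i=1..n. real (c i) *\<^sub>R \<alpha> i)"
      using high' \<theta> unfolding is_highest_root_def n_eq by blast
    have "\<omega> i (\<theta>' - \<theta>) = (\<Sum>j=1..n. if j = i then real (c j) else 0)"
      unfolding c blinfun.sum_right by (intro sum.cong) (auto simp: blinfun.scaleR_right coweight_simple)
    then have "\<omega> i \<theta> \<le> \<omega> i \<theta>'" using i by (simp add: blinfun.diff_right)
    moreover have "\<omega> i \<theta>' \<le> \<omega> i \<theta>" using high' dom i unfolding is_highest_root_def n_eq by blast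
    ultimately show "\<omega> i \<theta>' = \<omega> i \<theta>" by simp
  qed
  have hr: "highest_root \<Phi> \<alpha> = \<theta>" unfolding highest_root_def using high unique by (rule the_equality)
  let ?B = "\<alpha> ` {1..n}"
  have lin: "linear (\<lambda>v. representation ?B v (\<alpha> i))"
    by (rule linearI) (simp_all only: representation_add[OF simple_independent in_simple_span in_simple_span]
        representation_scale[OF simple_independent in_simple_span] real_scaleR_def)
  have "representation ?B w (\<alpha> i) = \<omega> i w" if w: "w \<in> ?B" for w
  proof -
    obtain j where j: "j \<in> {1..n}" "w = \<alpha> j" using w by blast
    have "\<alpha> i = \<alpha> j \<longleftrightarrow> i = j" using simple_inj i j(1) by (auto simp: inj_on_eq_iff)
    moreover have "representation ?B (\<alpha> j) = (\<lambda>v. if v = \<alpha> j then 1 else 0)"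
      by (rule representation_basis[OF simple_independent]) (use j(1) in blast)
    ultimately show ?thesis using j by (simp add: coweight_simple)
  qed
  note on_basis = this
  have lin': "linear (blinfun_apply (\<omega> i))" by (simp add: blinfun.bounded_linear_right bounded_linear.linear)
  have "representation ?B v (\<alpha> i) = \<omega> i v" for v
    by (rule linear_eq_on_span[OF lin lin'], erule on_basis, rule in_simple_span)
  from this[of \<theta>] show ?thesis by (simp only: highest_root_coeff_def hr n_eq)
qed


section \<open>The polar root polytopes of the four zonotopal types\<close>

lemma scaled_coweight_eqI:
  assumes "x = \<omega> i" "highest_root_coeff \<Phi> \<alpha> i = m"
  shows "scaled_coweight \<Phi> \<alpha> i = x /\<^sub>R m"
  unfolding scaled_coweight_def assms ..

text \<open>The functionals \<open>x 0, \<dots>, x n\<close> are the restrictions of the coordinate functionals in the standard model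
  \<open>\<alpha> i = e\<^sub>i\<^sub>-\<^sub>1 - e\<^sub>i\<close>; simple reflections interchange neighbours, and \<open>x 0\<close> is the first fundamental
  coweight. The roots have one coordinate \<open>1\<close>, one coordinate \<open>-1\<close> and zeros, so that the polar
  consists of the sums \<open>\<Sum> c\<^sub>i x\<^sub>i\<close> in which all differences \<open>c\<^sub>i - c\<^sub>j\<close> are at most 1. As the sum of the \<open>x i\<close> is
  zero, the \<open>c\<^sub>i\<close> may be shifted so that the smallest of them is 0.\<close>

lemma polar_type_A:
  assumes C: "has_cartan_matrix \<alpha> cartan_A"
  shows "polar_root_polytope \<Phi> = ZT (weyl_orbit \<Phi> (scaled_coweight \<Phi> \<alpha> 1))"
proof -
  have "\<forall>i. \<exists>x :: 'a \<Rightarrow>\<^sub>L real. \<forall>j\<in>{1..n}. x (\<alpha> j) = of_bool (Suc i = j) - of_bool (i = j)"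
    by (intro allI functional_exists)
  then obtain x :: "nat \<Rightarrow> 'a \<Rightarrow>\<^sub>L real"
    where x: "x i (\<alpha> j) = of_bool (Suc i = j) - of_bool (i = j)" if "j \<in> {1..n}" for i j
    by metis
  define \<sigma> where "\<sigma> k i = (if i = k then k - 1 else if i = k - 1 then k else i)" for k i :: nat
  have \<sigma>_le: "\<sigma> k i \<le> n" if "k \<in> {1..n}" "i \<le> n" for k i using that by (auto simp: \<sigma>_def)
  have \<sigma>_\<sigma>: "\<sigma> k i = j \<longleftrightarrow> i = \<sigma> k j" if "k \<in> {1..n}" for k i j using that by (auto simp: \<sigma>_def)
  have refl: "dual_reflection (\<alpha> k) (x i) = x (\<sigma> k i)" if k: "k \<in> {1..n}" for k i
  proof (rule functional_eqI)
    fix j assume j: "j \<in> {1..n}"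
    obtain k' j' where "k = Suc k'" "j = Suc j'" using k j by (cases k; cases j) auto
    then show "dual_reflection (\<alpha> k) (x i) (\<alpha> j) = x (\<sigma> k i) (\<alpha> j)"
      unfolding dual_reflection_simple[OF C j k] x[OF j] x[OF k] by (auto simp: \<sigma>_def cartan_A_def)
  qed
  have refl_apply: "x i (reflection (\<alpha> k) b) = x (\<sigma> k i) b" if "k \<in> {1..n}" for k i b
    using refl[OF that] by (metis dual_reflection_apply)
  have \<omega>_sum: "\<omega> k = (\<Sum>i<k. x i)" if k: "k \<in> {1..n}" for k
  proof (rule functional_eqI)
    fix j assume j: "j \<in> {1..n}"
    have "(\<Sum>i<k. x i) (\<alpha> j) = (\<Sum>i<k. (if i = j - 1 then 1 else 0) - (if i = j then 1 else 0))"
      unfolding blinfun.sum_left using j by (intro sum.cong) (auto simp: x)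
    also have "\<dots> = of_bool (j - 1 < k) - of_bool (j < k)" by (simp add: sum_subtractf)
    also have "\<dots> = (if k = j then 1 else 0)" using j by auto
    finally show "\<omega> k (\<alpha> j) = (\<Sum>i<k. x i) (\<alpha> j)" using coweight_simple[OF j] by simp
  qed
  have form: "\<exists>i j. i \<le> n \<and> j \<le> n \<and> i \<noteq> j \<and> (\<forall>k\<le>n. x k b = of_bool (k = i) - of_bool (k = j))"
    if "b \<in> \<Phi>" for b
    using that
  proof (induction rule: root_induct)
    case (simple m)
    then show ?case by (intro exI[of _ "m - 1"] exI[of _ m]) (auto simp: x)
  next
    case (minus b)
    then obtain i j where "i \<le> n" "j \<le> n" "i \<noteq> j" "\<forall>k\<le>n. x k b = of_bool (k = i) - of_bool (k = j)" by blast
    then show ?case by (intro exI[of _ j] exI[of _ i]) (auto simp: blinfun.minus_right)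
  next
    case (reflection b m)
    then obtain i j where ij: "i \<le> n" "j \<le> n" "i \<noteq> j" "\<forall>k\<le>n. x k b = of_bool (k = i) - of_bool (k = j)" by blast
    have "\<sigma> m i \<noteq> \<sigma> m j" using ij(3) \<sigma>_\<sigma>[OF reflection(2)] by metis
    moreover have "\<forall>k\<le>n. x k (reflection (\<alpha> m) b) = of_bool (k = \<sigma> m i) - of_bool (k = \<sigma> m j)"
      using ij(4) \<sigma>_le[OF reflection(2)] by (simp add: refl_apply[OF reflection(2)] \<sigma>_\<sigma>[OF reflection(2)])
    ultimately show ?case using \<sigma>_le[OF reflection(2)] ij(1,2) by blast
  qed
  have pos_root: "\<exists>b\<in>\<Phi>. \<forall>k\<le>n. x k b = of_bool (k = i) - of_bool (k = j)" if "i < j" "j \<le> n" for i j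
    using that
  proof (induction j)
    case (Suc j)
    show ?case
    proof (cases "i = j")
      case True
      then show ?thesis using Suc.prems simple_root[of "Suc j"] by (intro bexI[of _ "\<alpha> (Suc j)"]) (auto simp: x)
    next
      case False
      then obtain b where b: "b \<in> \<Phi>" "\<forall>k\<le>n. x k b = of_bool (k = i) - of_bool (k = j)"
        using Suc by auto
      have m: "Suc j \<in> {1..n}" using Suc.prems by simp
      have "\<forall>k\<le>n. x k (reflection (\<alpha> (Suc j)) b) = of_bool (k = i) - of_bool (k = Suc j)"
        using b(2) \<sigma>_le[OF m] False Suc.prems by (simp add: refl_apply[OF m] \<sigma>_\<sigma>[OF m]) (simp add: \<sigma>_def)
      then show ?thesis using reflection_root[OF simple_root[OF m] b(1)] by blast
    qed
  qed simp
  have root: "\<exists>b\<in>\<Phi>. \<forall>k\<le>n. x k b = of_bool (k = i) - of_bool (k = j)"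
    if ne: "i \<noteq> j" and le: "i \<le> n" "j \<le> n" for i j
  proof (cases "i < j")
    case False
    then obtain b where "b \<in> \<Phi>" "\<forall>k\<le>n. x k b = of_bool (k = j) - of_bool (k = i)"
      using pos_root[OF _ le(1), of j] ne by (metis linorder_neqE_nat)
    then show ?thesis using minus_root by (intro bexI[of _ "- b"]) (auto simp: blinfun.minus_right)
  qed (use pos_root le in blast)
  have x0: "x 0 = \<omega> 1" using \<omega>_sum[of 1] n_pos by simp
  obtain \<theta> where \<theta>: "\<theta> \<in> \<Phi>" "\<forall>k\<le>n. x k \<theta> = of_bool (k = 0) - of_bool (k = n)" using root[of 0 n] n_pos by auto
  have \<omega>_form: "\<omega> k b = of_bool (i < k) - of_bool (j < k)"
    if "k \<in> {1..n}" "\<forall>k\<le>n. x k b = of_bool (k = i) - of_bool (k = j)" for i j k b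
  proof -
    have "\<omega> k b = (\<Sum>l<k. (if l = i then 1 else 0) - (if l = j then 1 else 0))"
      unfolding \<omega>_sum[OF that(1)] blinfun.sum_left using that by (intro sum.cong) auto
    then show ?thesis by (simp add: sum_subtractf)
  qed
  have "highest_root_coeff \<Phi> \<alpha> 1 = \<omega> 1 \<theta>"
  proof (rule highest_root_coeff_eq[OF \<theta>(1)])
    fix b i assume "b \<in> \<Phi>" "i \<in> {1..n}"
    then show "\<omega> i b \<le> \<omega> i \<theta>" using form[of b] \<omega>_form[of i b] \<omega>_form[of i \<theta>, OF _ \<theta>(2)] by fastforce
  qed (use n_pos in simp)
  then have m1: "highest_root_coeff \<Phi> \<alpha> 1 = 1" using \<theta>(2) n_pos unfolding x0[symmetric] by simp
  have o1: "scaled_coweight \<Phi> \<alpha> 1 = x 0" using scaled_coweight_eqI[OF x0 m1] by simp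
  have orbit: "weyl_orbit \<Phi> (x 0) = x ` {..n}"
  proof
    show "weyl_orbit \<Phi> (x 0) \<subseteq> x ` {..n}"
      by (rule weyl_orbit_subset_simple) (auto simp: refl intro!: imageI \<sigma>_le[simplified])
    have "x i \<in> weyl_orbit \<Phi> (x 0)" if "i \<le> n" for i
      using that
    proof (induction i)
      case 0
      show ?case by (rule weyl_orbit_self)
    next
      case (Suc i)
      then have "dual_reflection (\<alpha> (Suc i)) (x i) \<in> weyl_orbit \<Phi> (x 0)"
        by (intro weyl_orbit_dual_reflection simple_root) auto
      then show ?case using refl[of "Suc i" i] Suc.prems by (simp add: \<sigma>_def)
    qed
    then show "x ` {..n} \<subseteq> weyl_orbit \<Phi> (x 0)" by auto
  qed
  have inj: "inj_on x {..n}"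
  proof (rule inj_onI)
    fix i j assume ij: "i \<in> {..n}" "j \<in> {..n}" "x i = x j"
    show "i = j"
    proof (rule ccontr)
      assume "i \<noteq> j"
      then obtain b where "\<forall>k\<le>n. x k b = of_bool (k = i) - of_bool (k = j)"
        using root[OF \<open>i \<noteq> j\<close>] ij(1,2) unfolding atMost_iff by blast
      then have "x i b = 1" "x j b = - 1" using ij(1,2) \<open>i \<noteq> j\<close> by auto
      then show False using ij(3) by simp
    qed
  qed
  have comb: "(\<Sum>k\<le>n. c k *\<^sub>R x k) b = c i - c j"
    if "\<forall>k\<le>n. x k b = of_bool (k = i) - of_bool (k = j)" "i \<le> n" "j \<le> n" for c b i j
  proof -
    have "(\<Sum>k\<le>n. c k *\<^sub>R x k) b = (\<Sum>k\<le>n. (if k = i then c k else 0) - (if k = j then c k else 0))"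
      unfolding blinfun.sum_left using that by (intro sum.cong) (auto simp: blinfun.scaleR_left)
    then show ?thesis using that by (simp add: sum_subtractf)
  qed
  show ?thesis
    unfolding o1 orbit ZT_image[OF finite_atMost inj] polar_root_polytope_eq
  proof (intro subset_antisym subsetI)
    fix z assume "z \<in> {\<Sum>i\<in>{..n}. c i *\<^sub>R x i |c. \<forall>i\<in>{..n}. 0 \<le> c i \<and> c i \<le> 1}"
    then obtain c where c: "\<forall>i\<le>n. 0 \<le> c i \<and> c i \<le> 1" "z = (\<Sum>i\<le>n. c i *\<^sub>R x i)" by auto
    have "z b \<le> 1" if b: "b \<in> \<Phi>" for b
    proof -
      obtain i j where ij: "i \<le> n" "j \<le> n" "\<forall>k\<le>n. x k b = of_bool (k = i) - of_bool (k = j)"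
        using form[OF b] by blast
      have "c i \<le> 1" "0 \<le> c j" using c(1) ij by auto
      then show ?thesis unfolding c(2) comb[OF ij(3,1,2)] by simp
    qed
    then show "z \<in> {x. \<forall>a\<in>\<Phi>. blinfun_apply x a \<le> 1}" by simp
  next
    fix z :: "'a \<Rightarrow>\<^sub>L real" assume "z \<in> {x. \<forall>a\<in>\<Phi>. blinfun_apply x a \<le> 1}"
    then have z: "z b \<le> 1" if "b \<in> \<Phi>" for b using that by simp
    \<comment> \<open>The coordinates of \<open>z\<close>, which are determined only up to a common shift.\<close>
    define h where "h i = - (\<Sum>j=1..i. z (\<alpha> j))" for i
    define m where "m = Min (h ` {..n})"
    define c where "c i = h i - m" for i
    have z_eq: "z = (\<Sum>i\<le>n. c i *\<^sub>R x i)"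
    proof (rule functional_eqI)
      fix j assume j: "j \<in> {1..n}"
      then obtain j' where j': "j = Suc j'" by (cases j) auto
      have "\<forall>k\<le>n. x k (\<alpha> j) = of_bool (k = j') - of_bool (k = j)" using x[OF j] j' by auto
      from comb[OF this] have "(\<Sum>i\<le>n. c i *\<^sub>R x i) (\<alpha> j) = c j' - c j" using j j' by simp
      also have "\<dots> = z (\<alpha> j)" by (simp add: c_def h_def j')
      finally show "z (\<alpha> j) = (\<Sum>i\<le>n. c i *\<^sub>R x i) (\<alpha> j)" ..
    qed
    have "m \<in> h ` {..n}" unfolding m_def by (intro Min_in) auto
    then obtain i0 where i0: "i0 \<le> n" "m = h i0" by auto
    have "0 \<le> c i \<and> c i \<le> 1" if i: "i \<le> n" for i
    proof
      show "0 \<le> c i" unfolding c_def m_def using i by simp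
      show "c i \<le> 1"
      proof (cases "i = i0")
        case False
        then obtain b where b: "b \<in> \<Phi>" "\<forall>k\<le>n. x k b = of_bool (k = i) - of_bool (k = i0)" using root i i0 by blast
        have "c i - c i0 \<le> 1" using z[OF b(1)] comb[OF b(2) i i0(1), of c] z_eq by simp
        then show ?thesis by (simp add: c_def i0(2))
      qed (simp add: c_def i0)
    qed
    then show "z \<in> {\<Sum>i\<in>{..n}. c i *\<^sub>R x i |c. \<forall>i\<in>{..n}. 0 \<le> c i \<and> c i \<le> 1}"
      using z_eq by auto
  qed
qed

text \<open>The functionals \<open>x 1, \<dots>, x n\<close> are the coordinate functionals of the standard model
  \<open>\<alpha> i = e\<^sub>i - e\<^sub>i\<^sub>+\<^sub>1\<close>, \<open>\<alpha> n = 2 e\<^sub>n\<close>. The root polytope is the cross-polytope with the vertices \<open>\<plusminus>2 e\<^sub>i\<close>, which are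
  the roots \<open>\<plusminus>v i\<close>, and its polar is the cube generated by the functionals \<open>x i / 2\<close>, which form the orbit up to
  sign.\<close>

lemma polar_type_C:
  assumes n2: "2 \<le> n" and C: "has_cartan_matrix \<alpha> (cartan_C n)"
  shows "polar_root_polytope \<Phi> = ZT (weyl_orbit \<Phi> (scaled_coweight \<Phi> \<alpha> 1))"
proof -
  have "\<forall>i. \<exists>x :: 'a \<Rightarrow>\<^sub>L real. \<forall>j\<in>{1..n}. x (\<alpha> j) =
      (if j < n then of_bool (i = j) - of_bool (i = Suc j) else 2 * of_bool (i = n))"
    by (intro allI functional_exists)
  then obtain x :: "nat \<Rightarrow> 'a \<Rightarrow>\<^sub>L real"
    where x: "x i (\<alpha> j) = (if j < n then of_bool (i = j) - of_bool (i = Suc j) else 2 * of_bool (i = n))"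
      if "j \<in> {1..n}" for i j
    by metis
  define \<sigma> where "\<sigma> k i = (if k < n then if i = k then Suc k else if i = Suc k then k else i else i)" for k i :: nat
  define \<epsilon> where "\<epsilon> k i = (if k = n \<and> i = n then - 1 else 1 :: real)" for k i :: nat
  have \<sigma>_mem: "\<sigma> k i \<in> {1..n}" if "k \<in> {1..n}" "i \<in> {1..n}" for k i using that by (auto simp: \<sigma>_def)
  have \<sigma>_\<sigma>: "\<sigma> k i = j \<longleftrightarrow> i = \<sigma> k j" for k i j by (auto simp: \<sigma>_def)
  have refl: "dual_reflection (\<alpha> k) (x i) = \<epsilon> k i *\<^sub>R x (\<sigma> k i)" if k: "k \<in> {1..n}" for k i
  proof (rule functional_eqI)
    fix j assume j: "j \<in> {1..n}"
    show "dual_reflection (\<alpha> k) (x i) (\<alpha> j) = (\<epsilon> k i *\<^sub>R x (\<sigma> k i)) (\<alpha> j)"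
      using j k n2
      by (auto simp: dual_reflection_simple[OF C j k] x[OF j] x[OF k] \<sigma>_def \<epsilon>_def cartan_C_def cartan_A_def blinfun.scaleR_left)
  qed
  have refl_apply: "x i (reflection (\<alpha> k) b) = \<epsilon> k i * x (\<sigma> k i) b" if "k \<in> {1..n}" for k i b
    using refl[OF that, of i] by (metis dual_reflection_apply blinfun.scaleR_left real_scaleR_def)
  have \<omega>_sum: "\<omega> k = (if k < n then 1 else 1/2) *\<^sub>R (\<Sum>i=1..k. x i)" if k: "k \<in> {1..n}" for k
  proof (rule functional_eqI)
    fix j assume j: "j \<in> {1..n}"
    have "(\<Sum>i=1..k. x i) (\<alpha> j) = (\<Sum>i=1..k. (if i = j then (if j < n then 1 else 2) else 0) - (if i = Suc j then 1 else 0))"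
      unfolding blinfun.sum_left using j k by (intro sum.cong) (auto simp: x)
    also have "\<dots> = (if j \<le> k then (if j < n then 1 else 2) else 0) - of_bool (Suc j \<le> k)"
      using j by (simp add: sum_subtractf)
    finally show "\<omega> k (\<alpha> j) = ((if k < n then 1 else 1/2) *\<^sub>R (\<Sum>i=1..k. x i)) (\<alpha> j)"
      using coweight_simple[OF j, of k] j k by (auto simp: blinfun.scaleR_left)
  qed
  have separates: "u = v" if "\<And>i. i \<in> {1..n} \<Longrightarrow> x i u = x i v" for u v
    by (rule coweight_separates)
      (use that in \<open>auto simp: \<omega>_sum blinfun.sum_left blinfun.scaleR_left intro!: sum.cong\<close>)
  have form: "\<exists>i j s t. i \<in> {1..n} \<and> j \<in> {1..n} \<and> \<bar>s\<bar> = 1 \<and> \<bar>t\<bar> = 1 \<and>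
      (\<forall>k\<in>{1..n}. x k b = s * of_bool (k = i) + t * of_bool (k = j))" if "b \<in> \<Phi>" for b
    using that
  proof (induction rule: root_induct)
    case (simple m)
    show ?case
    proof (cases "m < n")
      case True
      then show ?thesis using simple
        by (intro exI[of _ m] exI[of _ "Suc m"] exI[of _ 1] exI[of _ "- 1"]) (auto simp: x)
    next
      case False
      then show ?thesis using simple
        by (intro exI[of _ m] exI[of _ m] exI[of _ 1] exI[of _ 1]) (auto simp: x)
    qed
  next
    case (minus b)
    then obtain i j s t where "i \<in> {1..n}" "j \<in> {1..n}" "\<bar>s\<bar> = 1" "\<bar>t\<bar> = 1"
      "\<forall>k\<in>{1..n}. x k b = s * of_bool (k = i) + t * of_bool (k = j)" by blast
    then show ?case
      by (intro exI[of _ i] exI[of _ j] exI[of _ "- s"] exI[of _ "- t"]) (simp add: blinfun.minus_right)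
  next
    case (reflection b m)
    then obtain i j s t where ij: "i \<in> {1..n}" "j \<in> {1..n}" "\<bar>s\<bar> = 1" "\<bar>t\<bar> = 1"
      "\<forall>k\<in>{1..n}. x k b = s * of_bool (k = i) + t * of_bool (k = j)" by blast
    have "x k (reflection (\<alpha> m) b) = \<epsilon> m (\<sigma> m i) * s * of_bool (k = \<sigma> m i) + \<epsilon> m (\<sigma> m j) * t * of_bool (k = \<sigma> m j)"
      if k: "k \<in> {1..n}" for k
      unfolding refl_apply[OF reflection(2)] bspec[OF ij(5) \<sigma>_mem[OF reflection(2) k]] \<sigma>_\<sigma>[of m k]
      by (simp add: algebra_simps)
    moreover have "\<bar>\<epsilon> m (\<sigma> m i) * s\<bar> = 1" "\<bar>\<epsilon> m (\<sigma> m j) * t\<bar> = 1"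
      using ij by (simp_all add: abs_mult \<epsilon>_def)
    ultimately show ?case using \<sigma>_mem[OF reflection(2)] ij(1,2) by blast
  qed
  have root: "\<exists>b\<in>\<Phi>. \<forall>i\<in>{1..n}. x i b = 2 * of_bool (i = k)" if "k \<in> {1..n}" for k
  proof -
    have "k \<le> n" using that by simp
    then show ?thesis using that
    proof (induction k rule: inc_induct)
      case base
      then show ?case using simple_root[of n] by (intro bexI[of _ "\<alpha> n"]) (auto simp: x)
    next
      case (step k)
      then obtain b where b: "b \<in> \<Phi>" "\<forall>i\<in>{1..n}. x i b = 2 * of_bool (i = Suc k)" by auto
      have k: "k \<in> {1..n}" "k < n" using step by auto
      have "x i (reflection (\<alpha> k) b) = 2 * of_bool (i = k)" if "i \<in> {1..n}" for i
        unfolding refl_apply[OF k(1)] bspec[OF b(2) \<sigma>_mem[OF k(1) that]] using k by (auto simp: \<sigma>_def \<epsilon>_def)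
      then show ?case using reflection_root[OF simple_root[OF k(1)] b(1)] by blast
    qed
  qed
  then obtain v where v: "v k \<in> \<Phi>" "\<forall>i\<in>{1..n}. x i (v k) = 2 * of_bool (i = k)" if "k \<in> {1..n}" for k
    by metis
  have one: "1 \<in> {1..n}" using n2 by simp
  have x1: "x 1 = \<omega> 1" using \<omega>_sum[OF one] n2 by simp
  have \<omega>_form: "\<omega> k b = (if k < n then 1 else 1/2) * (s * of_bool (i \<le> k) + t * of_bool (j \<le> k))"
    if "k \<in> {1..n}" "i \<in> {1..n}" "j \<in> {1..n}" "\<forall>k\<in>{1..n}. x k b = s * of_bool (k = i) + t * of_bool (k = j)"
    for i j s t k b
  proof -
    have "(\<Sum>l=1..k. x l) b = (\<Sum>l=1..k. (if l = i then s else 0) + (if l = j then t else 0))"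
      unfolding blinfun.sum_left using that by (intro sum.cong) auto
    also have "\<dots> = s * of_bool (i \<le> k) + t * of_bool (j \<le> k)"
      using that by (simp add: sum.distrib)
    finally show ?thesis by (simp add: \<omega>_sum[OF that(1)] blinfun.scaleR_left)
  qed
  have "highest_root_coeff \<Phi> \<alpha> 1 = \<omega> 1 (v 1)"
  proof (rule highest_root_coeff_eq[OF v(1)[OF one] _ one])
    fix b k assume b: "b \<in> \<Phi>" and k: "k \<in> {1..n}"
    obtain i j s t where ij: "i \<in> {1..n}" "j \<in> {1..n}" "\<bar>s\<bar> = 1" "\<bar>t\<bar> = 1"
      "\<forall>k\<in>{1..n}. x k b = s * of_bool (k = i) + t * of_bool (k = j)" using form[OF b] by blast
    have "\<forall>k\<in>{1..n}. x k (v 1) = 1 * of_bool (k = 1) + 1 * of_bool (k = 1)" using v(2)[OF one] by auto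
    from \<omega>_form[OF k one one this] have "\<omega> k (v 1) = (if k < n then 1 else 1/2) * 2" using k by simp
    moreover have "s * of_bool (i \<le> k) + t * of_bool (j \<le> k) \<le> 2" using ij(3,4) by (auto simp: of_bool_def)
    ultimately show "\<omega> k b \<le> \<omega> k (v 1)" unfolding \<omega>_form[OF k ij(1,2,5)] by auto
  qed
  then have m1: "highest_root_coeff \<Phi> \<alpha> 1 = 2" using bspec[OF v(2)[OF one] one] unfolding x1[symmetric] by simp
  define f where "f i = (1/2) *\<^sub>R x i" for i
  have o1: "scaled_coweight \<Phi> \<alpha> 1 = f 1" using scaled_coweight_eqI[OF x1 m1] by (simp add: f_def)
  have dual_f: "dual_reflection (\<alpha> k) (f i) = \<epsilon> k i *\<^sub>R f (\<sigma> k i)"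
    "dual_reflection (\<alpha> k) (- f i) = - \<epsilon> k i *\<^sub>R f (\<sigma> k i)" if k: "k \<in> {1..n}" for k i
    by (rule blinfun_eqI, simp add: dual_reflection_apply f_def blinfun.scaleR_left blinfun.minus_left refl_apply[OF k])+
  have orbit: "weyl_orbit \<Phi> (f 1) = f ` {1..n} \<union> (\<lambda>i. - f i) ` {1..n}"
  proof
    show "weyl_orbit \<Phi> (f 1) \<subseteq> f ` {1..n} \<union> (\<lambda>i. - f i) ` {1..n}"
    proof (rule weyl_orbit_subset_simple)
      show "f 1 \<in> f ` {1..n} \<union> (\<lambda>i. - f i) ` {1..n}" using one by blast
      fix k y assume k: "k \<in> {1..n}" and "y \<in> f ` {1..n} \<union> (\<lambda>i. - f i) ` {1..n}"
      then obtain i where i: "i \<in> {1..n}" "y = f i \<or> y = - f i" by blast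
      have "\<epsilon> k i = 1 \<or> \<epsilon> k i = - 1" by (simp add: \<epsilon>_def)
      then have "dual_reflection (\<alpha> k) y = f (\<sigma> k i) \<or> dual_reflection (\<alpha> k) y = - f (\<sigma> k i)"
        using i(2) dual_f[OF k, of i] by auto
      then show "dual_reflection (\<alpha> k) y \<in> f ` {1..n} \<union> (\<lambda>i. - f i) ` {1..n}"
        using \<sigma>_mem[OF k i(1)] by blast
    qed
    have pos: "f i \<in> weyl_orbit \<Phi> (f 1)" if "i \<in> {1..n}" for i
    proof -
      have "1 \<le> i" using that by simp
      then show ?thesis using that
      proof (induction i rule: dec_induct)
        case base
        show ?case by (rule weyl_orbit_self)
      next
        case (step i)
        then have "dual_reflection (\<alpha> i) (f i) \<in> weyl_orbit \<Phi> (f 1)"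
          by (intro weyl_orbit_dual_reflection simple_root) auto
        then show ?case using dual_f(1)[of i i] step by (simp add: \<sigma>_def \<epsilon>_def)
      qed
    qed
    have neg: "- f i \<in> weyl_orbit \<Phi> (f 1)" if "i \<in> {1..n}" for i
    proof -
      have "i \<le> n" using that by simp
      then show ?thesis using that
      proof (induction i rule: inc_induct)
        case base
        then have "dual_reflection (\<alpha> n) (f n) \<in> weyl_orbit \<Phi> (f 1)"
          by (intro weyl_orbit_dual_reflection simple_root pos) auto
        then show ?case using dual_f(1)[of n n] base by (simp add: \<sigma>_def \<epsilon>_def)
      next
        case (step i)
        then have "dual_reflection (\<alpha> i) (- f (Suc i)) \<in> weyl_orbit \<Phi> (f 1)"
          by (intro weyl_orbit_dual_reflection simple_root) auto
        then show ?case using dual_f(2)[of i "Suc i"] step by (simp add: \<sigma>_def \<epsilon>_def)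
      qed
    qed
    show "f ` {1..n} \<union> (\<lambda>i. - f i) ` {1..n} \<subseteq> weyl_orbit \<Phi> (f 1)" using pos neg by blast
  qed
  have fv: "f i (v k) = of_bool (i = k)" if "i \<in> {1..n}" "k \<in> {1..n}" for i k
    using v(2)[OF that(2)] that(1) by (auto simp: f_def blinfun.scaleR_left)
  have inj: "inj_on f {1..n}"
  proof (rule inj_onI)
    fix i j assume ij: "i \<in> {1..n}" "j \<in> {1..n}" "f i = f j"
    then have "f j (v i) = 1" using fv[of i i] by simp
    then show "i = j" using fv[of j i] ij by (cases "i = j") auto
  qed
  have ne: "f i \<noteq> - f j" if "i \<in> {1..n}" "j \<in> {1..n}" for i j
  proof
    assume eq: "f i = - f j"
    have "f i (v i) = 1" "f j (v i) \<ge> 0" using fv that by simp_all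
    then show False unfolding eq by (simp add: blinfun.minus_left)
  qed
  have simple_v: "\<alpha> j = (if j < n then (1/2) *\<^sub>R (v j - v (Suc j)) else v n)" if j: "j \<in> {1..n}" for j
  proof (rule separates)
    fix i assume i: "i \<in> {1..n}"
    have "x i (v k) = 2 * of_bool (i = k)" if "k \<in> {1..n}" for k using v(2)[OF that] i by blast
    then show "x i (\<alpha> j) = x i (if j < n then (1/2) *\<^sub>R (v j - v (Suc j)) else v n)"
      using i j by (auto simp: x[OF j] blinfun.diff_right blinfun.scaleR_right)
  qed
  have v_eqI: "y = z" if eq: "\<And>k. k \<in> {1..n} \<Longrightarrow> y (v k) = z (v k)" for y z :: "'a \<Rightarrow>\<^sub>L real"
  proof (rule functional_eqI)
    fix j assume j: "j \<in> {1..n}"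
    then show "y (\<alpha> j) = z (\<alpha> j)"
      by (auto simp: simple_v[OF j] blinfun.diff_right blinfun.scaleR_right eq)
  qed
  have ZT_eq: "ZT (f ` {1..n} \<union> (\<lambda>i. - f i) ` {1..n}) =
      {\<Sum>i=1..n. c i *\<^sub>R f i |c. \<forall>i\<in>{1..n}. -1 \<le> c i \<and> c i \<le> 1}"
    by (rule ZT_image_symmetric[OF finite_atLeastAtMost inj]) (rule ne)
  show ?thesis
    unfolding o1 orbit ZT_eq polar_root_polytope_eq
  proof (intro subset_antisym subsetI)
    fix z assume "z \<in> {\<Sum>i=1..n. c i *\<^sub>R f i |c. \<forall>i\<in>{1..n}. -1 \<le> c i \<and> c i \<le> 1}"
    then obtain c where c: "\<forall>i\<in>{1..n}. -1 \<le> c i \<and> c i \<le> 1" "z = (\<Sum>i=1..n. c i *\<^sub>R f i)" by blast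
    have "z b \<le> 1" if b: "b \<in> \<Phi>" for b
    proof -
      obtain i j s t where ij: "i \<in> {1..n}" "j \<in> {1..n}" "\<bar>s\<bar> = 1" "\<bar>t\<bar> = 1"
        "\<forall>k\<in>{1..n}. x k b = s * of_bool (k = i) + t * of_bool (k = j)" using form[OF b] by blast
      have "z b = (\<Sum>k=1..n. (if k = i then c k * s / 2 else 0) + (if k = j then c k * t / 2 else 0))"
        unfolding c(2) blinfun.sum_left using ij(5)
        by (intro sum.cong) (auto simp: blinfun.scaleR_left f_def field_simps)
      also have "\<dots> = c i * s / 2 + c j * t / 2" using ij(1,2) by (simp add: sum.distrib)
      finally have "z b = c i * s / 2 + c j * t / 2" .
      moreover have "c i * s \<le> 1" "c j * t \<le> 1" using c(1) ij by (auto simp: abs_if split: if_splits)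
      ultimately show ?thesis by simp
    qed
    then show "z \<in> {x. \<forall>a\<in>\<Phi>. blinfun_apply x a \<le> 1}" by simp
  next
    fix z :: "'a \<Rightarrow>\<^sub>L real" assume "z \<in> {x. \<forall>a\<in>\<Phi>. blinfun_apply x a \<le> 1}"
    then have z: "z b \<le> 1" if "b \<in> \<Phi>" for b using that by simp
    have z_eq: "z = (\<Sum>i=1..n. z (v i) *\<^sub>R f i)"
    proof (rule v_eqI)
      fix k assume k: "k \<in> {1..n}"
      have "(\<Sum>i=1..n. z (v i) *\<^sub>R f i) (v k) = (\<Sum>i=1..n. if i = k then z (v i) else 0)"
        unfolding blinfun.sum_left using k by (intro sum.cong) (auto simp: blinfun.scaleR_left fv)
      then show "z (v k) = (\<Sum>i=1..n. z (v i) *\<^sub>R f i) (v k)" using k by simp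
    qed
    have z_bound: "- 1 \<le> z (v i) \<and> z (v i) \<le> 1" if "i \<in> {1..n}" for i
      using z[OF v(1)[OF that]] z[OF minus_root[OF v(1)[OF that]]] by (simp add: blinfun.minus_right)
    show "z \<in> {\<Sum>i=1..n. c i *\<^sub>R f i |c. \<forall>i\<in>{1..n}. -1 \<le> c i \<and> c i \<le> 1}"
      by (rule CollectI, rule exI[of _ "\<lambda>i. z (v i)"], rule conjI, rule z_eq, rule ballI, rule z_bound)
  qed
qed

end

text \<open>Helly's theorem for intervals on the line: the four intervals of length 2 with the centres
  \<open>- a\<close>, \<open>b\<close>, \<open>c\<close>, \<open>d\<close> meet pairwise, so they have a common point.\<close>

lemma symmetric_interval_Helly:
  fixes a b c d :: real
  assumes "\<bar>a + b\<bar> \<le> 2" "\<bar>a + c\<bar> \<le> 2" "\<bar>a + d\<bar> \<le> 2" "\<bar>b - c\<bar> \<le> 2" "\<bar>b - d\<bar> \<le> 2" "\<bar>c - d\<bar> \<le> 2"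
  shows "\<exists>r. \<bar>a + r\<bar> \<le> 1 \<and> \<bar>b - r\<bar> \<le> 1 \<and> \<bar>c - r\<bar> \<le> 1 \<and> \<bar>d - r\<bar> \<le> 1"
proof -
  \<comment> \<open>the largest of the left end points\<close>
  define r where "r = max (- 1 - a) (max (b - 1) (max (c - 1) (d - 1)))"
  have "\<bar>a + r\<bar> \<le> 1 \<and> \<bar>b - r\<bar> \<le> 1 \<and> \<bar>c - r\<bar> \<le> 1 \<and> \<bar>d - r\<bar> \<le> 1"
    using assms unfolding r_def by (auto simp: abs_le_iff max_def)
  then show ?thesis ..
qed

context based_root_system
begin

text \<open>In the standard model \<open>\<alpha> 1 = e\<^sub>1 - e\<^sub>2\<close>, \<open>\<alpha> 2 = e\<^sub>2 - e\<^sub>3\<close>, \<open>\<alpha> 3 = e\<^sub>3\<close> the orbit consists of the eight functionals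
  \<open>(\<plusminus>x\<^sub>1 \<plusminus> x\<^sub>2 \<plusminus> x\<^sub>3) / 4\<close>, and the polar is the rhombic dodecahedron \<open>\<bar>p\<^sub>i \<plusminus> p\<^sub>j\<bar> \<le> 1\<close>. The four diagonals \<open>g 0, \<dots>, g 3\<close>
  satisfy the relation \<open>g 1 + g 2 + g 3 = g 0\<close>, so a point \<open>p\<close> has a one-parameter family of coefficients;
  the conditions that they lie in \<open>[-1, 1]\<close> are four intervals for the parameter, which meet pairwise by the
  inequalities of the dodecahedron.\<close>

lemma polar_type_B3:
  assumes n3: "n = 3" and C: "has_cartan_matrix \<alpha> (cartan_B 3)"
  shows "polar_root_polytope \<Phi> = ZT (weyl_orbit \<Phi> (scaled_coweight \<Phi> \<alpha> 3 /\<^sub>R 2))"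
proof -
  \<comment> \<open>The rewrite rules below concern the index \<open>1\<close>, not \<open>Suc 0\<close>.\<close>
  note One_nat_def [simp del]
  have idx: "{1..n} = {1, 2, 3}" using n3 by auto
  have mem: "1 \<in> {1..n}" "2 \<in> {1..n}" "3 \<in> {1..n}" using n3 by auto
  have "\<forall>i. \<exists>x :: 'a \<Rightarrow>\<^sub>L real. \<forall>j\<in>{1..n}. x (\<alpha> j) = (if i = j then 1 else if i = Suc j then - 1 else 0)"
    by (intro allI functional_exists)
  then obtain x :: "nat \<Rightarrow> 'a \<Rightarrow>\<^sub>L real"
    where x: "x i (\<alpha> j) = (if i = j then 1 else if i = Suc j then - 1 else 0)" if "j \<in> {1..n}" for i j
    by metis
  have eqI: "y = z" if "y (\<alpha> 1) = z (\<alpha> 1)" "y (\<alpha> 2) = z (\<alpha> 2)" "y (\<alpha> 3) = z (\<alpha> 3)" for y z :: "'a \<Rightarrow>\<^sub>L real"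
    by (rule functional_eqI, unfold idx) (use that in auto)
  note refl_simple = dual_reflection_simple[OF C]
  have refl1: "dual_reflection (\<alpha> 1) (x 1) = x 2" "dual_reflection (\<alpha> 1) (x 2) = x 1" "dual_reflection (\<alpha> 1) (x 3) = x 3"
    and refl2: "dual_reflection (\<alpha> 2) (x 1) = x 1" "dual_reflection (\<alpha> 2) (x 2) = x 3" "dual_reflection (\<alpha> 2) (x 3) = x 2"
    and refl3: "dual_reflection (\<alpha> 3) (x 1) = x 1" "dual_reflection (\<alpha> 3) (x 2) = x 2" "dual_reflection (\<alpha> 3) (x 3) = - x 3"
    by (rule eqI; simp only: refl_simple mem x blinfun.minus_left; simp add: cartan_B_def cartan_A_def)+
  have apply1: "x 1 (reflection (\<alpha> 1) b) = x 2 b" "x 2 (reflection (\<alpha> 1) b) = x 1 b" "x 3 (reflection (\<alpha> 1) b) = x 3 b"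
    and apply2: "x 1 (reflection (\<alpha> 2) b) = x 1 b" "x 2 (reflection (\<alpha> 2) b) = x 3 b" "x 3 (reflection (\<alpha> 2) b) = x 2 b"
    and apply3: "x 1 (reflection (\<alpha> 3) b) = x 1 b" "x 2 (reflection (\<alpha> 3) b) = x 2 b" "x 3 (reflection (\<alpha> 3) b) = - x 3 b" for b
    using refl1 refl2 refl3 by (metis dual_reflection_apply blinfun.minus_left)+
  have \<omega>: "\<omega> 1 = x 1" "\<omega> 2 = x 1 + x 2" "\<omega> 3 = x 1 + x 2 + x 3"
    by (rule eqI; simp only: coweight_simple mem x blinfun.add_left; simp)+
  define R where "R b \<longleftrightarrow> x 1 b \<in> {-1, 0, 1} \<and> x 2 b \<in> {-1, 0, 1} \<and> x 3 b \<in> {-1, 0, 1} \<and>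
      \<bar>x 1 b\<bar> + \<bar>x 2 b\<bar> + \<bar>x 3 b\<bar> \<le> 2" for b
  have form: "R b" if "b \<in> \<Phi>" for b
    using that
  proof (induction rule: root_induct)
    case (simple i)
    then show ?case unfolding idx R_def using x[OF mem(1)] x[OF mem(2)] x[OF mem(3)] by auto
  next
    case (minus b)
    then show ?case by (auto simp: R_def blinfun.minus_right)
  next
    case (reflection b i)
    then consider "i = 1" | "i = 2" | "i = 3" unfolding idx by blast
    then show ?case
    proof cases
      case 1
      then show ?thesis using reflection(3) unfolding R_def 1 apply1 by (simp add: add.commute)
    next
      case 2
      then show ?thesis using reflection(3) unfolding R_def 2 apply2 by (simp add: add_ac)
    next
      case 3
      have "- x 3 b \<in> {-1, 0, 1}" using reflection(3) unfolding R_def by force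
      then show ?thesis using reflection(3) unfolding R_def 3 apply3 abs_minus_cancel by blast
    qed
  qed
  define root where "root a b c \<longleftrightarrow> (\<exists>v\<in>\<Phi>. x 1 v = a \<and> x 2 v = b \<and> x 3 v = c)" for a b c
  have root_refl: "root a b c \<Longrightarrow> root b a c" "root a b c \<Longrightarrow> root a c b" "root a b c \<Longrightarrow> root a b (- c)" for a b c
    unfolding root_def
    using reflection_root[OF simple_root[OF mem(1)]] reflection_root[OF simple_root[OF mem(2)]]
      reflection_root[OF simple_root[OF mem(3)]] apply1 apply2 apply3 by metis+
  have r1: "root 1 (- 1) 0" unfolding root_def
    by (rule bexI[of _ "\<alpha> 1"]) (simp only: x[OF mem(1)], simp, rule simple_root[OF mem(1)])
  have r2: "root 1 0 (- 1)" using root_refl(2)[OF r1] by simp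
  have r3: "root 1 0 1" using root_refl(3)[OF r2] by simp
  have r4: "root 1 1 0" using root_refl(2)[OF r3] by simp
  have r5: "root 0 1 1" using root_refl(1)[OF r3] by simp
  have r6: "root 0 1 (- 1)" using root_refl(3)[OF r5] by simp
  obtain \<theta> where \<theta>: "\<theta> \<in> \<Phi>" "x 1 \<theta> = 1" "x 2 \<theta> = 1" "x 3 \<theta> = 0" using r4 unfolding root_def by blast
  have "highest_root_coeff \<Phi> \<alpha> 3 = \<omega> 3 \<theta>"
  proof (rule highest_root_coeff_eq[OF \<theta>(1) _ mem(3)])
    fix b i assume b: "b \<in> \<Phi>" and "i \<in> {1..n}"
    then consider "i = 1" | "i = 2" | "i = 3" unfolding idx by blast
    moreover have "x 1 b \<le> 1" "\<bar>x 1 b\<bar> + \<bar>x 2 b\<bar> + \<bar>x 3 b\<bar> \<le> 2" using form[OF b] unfolding R_def by auto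
    then have "\<omega> 1 b \<le> \<omega> 1 \<theta>" "\<omega> 2 b \<le> \<omega> 2 \<theta>" "\<omega> 3 b \<le> \<omega> 3 \<theta>"
      unfolding \<omega> blinfun.add_left \<theta>(2-4) by linarith+
    ultimately show "\<omega> i b \<le> \<omega> i \<theta>" by cases simp_all
  qed
  then have m3: "highest_root_coeff \<Phi> \<alpha> 3 = 2" unfolding \<omega> blinfun.add_left \<theta>(2-4) by simp
  define f where "f a b c = (1/4) *\<^sub>R (a *\<^sub>R x 1 + b *\<^sub>R x 2 + c *\<^sub>R x 3)" for a b c :: real
  have f_apply: "f a b c v = (a * x 1 v + b * x 2 v + c * x 3 v) / 4" for a b c v
    by (simp add: f_def blinfun.add_left blinfun.scaleR_left)
  have o3: "scaled_coweight \<Phi> \<alpha> 3 /\<^sub>R 2 = f 1 1 1"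
    unfolding scaled_coweight_def m3 \<omega> by (simp add: f_def)
  have f_refl: "dual_reflection (\<alpha> 1) (f a b c) = f b a c" "dual_reflection (\<alpha> 2) (f a b c) = f a c b"
    "dual_reflection (\<alpha> 3) (f a b c) = f a b (- c)" for a b c
    by (rule blinfun_eqI, simp add: dual_reflection_apply f_apply apply1 apply2 apply3)+
  define g where "g i = (if i = 0 then f 1 1 1 else if i = 1 then f 1 1 (-1) else if i = 2 then f 1 (-1) 1 else f (-1) 1 1)"
    for i :: nat
  have f_minus: "- f a b c = f (- a) (- b) (- c)" for a b c
    by (rule blinfun_eqI) (simp add: f_apply blinfun.minus_left field_simps)
  have I4: "{..<4} = {0, 1, 2, 3::nat}" by auto
  define S where "S = {f a b c | a b c. a \<in> {1, -1} \<and> b \<in> {1, -1} \<and> c \<in> {1, -1}}"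
  have S_eq: "S = g ` {..<4} \<union> (\<lambda>i. - g i) ` {..<4}"
  proof -
    have "S = {f 1 1 1, f 1 1 (-1), f 1 (-1) 1, f (-1) 1 1, f (-1) (-1) (-1), f (-1) (-1) 1, f (-1) 1 (-1), f 1 (-1) (-1)}"
      unfolding S_def by blast
    also have "\<dots> = g ` {..<4} \<union> (\<lambda>i. - g i) ` {..<4}"
      unfolding I4 by (simp add: g_def f_minus insert_commute)
    finally show ?thesis .
  qed
  have orbit: "weyl_orbit \<Phi> (f 1 1 1) = S"
  proof
    show "weyl_orbit \<Phi> (f 1 1 1) \<subseteq> S"
    proof (rule weyl_orbit_subset_simple)
      show "f 1 1 1 \<in> S" unfolding S_def by blast
      fix i y assume i: "i \<in> {1..n}" and "y \<in> S"
      then obtain a b c where y: "y = f a b c" "a \<in> {1, -1}" "b \<in> {1, -1}" "c \<in> {1, -1}" unfolding S_def by blast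
      then have "- c \<in> {1, -1}" by auto
      then have "f b a c \<in> S" "f a c b \<in> S" "f a b (- c) \<in> S" unfolding S_def using y(2-4) by blast+
      then show "dual_reflection (\<alpha> i) y \<in> S" using i unfolding idx y(1) by (auto simp: f_refl)
    qed
    have step: "dual_reflection (\<alpha> i) y \<in> weyl_orbit \<Phi> (f 1 1 1)"
      if "i \<in> {1..n}" "y \<in> weyl_orbit \<Phi> (f 1 1 1)" for i y
      using weyl_orbit_dual_reflection[OF that(2) simple_root[OF that(1)]] .
    have swap12: "f b a c \<in> weyl_orbit \<Phi> (f 1 1 1)" and swap23: "f a c b \<in> weyl_orbit \<Phi> (f 1 1 1)"
      and neg: "f a b (- c) \<in> weyl_orbit \<Phi> (f 1 1 1)" if "f a b c \<in> weyl_orbit \<Phi> (f 1 1 1)" for a b c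
      using step[OF mem(1) that] step[OF mem(2) that] step[OF mem(3) that] by (simp_all add: f_refl)
    have f1: "f 1 1 1 \<in> weyl_orbit \<Phi> (f 1 1 1)" by (rule weyl_orbit_self)
    note f2 = neg[OF f1] note f3 = swap23[OF f2] note f4 = swap12[OF f3]
    note f5 = neg[OF f3] note f6 = neg[OF f4] note f7 = swap23[OF f6] note f8 = neg[OF f7]
    show "S \<subseteq> weyl_orbit \<Phi> (f 1 1 1)"
      unfolding S_def using f1 f2 f3 f4 f5 f6 f7 f8 by auto
  qed
  have fa: "f a b c (\<alpha> 1) = (a - b) / 4" "f a b c (\<alpha> 2) = (b - c) / 4" "f a b c (\<alpha> 3) = c / 4" for a b c
    unfolding f_apply x[OF mem(1)] x[OF mem(2)] x[OF mem(3)] by simp_all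
  have f_inj: "f a b c = f a' b' c' \<longleftrightarrow> a = a' \<and> b = b' \<and> c = c'" for a b c a' b' c'
  proof
    assume eq: "f a b c = f a' b' c'"
    show "a = a' \<and> b = b' \<and> c = c'"
      using fa[of a b c] fa[of a' b' c'] unfolding eq by auto
  qed simp
  have inj: "inj_on g {..<4}" unfolding I4 by (auto simp: inj_on_def g_def f_inj)
  have ne: "g i \<noteq> - g j" if "i \<in> {..<4}" "j \<in> {..<4}" for i j
    using that unfolding I4 by (auto simp: g_def f_inj f_minus)
  have sum_g: "(\<Sum>i<4. c i *\<^sub>R g i) v = c 0 * f 1 1 1 v + c 1 * f 1 1 (-1) v + c 2 * f 1 (-1) 1 v + c 3 * f (-1) 1 1 v"
    for c :: "nat \<Rightarrow> real" and v
    unfolding I4 by (simp add: g_def blinfun.add_left blinfun.scaleR_left)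
  have ZT_eq: "ZT S = {\<Sum>i<4. c i *\<^sub>R g i |c. \<forall>i\<in>{..<4}. -1 \<le> c i \<and> c i \<le> 1}"
    unfolding S_eq by (rule ZT_image_symmetric[OF finite_lessThan inj]) (rule ne)
  show ?thesis
    unfolding o3 orbit ZT_eq polar_root_polytope_eq
  proof (intro subset_antisym subsetI)
    fix z assume "z \<in> {\<Sum>i<4. c i *\<^sub>R g i |c. \<forall>i\<in>{..<4}. -1 \<le> c i \<and> c i \<le> 1}"
    then obtain c where c: "\<forall>i\<in>{..<4}. -1 \<le> c i \<and> c i \<le> 1" "z = (\<Sum>i<4. c i *\<^sub>R g i)" by blast
    have c4: "-1 \<le> c 0" "c 0 \<le> 1" "-1 \<le> c 1" "c 1 \<le> 1" "-1 \<le> c 2" "c 2 \<le> 1" "-1 \<le> c 3" "c 3 \<le> 1"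
      using c(1) unfolding I4 by auto
    have "z b \<le> 1" if b: "b \<in> \<Phi>" for b
      using form[OF b] c4 unfolding R_def c(2) sum_g f_apply by auto
    then show "z \<in> {x. \<forall>a\<in>\<Phi>. blinfun_apply x a \<le> 1}" by simp
  next
    fix z :: "'a \<Rightarrow>\<^sub>L real" assume "z \<in> {x. \<forall>a\<in>\<Phi>. blinfun_apply x a \<le> 1}"
    then have z: "z b \<le> 1" if "b \<in> \<Phi>" for b using that by simp
    define p3 where "p3 = z (\<alpha> 3)"
    define p2 where "p2 = z (\<alpha> 2) + p3"
    define p1 where "p1 = z (\<alpha> 1) + p2"
    have z_eq: "z = p1 *\<^sub>R x 1 + p2 *\<^sub>R x 2 + p3 *\<^sub>R x 3"
      by (rule eqI; simp only: x mem blinfun.add_left blinfun.scaleR_left; simp add: p1_def p2_def p3_def)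
    have bound: "\<bar>p1 * a + p2 * b + p3 * c\<bar> \<le> 1" if r: "root a b c" for a b c
    proof -
      obtain v where v: "v \<in> \<Phi>" "x 1 v = a" "x 2 v = b" "x 3 v = c" using r unfolding root_def by blast
      have "z v = p1 * a + p2 * b + p3 * c" unfolding z_eq by (simp add: blinfun.add_left blinfun.scaleR_left v)
      then show ?thesis using z[OF v(1)] z[OF minus_root[OF v(1)]] by (simp add: blinfun.minus_right)
    qed
    note bounds = bound[OF r1] bound[OF r2] bound[OF r3] bound[OF r4] bound[OF r5] bound[OF r6]
    obtain r where r: "\<bar>(p1 + p2 + p3) + r\<bar> \<le> 1" "\<bar>(p1 + p2 - p3) - r\<bar> \<le> 1"
      "\<bar>(p1 - p2 + p3) - r\<bar> \<le> 1" "\<bar>(- p1 + p2 + p3) - r\<bar> \<le> 1"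
      using symmetric_interval_Helly[of "p1 + p2 + p3" "p1 + p2 - p3" "p1 - p2 + p3" "- p1 + p2 + p3"] bounds
      by (auto simp: abs_le_iff)
    \<comment> \<open>For \<open>r = 0\<close> these are the products of \<open>p\<close> with the four diagonals, which form a tight frame.\<close>
    define c where "c i = (if i = 0 then (p1 + p2 + p3) + r else if i = 1 then (p1 + p2 - p3) - r
      else if i = 2 then (p1 - p2 + p3) - r else (- p1 + p2 + p3) - r)" for i :: nat
    have "z = (\<Sum>i<4. c i *\<^sub>R g i)"
      by (rule blinfun_eqI) (simp add: sum_g c_def f_apply z_eq blinfun.add_left blinfun.scaleR_left field_simps)
    moreover have "\<forall>i\<in>{..<4}. -1 \<le> c i \<and> c i \<le> 1" unfolding I4 c_def using r by (simp add: abs_le_iff)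
    ultimately show "z \<in> {\<Sum>i<4. c i *\<^sub>R g i |c. \<forall>i\<in>{..<4}. -1 \<le> c i \<and> c i \<le> 1}" by blast
  qed
qed

text \<open>In the basis of the fundamental coweights the orbit is \<open>\<plusminus>(1, 0) / 6\<close>, \<open>\<plusminus>(1, -3) / 6\<close>, \<open>\<plusminus>(2, -3) / 6\<close>,
  and the long roots, which have the coefficients \<open>(0, 1)\<close>, \<open>(3, 1)\<close>, \<open>(3, 2)\<close> up to sign, give the inequalities of the hexagon. The generators \<open>g 0\<close>, \<open>g 1\<close>,
  \<open>g 2\<close> sum to zero, so a point has a one-parameter family of coefficients, and three intervals for the
  parameter have to meet.\<close>

lemma polar_type_G2:
  assumes n2: "n = 2" and C: "has_cartan_matrix \<alpha> cartan_G2"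
  shows "polar_root_polytope \<Phi> = ZT (weyl_orbit \<Phi> (scaled_coweight \<Phi> \<alpha> 1 /\<^sub>R 2))"
proof -
  \<comment> \<open>The rewrite rules below concern the index \<open>1\<close>, not \<open>Suc 0\<close>.\<close>
  note One_nat_def [simp del]
  have idx: "{1..n} = {1, 2}" using n2 by auto
  have mem: "1 \<in> {1..n}" "2 \<in> {1..n}" using n2 by auto
  have \<omega>\<alpha>: "\<omega> 1 (\<alpha> 1) = 1" "\<omega> 1 (\<alpha> 2) = 0" "\<omega> 2 (\<alpha> 1) = 0" "\<omega> 2 (\<alpha> 2) = 1"
    unfolding coweight_simple[OF mem(1)] coweight_simple[OF mem(2)] by simp_all
  have eqI: "y = z" if "y (\<alpha> 1) = z (\<alpha> 1)" "y (\<alpha> 2) = z (\<alpha> 2)" for y z :: "'a \<Rightarrow>\<^sub>L real"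
    by (rule functional_eqI, unfold idx) (use that in auto)
  have refl_simple: "dual_reflection (\<alpha> 1) y (\<alpha> 1) = - y (\<alpha> 1)" "dual_reflection (\<alpha> 1) y (\<alpha> 2) = y (\<alpha> 2) + 3 * y (\<alpha> 1)"
    "dual_reflection (\<alpha> 2) y (\<alpha> 1) = y (\<alpha> 1) + y (\<alpha> 2)" "dual_reflection (\<alpha> 2) y (\<alpha> 2) = - y (\<alpha> 2)" for y
    unfolding dual_reflection_simple[OF C mem(1) mem(1)] dual_reflection_simple[OF C mem(1) mem(2)]
      dual_reflection_simple[OF C mem(2) mem(1)] dual_reflection_simple[OF C mem(2) mem(2)]
    by (simp_all add: cartan_G2_def cartan_A_def)
  have \<omega>_refl: "dual_reflection (\<alpha> 1) (\<omega> 1) = 3 *\<^sub>R \<omega> 2 - \<omega> 1" "dual_reflection (\<alpha> 1) (\<omega> 2) = \<omega> 2"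
    "dual_reflection (\<alpha> 2) (\<omega> 1) = \<omega> 1" "dual_reflection (\<alpha> 2) (\<omega> 2) = \<omega> 1 - \<omega> 2"
    by (rule eqI; simp only: refl_simple \<omega>\<alpha> blinfun.diff_left blinfun.scaleR_left; simp)+
  have apply1: "\<omega> 1 (reflection (\<alpha> 1) b) = 3 * \<omega> 2 b - \<omega> 1 b" "\<omega> 2 (reflection (\<alpha> 1) b) = \<omega> 2 b"
    and apply2: "\<omega> 1 (reflection (\<alpha> 2) b) = \<omega> 1 b" "\<omega> 2 (reflection (\<alpha> 2) b) = \<omega> 1 b - \<omega> 2 b" for b
    using arg_cong[OF \<omega>_refl(1), of "\<lambda>y. blinfun_apply y b"] arg_cong[OF \<omega>_refl(2), of "\<lambda>y. blinfun_apply y b"]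
      arg_cong[OF \<omega>_refl(3), of "\<lambda>y. blinfun_apply y b"] arg_cong[OF \<omega>_refl(4), of "\<lambda>y. blinfun_apply y b"]
    by (simp_all add: dual_reflection_apply blinfun.diff_left blinfun.scaleR_left)
  define R :: "(real \<times> real) set" where "R = {(1, 0), (0, 1), (1, 1), (2, 1), (3, 1), (3, 2),
    (-1, 0), (0, -1), (-1, -1), (-2, -1), (-3, -1), (-3, -2)}"
  have form: "(\<omega> 1 b, \<omega> 2 b) \<in> R" if "b \<in> \<Phi>" for b
    using that
  proof (induction rule: root_induct)
    case (simple i)
    then show ?case unfolding idx R_def using \<omega>\<alpha> by auto
  next
    case (minus b)
    then show ?case unfolding R_def blinfun.minus_right by (elim insertE emptyE) simp_all
  next
    case (reflection b i)
    then consider "i = 1" | "i = 2" unfolding idx by blast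
    then show ?case
    proof cases
      case 1
      show ?thesis using reflection(3) unfolding R_def 1 apply1 by (elim insertE emptyE) simp_all
    next
      case 2
      show ?thesis using reflection(3) unfolding R_def 2 apply2 by (elim insertE emptyE) simp_all
    qed
  qed
  define root where "root a b \<longleftrightarrow> (\<exists>v\<in>\<Phi>. \<omega> 1 v = a \<and> \<omega> 2 v = b)" for a b
  have root_refl: "root a b \<Longrightarrow> root (3 * b - a) b" "root a b \<Longrightarrow> root a (a - b)" for a b
    unfolding root_def
    using reflection_root[OF simple_root[OF mem(1)]] reflection_root[OF simple_root[OF mem(2)]] apply1 apply2 by metis+
  have r1: "root 0 1" unfolding root_def using \<omega>\<alpha> simple_root[OF mem(2)] by blast
  have r2: "root 3 1" using root_refl(1)[OF r1] by simp
  have r3: "root 3 2" using root_refl(2)[OF r2] by simp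
  obtain \<theta> where \<theta>: "\<theta> \<in> \<Phi>" "\<omega> 1 \<theta> = 3" "\<omega> 2 \<theta> = 2" using r3 unfolding root_def by blast
  have "highest_root_coeff \<Phi> \<alpha> 1 = \<omega> 1 \<theta>"
  proof (rule highest_root_coeff_eq[OF \<theta>(1) _ mem(1)])
    fix b i assume b: "b \<in> \<Phi>" and "i \<in> {1..n}"
    then consider "i = 1" | "i = 2" unfolding idx by blast
    then show "\<omega> i b \<le> \<omega> i \<theta>"
      using form[OF b] \<theta>(2,3) unfolding R_def by cases auto
  qed
  then have m1: "highest_root_coeff \<Phi> \<alpha> 1 = 3" using \<theta> by simp
  define f where "f a b = (1/6) *\<^sub>R (a *\<^sub>R \<omega> 1 + b *\<^sub>R \<omega> 2)" for a b :: real
  have f_apply: "f a b v = (a * \<omega> 1 v + b * \<omega> 2 v) / 6" for a b v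
    by (simp add: f_def blinfun.add_left blinfun.scaleR_left)
  have o1: "scaled_coweight \<Phi> \<alpha> 1 /\<^sub>R 2 = f 1 0"
    unfolding scaled_coweight_def m1 by (simp add: f_def)
  have f_refl: "dual_reflection (\<alpha> 1) (f a b) = f (- a) (3 * a + b)" "dual_reflection (\<alpha> 2) (f a b) = f (a + b) (- b)" for a b
    by (rule blinfun_eqI, unfold dual_reflection_apply f_apply apply1 apply2, simp add: algebra_simps)+
  define g where "g i = (if i = 0 then f 1 0 else if i = 1 then f 1 (-3) else f (-2) 3)" for i :: nat
  have f_minus: "- f a b = f (- a) (- b)" for a b
    by (rule blinfun_eqI) (simp add: f_apply blinfun.minus_left field_simps)
  have I3: "{..<3} = {0, 1, 2::nat}" by auto
  define S where "S = {f 1 0, f 1 (-3), f (-2) 3, f (-1) 0, f (-1) 3, f 2 (-3)}"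
  have S_eq: "S = g ` {..<3} \<union> (\<lambda>i. - g i) ` {..<3}"
    unfolding I3 S_def by (simp add: g_def f_minus insert_commute)
  have orbit: "weyl_orbit \<Phi> (f 1 0) = S"
  proof
    show "weyl_orbit \<Phi> (f 1 0) \<subseteq> S"
    proof (rule weyl_orbit_subset_simple)
      fix i y assume "i \<in> {1..n}" "y \<in> S"
      then show "dual_reflection (\<alpha> i) y \<in> S" unfolding idx S_def by (auto simp: f_refl)
    qed (simp add: S_def)
    have step: "f (- a) (3 * a + b) \<in> weyl_orbit \<Phi> (f 1 0)" "f (a + b) (- b) \<in> weyl_orbit \<Phi> (f 1 0)"
      if "f a b \<in> weyl_orbit \<Phi> (f 1 0)" for a b
      using weyl_orbit_dual_reflection[OF that simple_root[OF mem(1)]]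
        weyl_orbit_dual_reflection[OF that simple_root[OF mem(2)]] by (simp_all add: f_refl)
    have f1: "f 1 0 \<in> weyl_orbit \<Phi> (f 1 0)" by (rule weyl_orbit_self)
    have f2: "f (-1) 3 \<in> weyl_orbit \<Phi> (f 1 0)" using step(1)[OF f1] by simp
    have f3: "f 2 (-3) \<in> weyl_orbit \<Phi> (f 1 0)" using step(2)[OF f2] by simp
    have f4: "f (-2) 3 \<in> weyl_orbit \<Phi> (f 1 0)" using step(1)[OF f3] by simp
    have f5: "f 1 (-3) \<in> weyl_orbit \<Phi> (f 1 0)" using step(2)[OF f4] by simp
    have f6: "f (-1) 0 \<in> weyl_orbit \<Phi> (f 1 0)" using step(1)[OF f5] by simp
    show "S \<subseteq> weyl_orbit \<Phi> (f 1 0)" unfolding S_def using f1 f2 f3 f4 f5 f6 by simp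
  qed
  have fa: "f a b (\<alpha> 1) = a / 6" "f a b (\<alpha> 2) = b / 6" for a b by (simp_all add: f_apply \<omega>\<alpha>[simplified])
  have f_inj: "f a b = f a' b' \<longleftrightarrow> a = a' \<and> b = b'" for a b a' b'
  proof
    assume eq: "f a b = f a' b'"
    show "a = a' \<and> b = b'" using fa[of a b] fa[of a' b'] unfolding eq by auto
  qed simp
  have inj: "inj_on g {..<3}" unfolding I3 by (auto simp: inj_on_def g_def f_inj)
  have ne: "g i \<noteq> - g j" if "i \<in> {..<3}" "j \<in> {..<3}" for i j
    using that unfolding I3 by (auto simp: g_def f_inj f_minus)
  have sum_g: "(\<Sum>i<3. c i *\<^sub>R g i) v = c 0 * f 1 0 v + c 1 * f 1 (-3) v + c 2 * f (-2) 3 v"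
    for c :: "nat \<Rightarrow> real" and v
    unfolding I3 by (simp add: g_def blinfun.add_left blinfun.scaleR_left)
  have ZT_eq: "ZT S = {\<Sum>i<3. c i *\<^sub>R g i |c. \<forall>i\<in>{..<3}. -1 \<le> c i \<and> c i \<le> 1}"
    unfolding S_eq by (rule ZT_image_symmetric[OF finite_lessThan inj]) (rule ne)
  show ?thesis
    unfolding o1 orbit ZT_eq polar_root_polytope_eq
  proof (intro subset_antisym subsetI)
    fix z assume "z \<in> {\<Sum>i<3. c i *\<^sub>R g i |c. \<forall>i\<in>{..<3}. -1 \<le> c i \<and> c i \<le> 1}"
    then obtain c where c: "\<forall>i\<in>{..<3}. -1 \<le> c i \<and> c i \<le> 1" "z = (\<Sum>i<3. c i *\<^sub>R g i)" by blast
    have c3: "-1 \<le> c 0" "c 0 \<le> 1" "-1 \<le> c 1" "c 1 \<le> 1" "-1 \<le> c 2" "c 2 \<le> 1"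
      using c(1) unfolding I3 by auto
    have "z b \<le> 1" if b: "b \<in> \<Phi>" for b
      using form[OF b] c3 unfolding R_def c(2) sum_g f_apply by auto
    then show "z \<in> {x. \<forall>a\<in>\<Phi>. blinfun_apply x a \<le> 1}" by simp
  next
    fix z :: "'a \<Rightarrow>\<^sub>L real" assume "z \<in> {x. \<forall>a\<in>\<Phi>. blinfun_apply x a \<le> 1}"
    then have z: "z b \<le> 1" if "b \<in> \<Phi>" for b using that by simp
    define p q where "p = z (\<alpha> 1)" and "q = z (\<alpha> 2)"
    have z_eq: "z = p *\<^sub>R \<omega> 1 + q *\<^sub>R \<omega> 2"
      by (rule eqI; simp only: \<omega>\<alpha> blinfun.add_left blinfun.scaleR_left; simp add: p_def q_def)
    have bound: "\<bar>p * a + q * b\<bar> \<le> 1" if r: "root a b" for a b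
    proof -
      obtain v where v: "v \<in> \<Phi>" "\<omega> 1 v = a" "\<omega> 2 v = b" using r unfolding root_def by blast
      have "z v = p * a + q * b" unfolding z_eq by (simp only: blinfun.add_left blinfun.scaleR_left v) simp
      then show ?thesis using z[OF v(1)] z[OF minus_root[OF v(1)]] by (simp add: blinfun.minus_right)
    qed
    note bounds = bound[OF r1] bound[OF r2] bound[OF r3]
    obtain r where r: "\<bar>- (6 * p + 2 * q) - r\<bar> \<le> 1" "\<bar>2 * q - r\<bar> \<le> 1" "\<bar>r\<bar> \<le> 1"
      using symmetric_interval_Helly[of 0 "- (6 * p + 2 * q)" "2 * q" 0] bounds
      by (auto simp: abs_le_iff)
    \<comment> \<open>the coefficients for which \<open>g 2\<close> has the coefficient \<open>r\<close>\<close>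
    define c where "c i = (if i = 0 then 6 * p + 2 * q + r else if i = 1 then r - 2 * q else r)" for i :: nat
    have "z = (\<Sum>i<3. c i *\<^sub>R g i)"
      by (rule blinfun_eqI) (simp add: sum_g c_def f_apply z_eq blinfun.add_left blinfun.scaleR_left field_simps)
    moreover have "\<forall>i\<in>{..<3}. -1 \<le> c i \<and> c i \<le> 1" unfolding I3 c_def using r by (simp add: abs_le_iff)
    ultimately show "z \<in> {\<Sum>i<3. c i *\<^sub>R g i |c. \<forall>i\<in>{..<3}. -1 \<le> c i \<and> c i \<le> 1}" by blast
  qed
qed

end

section \<open>Zonotopal polar root polytopes\<close>

theorem theorem2p2:
  fixes \<Phi> :: "'a::euclidean_space set"
  assumes "root_system \<Phi>" and "crystallographic \<Phi>" and "irreducible_roots \<Phi>"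
  shows "(\<forall>\<alpha>. type_A \<Phi> \<alpha> \<or> type_C \<Phi> \<alpha> \<longrightarrow>
             polar_root_polytope \<Phi> = ZT (weyl_orbit \<Phi> (scaled_coweight \<Phi> \<alpha> 1))) \<and>
         (\<forall>\<alpha>. type_B3 \<Phi> \<alpha> \<longrightarrow>
             polar_root_polytope \<Phi> = ZT (weyl_orbit \<Phi> (scaled_coweight \<Phi> \<alpha> 3 /\<^sub>R 2))) \<and>
         (\<forall>\<alpha>. type_G2 \<Phi> \<alpha> \<longrightarrow>
             polar_root_polytope \<Phi> = ZT (weyl_orbit \<Phi> (scaled_coweight \<Phi> \<alpha> 1 /\<^sub>R 2))) \<and>
         ((\<nexists>\<alpha>. type_A \<Phi> \<alpha> \<or> type_C \<Phi> \<alpha> \<or> type_B3 \<Phi> \<alpha> \<or> type_G2 \<Phi> \<alpha>) \<longrightarrow>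
             \<not> zonotope (polar_root_polytope \<Phi>))"
proof -
  interpret irreducible_root_system \<Phi> by standard (rule assms)+
  have based: "based_root_system \<Phi> \<alpha> DIM('a)" if "root_basis \<Phi> \<alpha>" for \<alpha>
    by standard (use that in auto)
  show ?thesis
  proof (intro conjI allI impI)
    fix \<alpha> assume "type_A \<Phi> \<alpha> \<or> type_C \<Phi> \<alpha>"
    then show "polar_root_polytope \<Phi> = ZT (weyl_orbit \<Phi> (scaled_coweight \<Phi> \<alpha> 1))"
      using based_root_system.polar_type_A[OF based] based_root_system.polar_type_C[OF based]
      unfolding type_A_def type_C_def by blast
  next
    fix \<alpha> assume "type_B3 \<Phi> \<alpha>"
    then show "polar_root_polytope \<Phi> = ZT (weyl_orbit \<Phi> (scaled_coweight \<Phi> \<alpha> 3 /\<^sub>R 2))"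
      using based_root_system.polar_type_B3[OF based] unfolding type_B3_def by blast
  next
    fix \<alpha> assume "type_G2 \<Phi> \<alpha>"
    then show "polar_root_polytope \<Phi> = ZT (weyl_orbit \<Phi> (scaled_coweight \<Phi> \<alpha> 1 /\<^sub>R 2))"
      using based_root_system.polar_type_G2[OF based] unfolding type_G2_def by blast
  next
    assume "\<nexists>\<alpha>. type_A \<Phi> \<alpha> \<or> type_C \<Phi> \<alpha> \<or> type_B3 \<Phi> \<alpha> \<or> type_G2 \<Phi> \<alpha>"
    then show "\<not> zonotope (polar_root_polytope \<Phi>)"
      using zonotope_imp_star_free star_free_imp_type by blast
  qed
qed

end
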